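(* Let $\mathcal{P}$ be a finite classical polar space of rank $d$ and with parameter $e$ over $\mathbb{F}_q$, let $\mathcal{L}$ be a set of generators of $\mathcal{P}$ with characteristic vector $\boldsymbol{\chi}$, let $K$ be the generator disjointness matrix of $\mathcal{P}$, and let $V_0\perp\dots\perp V_d$ be the eigenspace decomposition described in the context. Put $x=|\mathcal{L}|/\prod_{i=0}^{d-2}(q^{e+i}+1)$. The following are equivalent: (i) for every generator $\pi$ of $\mathcal{P}$, the number of elements of $\mathcal{L}$ disjoint from $\pi$ equals $(x-(\boldsymbol{\chi})_\pi)q^{\binom{d-1}{2}+e(d-1)}$; (ii) the vector $\boldsymbol{\chi}-\frac{x}{q^{d+e-1}+1}\boldsymbol{j}$ lies in the eigenspace of $K$ for the eigenvalue $-q^{\binom{d-1}{2}+e(d-1)}$; (iii) $\boldsymbol{\chi}\in V_0\perp V_1\perp V_{d-1}$ if $d$ is even and $e=0$; $\boldsymbol{\chi}\in V_0\perp V_1\perp V_d$ if $d$ is odd and $e=1$; and $\boldsymbol{\chi}\in V_0\perp V_1$ in all other cases. If $\mathcal{P}$ admits a spread, then the following are also equivalent to (i)–(iii): (iv) $|\mathcal{L}\cap\mathcal{S}|=x$ for every spread $\mathcal{S}$ of $\mathcal{P}$; (v) $|\mathcal{L}\cap\mathcal{S}|=x$ for every spread $\mathcal{S}\in\mathcal{C}$, where $\mathcal{C}$ is a class of spreads which is a union of some orbits under the action of an automorphism group of $\mathcal{P}$ acting transitively on the ordered pairs of disjoint generators of $\mathcal{P}$.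
   Context: A finite classical polar space of rank $d$ is the geometry of totally isotropic subspaces (viewed projectively) of a non-degenerate quadratic or reflexive sesquilinear form; types and parameters $e$: $\mathcal{Q}^{+}(2d-1,q)$ ($e=0$), $\mathcal{H}(2d-1,q)$, $q$ a square ($e=1/2$), $\mathcal{W}(2d-1,q)$ ($e=1$), $\mathcal{Q}(2d,q)$ ($e=1$), $\mathcal{H}(2d,q)$, $q$ a square ($e=3/2$), $\mathcal{Q}^{-}(2d+1,q)$ ($e=2$). Generators are subspaces of projective dimension $d-1$; disjoint means trivial intersection; $\Omega$ denotes the set of generators, $\boldsymbol{j}$ the all-one vector in $\mathbb{R}^{\Omega}$, and $K$ the $\Omega\times\Omega$ 0/1 matrix with entry 1 iff the generators are disjoint. A spread is a set of generators such that every point of $\mathcal{P}$ lies in exactly one of them. The dual polar graph (generators adjacent iff they meet in a $(d-2)$-space) is distance-regular of diameter $d$, generators at distance $j$ meeting in a $(d-j-1)$-space; its association scheme yields an orthogonal decomposition $\mathbb{R}^{\Omega}=V_0\perp V_1\perp\dots\perp V_d$ into the common eigenspaces of the distance matrices, with $V_0=\langle\boldsymbol{j}\rangle$, ordered so that for each $k=1,\dots,d$ one has $\mathrm{im}(C_k^t)=V_0\perp\dots\perp V_k$, where $C_k$ is the incidence matrix between $(k-1)$-spaces and generators of $\mathcal{P}$. *)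

theory Defs
  imports "HOL-Analysis.Analysis" "HOL-Algebra.Bij"
begin

section \<open>Forms on a finite vector space\<close>

definition sesquilinear :: "('a::field \<Rightarrow> 'a) \<Rightarrow> ('a ^ 'n \<Rightarrow> 'a ^ 'n \<Rightarrow> 'a) \<Rightarrow> bool" where
  "sesquilinear \<sigma> B \<longleftrightarrow>
     (\<forall>x y z. B (x + y) z = B x z + B y z) \<and>
     (\<forall>x y z. B x (y + z) = B x y + B x z) \<and>
     (\<forall>c x y. B (c *s x) y = c * B x y) \<and>
     (\<forall>c x y. B x (c *s y) = \<sigma> c * B x y)"

definition nondegenerate :: "('a::field ^ 'n \<Rightarrow> 'a ^ 'n \<Rightarrow> 'a) \<Rightarrow> bool" where
  "nondegenerate B \<longleftrightarrow> (\<forall>x. (\<forall>y. B x y = 0) \<longrightarrow> x = 0)"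

definition symplectic_form :: "('a::field ^ 'n \<Rightarrow> 'a ^ 'n \<Rightarrow> 'a) \<Rightarrow> bool" where
  "symplectic_form B \<longleftrightarrow> sesquilinear (\<lambda>c. c) B \<and> (\<forall>x. B x x = 0) \<and> nondegenerate B"

text \<open>The field has square order \<open>r\<^sup>2\<close>, and \<open>c \<mapsto> c ^ r\<close> is its automorphism of order 2.\<close>

definition hermitian_form :: "('a::{field,finite} ^ 'n \<Rightarrow> 'a ^ 'n \<Rightarrow> 'a) \<Rightarrow> bool" where
  "hermitian_form B \<longleftrightarrow>
     (\<exists>r. r\<^sup>2 = CARD('a) \<and> sesquilinear (\<lambda>c. c ^ r) B \<and> (\<forall>x y. B y x = B x y ^ r)) \<and>
     nondegenerate B"

definition polar_form :: "('a::field ^ 'n \<Rightarrow> 'a) \<Rightarrow> 'a ^ 'n \<Rightarrow> 'a ^ 'n \<Rightarrow> 'a" where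
  "polar_form Q x y = Q (x + y) - Q x - Q y"

text \<open>
  Non-degeneracy is required of \<open>Q\<close>, not of its polar form: in even characteristic
  and odd dimension the polar form of a non-degenerate \<open>Q\<close> has a one-dimensional radical.
\<close>

definition nondegenerate_quadratic_form :: "('a::field ^ 'n \<Rightarrow> 'a) \<Rightarrow> bool" where
  "nondegenerate_quadratic_form Q \<longleftrightarrow>
     (\<forall>c x. Q (c *s x) = c\<^sup>2 * Q x) \<and>
     sesquilinear (\<lambda>c. c) (polar_form Q) \<and>
     (\<forall>x. Q x = 0 \<and> (\<forall>y. polar_form Q x y = 0) \<longrightarrow> x = 0)"

section \<open>Finite classical polar spaces\<close>

text \<open>
  In this order: \<open>Q\<^sup>+(2d-1,q)\<close>, \<open>H(2d-1,q)\<close>, \<open>W(2d-1,q)\<close>, \<open>Q(2d,q)\<close>, \<open>H(2d,q)\<close>, \<open>Q\<^sup>-(2d+1,q)\<close>.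
\<close>

datatype polar_type =
  Hyperbolic | Hermitian_odd | Symplectic | Parabolic | Hermitian_even | Elliptic

text \<open>Dimension of the underlying vector space, one more than the projective dimension.\<close>

fun ambient_dim :: "polar_type \<Rightarrow> nat \<Rightarrow> nat" where
  "ambient_dim Hyperbolic d = 2 * d"
| "ambient_dim Hermitian_odd d = 2 * d"
| "ambient_dim Symplectic d = 2 * d"
| "ambient_dim Parabolic d = 2 * d + 1"
| "ambient_dim Hermitian_even d = 2 * d + 1"
| "ambient_dim Elliptic d = 2 * d + 2"

fun polar_param :: "polar_type \<Rightarrow> real" where
  "polar_param Hyperbolic = 0"
| "polar_param Hermitian_odd = 1 / 2"
| "polar_param Symplectic = 1"
| "polar_param Parabolic = 1"
| "polar_param Hermitian_even = 3 / 2"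
| "polar_param Elliptic = 2"

definition quadric :: "('a::field ^ 'n \<Rightarrow> 'a) \<Rightarrow> ('a ^ 'n) set set" where
  "quadric Q = {U. vec.subspace U \<and> (\<forall>x\<in>U. Q x = 0)}"

definition isotropic_subspaces :: "('a::field ^ 'n \<Rightarrow> 'a ^ 'n \<Rightarrow> 'a) \<Rightarrow> ('a ^ 'n) set set" where
  "isotropic_subspaces B = {U. vec.subspace U \<and> (\<forall>x\<in>U. \<forall>y\<in>U. B x y = 0)}"

fun arises_from_form :: "polar_type \<Rightarrow> ('a::{field,finite} ^ 'n) set set \<Rightarrow> bool" where
  "arises_from_form Hyperbolic P = (\<exists>Q. nondegenerate_quadratic_form Q \<and> P = quadric Q)"
| "arises_from_form Parabolic P = (\<exists>Q. nondegenerate_quadratic_form Q \<and> P = quadric Q)"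
| "arises_from_form Elliptic P = (\<exists>Q. nondegenerate_quadratic_form Q \<and> P = quadric Q)"
| "arises_from_form Symplectic P = (\<exists>B. symplectic_form B \<and> P = isotropic_subspaces B)"
| "arises_from_form Hermitian_odd P = (\<exists>B. hermitian_form B \<and> P = isotropic_subspaces B)"
| "arises_from_form Hermitian_even P = (\<exists>B. hermitian_form B \<and> P = isotropic_subspaces B)"

text \<open>
  A polar space is the set of its totally isotropic (totally singular) subspaces, the zero
  subspace included. All dimensions are vector space dimensions, so the rank is the maximal
  dimension of a member. The three types of quadric are told apart by comparing the rank
  with the ambient dimension.
\<close>

definition classical_polar_space ::
  "polar_type \<Rightarrow> nat \<Rightarrow> ('a::{field,finite} ^ 'n) set set \<Rightarrow> bool" where
  "classical_polar_space T d P \<longleftrightarrow>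
     d \<ge> 1 \<and> CARD('n) = ambient_dim T d \<and> arises_from_form T P \<and>
     (\<exists>U\<in>P. vec.dim U = d) \<and> (\<forall>U\<in>P. vec.dim U \<le> d)"

definition generators :: "nat \<Rightarrow> ('a::field ^ 'n) set set \<Rightarrow> ('a ^ 'n) set set" where
  "generators d P = {U \<in> P. vec.dim U = d}"

definition disjoint_subspaces :: "('a::field ^ 'n) set \<Rightarrow> ('a ^ 'n) set \<Rightarrow> bool" where
  "disjoint_subspaces U W \<longleftrightarrow> U \<inter> W = {0}"

definition is_spread :: "nat \<Rightarrow> ('a::field ^ 'n) set set \<Rightarrow> ('a ^ 'n) set set \<Rightarrow> bool" where
  "is_spread d P S \<longleftrightarrow>
     S \<subseteq> generators d P \<and> (\<forall>p\<in>P. vec.dim p = 1 \<longrightarrow> (\<exists>!U. U \<in> S \<and> p \<subseteq> U))"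

section \<open>Automorphism groups\<close>

text \<open>
  Automorphisms are those of the incidence geometry; those induced by (semi)linear maps are
  among them. An automorphism group is any group of automorphisms, not only the full one.
\<close>

definition automorphism_group ::
  "('a::field ^ 'n) set set \<Rightarrow> (('a ^ 'n) set \<Rightarrow> ('a ^ 'n) set) set \<Rightarrow> bool" where
  "automorphism_group P A \<longleftrightarrow>
     subgroup A (BijGroup P) \<and> (\<forall>f\<in>A. \<forall>U\<in>P. \<forall>W\<in>P. f U \<subseteq> f W \<longleftrightarrow> U \<subseteq> W)"

definition transitive_on_disjoint_pairs ::
  "nat \<Rightarrow> ('a::field ^ 'n) set set \<Rightarrow> (('a ^ 'n) set \<Rightarrow> ('a ^ 'n) set) set \<Rightarrow> bool" where
  "transitive_on_disjoint_pairs d P A \<longleftrightarrow>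
     (\<forall>U1\<in>generators d P. \<forall>U2\<in>generators d P. \<forall>W1\<in>generators d P. \<forall>W2\<in>generators d P.
        disjoint_subspaces U1 U2 \<and> disjoint_subspaces W1 W2 \<longrightarrow>
        (\<exists>f\<in>A. f U1 = W1 \<and> f U2 = W2))"

definition spread_orbit ::
  "(('a ^ 'n) set \<Rightarrow> ('a ^ 'n) set) set \<Rightarrow> ('a ^ 'n) set set \<Rightarrow> ('a ^ 'n) set set set" where
  "spread_orbit A S = {f ` S |f. f \<in> A}"

text \<open>At least one orbit is required: the empty class would satisfy any universal condition.\<close>

definition union_of_spread_orbits ::
  "nat \<Rightarrow> ('a::field ^ 'n) set set \<Rightarrow> (('a ^ 'n) set \<Rightarrow> ('a ^ 'n) set) set
     \<Rightarrow> ('a ^ 'n) set set set \<Rightarrow> bool" where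
  "union_of_spread_orbits d P A C \<longleftrightarrow>
     (\<exists>R. R \<noteq> {} \<and> (\<forall>S\<in>R. is_spread d P S) \<and> C = (\<Union>S\<in>R. spread_orbit A S))"

section \<open>The dual polar graph and its eigenspaces\<close>

text \<open>
  From here on \<open>G\<close> is a bijection from a finite index type \<open>'g\<close> onto the set of generators,
  so that \<open>real ^ 'g\<close> is the space of real vectors indexed by the generators.
\<close>

definition char_vec :: "('g::finite \<Rightarrow> 'b) \<Rightarrow> 'b set \<Rightarrow> real ^ 'g" where
  "char_vec G L = (\<chi> i. if G i \<in> L then 1 else 0)"

definition all_one :: "real ^ 'g" where
  "all_one = (\<chi> i. 1)"

definition disjointness_matrix :: "('g::finite \<Rightarrow> ('a::field ^ 'n) set) \<Rightarrow> real ^ 'g ^ 'g" where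
  "disjointness_matrix G = (\<chi> i j. if disjoint_subspaces (G i) (G j) then 1 else 0)"

definition dual_polar_adjacent ::
  "nat \<Rightarrow> ('a::field ^ 'n) set set \<Rightarrow> ('a ^ 'n) set \<Rightarrow> ('a ^ 'n) set \<Rightarrow> bool" where
  "dual_polar_adjacent d P U W \<longleftrightarrow>
     U \<in> generators d P \<and> W \<in> generators d P \<and> vec.dim (U \<inter> W) + 1 = d"

definition dual_polar_distance ::
  "nat \<Rightarrow> ('a::field ^ 'n) set set \<Rightarrow> ('a ^ 'n) set \<Rightarrow> ('a ^ 'n) set \<Rightarrow> nat" where
  "dual_polar_distance d P U W = (LEAST m. (dual_polar_adjacent d P ^^ m) U W)"

definition distance_matrix ::
  "nat \<Rightarrow> ('a::field ^ 'n) set set \<Rightarrow> ('g::finite \<Rightarrow> ('a ^ 'n) set) \<Rightarrow> nat \<Rightarrow> real ^ 'g ^ 'g" where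
  "distance_matrix d P G m = (\<chi> i j. if dual_polar_distance d P (G i) (G j) = m then 1 else 0)"

text \<open>
  The rows are indexed by all sets of vectors. Those not indexed by a \<open>k\<close>-dimensional
  (projectively, \<open>(k-1)\<close>-dimensional) member of \<open>P\<close> are zero, which does not affect the
  image of the transpose.
\<close>

definition incidence_matrix ::
  "('a::{field,finite} ^ 'n) set set \<Rightarrow> ('g::finite \<Rightarrow> ('a ^ 'n) set) \<Rightarrow> nat
     \<Rightarrow> real ^ 'g ^ (('a ^ 'n) set)" where
  "incidence_matrix P G k = (\<chi> U i. if U \<in> P \<and> vec.dim U = k \<and> U \<subseteq> G i then 1 else 0)"

definition eigenspace :: "real ^ 'g ^ 'g \<Rightarrow> real \<Rightarrow> (real ^ 'g) set" where
  "eigenspace M \<theta> = {v. M *v v = \<theta> *\<^sub>R v}"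

definition common_eigenspace ::
  "nat \<Rightarrow> ('a::field ^ 'n) set set \<Rightarrow> ('g::finite \<Rightarrow> ('a ^ 'n) set) \<Rightarrow> (real ^ 'g) set \<Rightarrow> bool" where
  "common_eigenspace d P G E \<longleftrightarrow>
     E \<noteq> {0} \<and> (\<exists>\<theta>. E = (\<Inter>m\<le>d. eigenspace (distance_matrix d P G m) (\<theta> m)))"

text \<open>
  The last condition fixes the ordering of the eigenspaces, so there is exactly one such
  family \<open>V 0, \<dots>, V d\<close>.
\<close>

definition eigenspace_decomposition ::
  "nat \<Rightarrow> ('a::{field,finite} ^ 'n) set set \<Rightarrow> ('g::finite \<Rightarrow> ('a ^ 'n) set)
     \<Rightarrow> (nat \<Rightarrow> (real ^ 'g) set) \<Rightarrow> bool" where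
  "eigenspace_decomposition d P G V \<longleftrightarrow>
     (\<forall>k\<le>d. common_eigenspace d P G (V k)) \<and>
     (\<forall>i\<le>d. \<forall>j\<le>d. i \<noteq> j \<longrightarrow> (\<forall>u\<in>V i. \<forall>v\<in>V j. orthogonal u v)) \<and>
     span (\<Union>k\<le>d. V k) = UNIV \<and>
     V 0 = span {all_one} \<and>
     (\<forall>k\<in>{1..d}. range (\<lambda>w. transpose (incidence_matrix P G k) *v w) = span (\<Union>i\<le>k. V i))"

end

theory Submission
  imports Defs
begin

text \<open>
  Write \<open>K\<close> for the disjointness matrix and \<open>C\<^sub>k\<close> for the incidence matrices. The generators through
  a \<open>k\<close>-space \<open>U\<close> opposite to a generator \<open>\<pi>\<close> number \<open>c\<^sub>k = q powr (((d - k) choose 2) + e * (d - k))\<close>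
  if \<open>U\<close> is disjoint from \<open>\<pi>\<close>, and \<open>0\<close> otherwise. Moebius inversion on subspaces therefore writes
  the image of \<open>K\<close> composed with the transpose of \<open>C\<^sub>k\<close> in terms of the transposes of
  \<open>C\<^sub>0, \<dots>, C\<^sub>k\<close>, with leading factor \<open>(-1)^k * q^(k choose 2) * c\<^sub>k\<close>. Since \<open>K\<close> is symmetric, this
  factor is its eigenvalue on \<open>V k\<close>, and comparing exponents shows which \<open>V k\<close> share the
  eigenvalue of \<open>V 1\<close>.

  Spreads are orthogonal to that eigenspace: the projection of the unit vector of \<open>\<pi>\<close> is invariant
  under the stabiliser of \<open>\<pi>\<close>, which is transitive on the generators opposite to \<open>\<pi>\<close>, so it takes
  one value on all of them and its sum over a spread through \<open>\<pi>\<close> vanishes. Conversely, the number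
  of spreads through \<open>\<pi>\<close> and an opposite generator is constant by transitivity, and counting
  pairs recovers the condition on the numbers of disjoint elements.
\<close>

section \<open>Counting in finite vector spaces\<close>

text \<open>The number \<open>x / (q powr (d + e - 1) + 1)\<close> is the density of
  \<open>L\<close> among all generators, so (ii) removes the \<open>all_one\<close> component. A
  spread has \<open>q powr (d + e - 1) + 1\<close> members, so \<open>x\<close> is what this density
  predicts for its intersection with \<open>L\<close>. As \<open>all_one\<close> has the positive
  eigenvalue \<open>m * q powr (d + e - 1)\<close>, it is orthogonal to the eigenspace of
  \<open>- m\<close>.

  Two obstacles shape the proof. The six families are counted together, and in characteristic 2 the
  bilinear form of a quadric may have a radical. Hence dimensions of perpendicular spaces come from
  counting perpendicular pairs in two ways, and non-degeneracy enters through singular vectors only;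
  the type enters the counts through \<open>f\<close> and the ambient dimension, which combine into
  \<open>e\<close>. Secondly, (iv) concerns all spreads and comes with no group, so explicit
  isometries are built, whereas the group in (v) preserves only inclusion, so dimensions are
  recovered from chains of subspaces.\<close>

lemma card_field_ge2: "CARD('a::{field,finite}) \<ge> 2"
proof -
  have "card {0::'a, 1} \<le> CARD('a)" by (rule card_mono) auto
  then show ?thesis by simp
qed

lemma card_span_insert:
  fixes U :: "('a::{field,finite} ^ 'n) set"
  assumes U: "vec.subspace U" and y: "y \<notin> U"
  shows "card (vec.span (insert y U)) = CARD('a) * card U"
proof -
  let ?h = "\<lambda>(c::'a, u). c *s y + u"
  have "inj_on ?h (UNIV \<times> U)"
  proof (rule inj_onI, clarify)
    fix c c' :: 'a and u u'
    assume u: "u \<in> U" "u' \<in> U" and eq: "c *s y + u = c' *s y + u'"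
    have diff: "(c - c') *s y = u' - u"
      using eq by (simp add: vec.scale_left_diff_distrib algebra_simps)
    have "c = c'"
    proof (rule ccontr)
      assume "c \<noteq> c'"
      then have "y = inverse (c - c') *s (u' - u)"
        unfolding diff[symmetric] vec.scale_scale by simp
      then show False using u y U by (metis vec.subspace_diff vec.subspace_scale)
    qed
    with eq show "c = c' \<and> u = u'" by simp
  qed
  moreover have "?h ` (UNIV \<times> U) = vec.span (insert y U)"
  proof (intro equalityI subsetI)
    fix x assume "x \<in> ?h ` (UNIV \<times> U)"
    then show "x \<in> vec.span (insert y U)"
      by (auto intro: vec.span_add vec.span_scale vec.span_base)
  next
    fix x assume "x \<in> vec.span (insert y U)"
    then obtain k where k: "x - k *s y \<in> U"
      using U by (metis vec.span_breakdown_eq vec.span_eq_iff)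
    then have "x = ?h (k, x - k *s y)" by simp
    with k show "x \<in> ?h ` (UNIV \<times> U)" by blast
  qed
  ultimately have "card (vec.span (insert y U)) = card ((UNIV :: 'a set) \<times> U)"
    by (metis card_image)
  then show ?thesis by (simp add: card_cartesian_product)
qed

lemma card_subspace:
  fixes U :: "('a::{field,finite} ^ 'n) set"
  assumes U: "vec.subspace U"
  shows "card U = CARD('a) ^ vec.dim U"
proof -
  obtain B where B: "B \<subseteq> U" "vec.independent B" "U \<subseteq> vec.span B" "card B = vec.dim U"
    using vec.basis_exists by blast
  have "card (vec.span B) = CARD('a) ^ card B" using finite[of B] B(2)
  proof (induction B rule: finite_induct)
    case empty
    then show ?case by simp
  next
    case (insert a B)
    then have ind: "vec.independent B" "a \<notin> vec.span B"
      by (auto simp: vec.independent_insert)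
    have "vec.span (insert a B) = vec.span (insert a (vec.span B))"
      by (simp add: vec.span_breakdown_eq vec.span_span set_eq_iff)
    then show ?case using card_span_insert[OF vec.subspace_span ind(2)] insert ind by simp
  qed
  moreover have "vec.span B = U" using B U by (simp add: vec.span_subspace)
  ultimately show ?thesis using B by simp
qed

lemma dim_eq_iff_card:
  fixes U :: "('a::{field,finite} ^ 'n) set"
  assumes "vec.subspace U"
  shows "vec.dim U = k \<longleftrightarrow> card U = CARD('a) ^ k"
  using card_subspace[OF assms] card_field_ge2[where 'a = 'a] by simp

lemma dim_span_insert:
  fixes U :: "('a::{field,finite} ^ 'n) set"
  assumes "vec.subspace U" "y \<notin> U"
  shows "vec.dim (vec.span (insert y U)) = Suc (vec.dim U)"
  by (rule dim_eq_iff_card[OF vec.subspace_span, THEN iffD2])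
     (simp add: card_span_insert[OF assms] card_subspace[OF assms(1)])

lemma subspace_eqI:
  fixes U W :: "('a::{field,finite} ^ 'n) set"
  assumes "vec.subspace U" "vec.subspace W" "U \<subseteq> W" "vec.dim W \<le> vec.dim U"
  shows "U = W"
  using assms by (simp add: vec.subspace_dim_equal)

lemma span_insert_subset:
  assumes "vec.subspace T"
  shows "vec.span (insert y U) \<subseteq> T \<longleftrightarrow> y \<in> T \<and> U \<subseteq> T"
  using assms by (meson insert_subset order_trans vec.span_minimal vec.span_superset)

lemma in_span_insert_iff:
  assumes "vec.subspace U"
  shows "x \<in> vec.span (insert y U) \<longleftrightarrow> (\<exists>k. x - k *s y \<in> U)"
  using assms by (metis vec.span_breakdown_eq vec.span_eq_iff)

text \<open>Translation by a multiple of \<open>x0\<close> carries each fibre onto the kernel, so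
  the \<open>CARD('a)\<close> fibres share \<open>W\<close> equally.\<close>

lemma card_functional_fibre:
  fixes W :: "('a::{field,finite} ^ 'n) set" and g :: "'a ^ 'n \<Rightarrow> 'a"
  assumes W: "vec.subspace W"
    and add: "\<And>x y. g (x + y) = g x + g y" and scale: "\<And>c x. g (c *s x) = c * g x"
    and x0: "x0 \<in> W" "g x0 \<noteq> 0"
  shows "card {x \<in> W. g x = c} * CARD('a) = card W"
proof -
  have fib: "card {x \<in> W. g x = b} = card {x \<in> W. g x = 0}" for b
  proof (rule bij_betw_same_card)
    let ?v = "(b / g x0) *s x0"
    have v: "?v \<in> W" "g ?v = b" using W x0 scale by (auto simp: vec.subspace_scale)
    have diff: "g (x - ?v) = g x - b" for x
    proof -
      have "g x = g (x - ?v + ?v)" by simp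
      also have "\<dots> = g (x - ?v) + b" by (simp only: add v)
      finally show ?thesis by simp
    qed
    show "bij_betw (\<lambda>x. x - ?v) {x \<in> W. g x = b} {x \<in> W. g x = 0}"
      by (rule bij_betw_byWitness[where f' = "\<lambda>x. x + ?v"])
         (use v W add diff in \<open>auto intro: vec.subspace_add vec.subspace_diff\<close>)
  qed
  have "card W = card (\<Union>b. {x \<in> W. g x = b})" by (rule arg_cong[where f = card]) auto
  also have "\<dots> = (\<Sum>b\<in>UNIV. card {x \<in> W. g x = b})" by (rule card_UN_disjoint) auto
  also have "\<dots> = (\<Sum>b\<in>(UNIV :: 'a set). card {x \<in> W. g x = 0})" by (rule sum.cong[OF refl]) (rule fib)
  also have "\<dots> = CARD('a) * card {x \<in> W. g x = c}" by (simp add: fib[of c])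
  finally show ?thesis by simp
qed

lemma double_count:
  assumes "finite A" "finite B"
  shows "(\<Sum>x\<in>A. card {y \<in> B. R x y}) = (\<Sum>y\<in>B. card {x \<in> A. R x y})"
proof -
  have "(\<Sum>x\<in>A. card {y \<in> B. R x y}) = (\<Sum>x\<in>A. \<Sum>y\<in>B. if R x y then 1 else 0)"
    using assms by (intro sum.cong refl) (simp add: sum.If_cases Int_def)
  also have "\<dots> = (\<Sum>y\<in>B. \<Sum>x\<in>A. if R x y then 1 else 0)" by (rule sum.swap)
  also have "\<dots> = (\<Sum>y\<in>B. card {x \<in> A. R x y})"
    using assms by (intro sum.cong refl) (simp add: sum.If_cases Int_def)
  finally show ?thesis .
qed

text \<open>
  Induction on the codimension of \<open>U\<close>, double counting the pairs \<open>(y, T)\<close> with \<open>y \<in> T - U\<close>.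
\<close>

lemma count_top_members:
  fixes F :: "('a::{field,finite} ^ 'n) set set" and a :: "nat \<Rightarrow> real"
  assumes sub: "\<And>U. U \<in> F \<Longrightarrow> vec.subspace U"
    and dim: "\<And>U. U \<in> F \<Longrightarrow> vec.dim U \<le> t"
    and down: "\<And>U W. U \<in> F \<Longrightarrow> vec.subspace W \<Longrightarrow> W \<subseteq> U \<Longrightarrow> W \<in> F"
    and ext: "\<And>U. U \<in> F \<Longrightarrow> vec.dim U < t \<Longrightarrow>
      real (card {y. y \<notin> U \<and> vec.span (insert y U) \<in> F})
        = a (vec.dim U) * (real CARD('a) ^ t - real CARD('a) ^ vec.dim U)"
    and U: "U \<in> F"
  shows "real (card {T \<in> F. vec.dim T = t \<and> U \<subseteq> T}) = (\<Prod>i\<in>{vec.dim U..<t}. a i)"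
  using U
proof (induction "t - vec.dim U" arbitrary: U)
  case 0
  then have "vec.dim U = t" using dim[of U] by simp
  moreover have "T = U" if "T \<in> F" "vec.dim T = t" "U \<subseteq> T" for T
    using subspace_eqI[OF sub sub, of U T] 0(2) that \<open>vec.dim U = t\<close> by simp
  ultimately have "{T \<in> F. vec.dim T = t \<and> U \<subseteq> T} = {U}" using 0(2) by blast
  then show ?case using \<open>vec.dim U = t\<close> by simp
next
  case (Suc r)
  let ?q = "real CARD('a)" and ?k = "vec.dim U"
  let ?top = "\<lambda>U. {T \<in> F. vec.dim T = t \<and> U \<subseteq> T}"
  let ?Y = "{y. y \<notin> U \<and> vec.span (insert y U) \<in> F}"
  have k: "?k < t" and sU: "vec.subspace U" using Suc sub by auto
  have q: "?q \<ge> 2" using card_field_ge2[where 'a = 'a] by simp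
  have pos: "?q ^ t - ?q ^ ?k > 0" using k q by (simp add: power_strict_increasing)
  have left: "card {y \<in> - U. y \<in> T} = CARD('a) ^ t - CARD('a) ^ ?k" if "T \<in> ?top U" for T
  proof -
    have "{y \<in> - U. y \<in> T} = T - U" by auto
    then show ?thesis using that card_subspace[OF sU] card_subspace[OF sub[of T]]
      by (simp add: card_Diff_subset)
  qed
  have right: "real (card {T \<in> ?top U. y \<in> T}) = (if y \<in> ?Y then (\<Prod>i\<in>{Suc ?k..<t}. a i) else 0)"
    if y: "y \<notin> U" for y
  proof -
    have "vec.span (insert y U) \<subseteq> T \<longleftrightarrow> y \<in> T \<and> U \<subseteq> T" if "T \<in> F" for T
      by (rule span_insert_subset[OF sub[OF that]])
    then have eq: "{T \<in> ?top U. y \<in> T} = ?top (vec.span (insert y U))" by blast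
    show ?thesis
    proof (cases "y \<in> ?Y")
      case True
      have d: "vec.dim (vec.span (insert y U)) = Suc ?k" by (rule dim_span_insert[OF sU y])
      with True Suc(2) Suc(1)[of "vec.span (insert y U)"] show ?thesis
        unfolding eq d by simp
    next
      case False
      then have "?top (vec.span (insert y U)) = {}" using y down by auto
      then show ?thesis unfolding eq using False by (simp only: card.empty if_False)
    qed
  qed
  \<comment> \<open>Each \<open>T\<close> above \<open>U\<close> contributes
    \<open>q ^ t - q ^ k\<close> vectors \<open>y\<close>, the very factor that \<open>ext\<close>
    splits off; it cancels at the end and leaves \<open>a k\<close>.\<close>
  have "real (card (?top U)) * (?q ^ t - ?q ^ ?k) = real (\<Sum>T\<in>?top U. card {y \<in> - U. y \<in> T})"
    using left k by (simp add: of_nat_diff power_increasing)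
  also have "\<dots> = (\<Sum>y\<in>- U. real (card {T \<in> ?top U. y \<in> T}))"
    by (subst double_count) (auto simp: of_nat_sum)
  also have "\<dots> = (\<Sum>y\<in>- U. if y \<in> ?Y then (\<Prod>i\<in>{Suc ?k..<t}. a i) else 0)"
    by (rule sum.cong[OF refl]) (rule right, simp)
  also have "\<dots> = real (card ?Y) * (\<Prod>i\<in>{Suc ?k..<t}. a i)"
  proof -
    have "- U \<inter> ?Y = ?Y" by auto
    then show ?thesis by (simp only: sum.If_cases[OF finite] sum_constant Collect_mem_eq)
  qed
  also have "\<dots> = (\<Prod>i\<in>{?k..<t}. a i) * (?q ^ t - ?q ^ ?k)"
    using ext[OF Suc(3) k] k by (simp add: prod.atLeast_Suc_lessThan)
  finally show ?case using pos by simp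
qed

section \<open>Polar spaces of reflexive forms\<close>

text \<open>
  One set of axioms for all types. \<open>N\<close> is the quadratic form, or \<open>x \<mapsto> B x x\<close> for a
  Hermitian form, or \<open>0\<close> for a symplectic form; \<open>f\<close> is the proportion of vectors of a coset
  \<open>y + U\<close> on which \<open>N\<close> vanishes if \<open>U\<close> is totally singular and not perpendicular to \<open>y\<close>.
\<close>

locale polar_space =
  fixes B :: "'a::{field,finite} ^ 'n \<Rightarrow> 'a ^ 'n \<Rightarrow> 'a"
    and N :: "'a ^ 'n \<Rightarrow> 'a"
    and \<sigma> t :: "'a \<Rightarrow> 'a"
    and \<epsilon> :: 'a
    and d :: nat
    and q e f :: real
    and P :: "('a ^ 'n) set set"
  assumes q_eq: "q = real CARD('a)"
    and B_add_left: "B (x + y) z = B x z + B y z"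
    and B_add_right: "B x (y + z) = B x y + B x z"
    and B_scale_left: "B (c *s x) y = c * B x y"
    and B_scale_right: "B x (c *s y) = \<sigma> c * B x y"
    and B_swap: "B y x = \<epsilon> * \<sigma> (B x y)"
    and \<sigma>_mult: "\<sigma> (a * b) = \<sigma> a * \<sigma> b"
    and \<sigma>_eq_0: "\<sigma> c = 0 \<longleftrightarrow> c = 0"
    and N_add: "N (x + y) = N x + N y + t (B x y)"
    and N_scale: "N (c *s x) = c * \<sigma> c * N x"
    and t_add: "t (a + b) = t a + t b"
    and t_norm: "t (c * \<sigma> c * b) = c * \<sigma> c * t b"
    and B_self: "N x = 0 \<Longrightarrow> B x x = 0"
    and nondeg: "N x = 0 \<Longrightarrow> (\<And>y. B x y = 0) \<Longrightarrow> x = 0"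
    and card_t: "real (card {c. t c = - N x}) = f * q"
    and P_eq: "P = {U. vec.subspace U \<and> (\<forall>x\<in>U. N x = 0) \<and> (\<forall>x\<in>U. \<forall>y\<in>U. B x y = 0)}"
    and rank_pos: "d \<ge> 1"
    and rank_attained: "\<exists>U\<in>P. vec.dim U = d"
    and dim_le_rank: "U \<in> P \<Longrightarrow> vec.dim U \<le> d"
    and param: "f * q ^ CARD('n) = q powr (2 * real d + e - 1)"
begin

section \<open>Elementary algebra of the form and of totally singular subspaces\<close>

definition perp :: "('a ^ 'n) set \<Rightarrow> ('a ^ 'n) set" where
  "perp U = {x. \<forall>u\<in>U. B x u = 0}"

lemma q_gt_1: "q > 1" and q_pos: "q > 0"
  using card_field_ge2[where 'a = 'a] by (simp_all add: q_eq)

lemma perpD: "x \<in> perp U \<Longrightarrow> u \<in> U \<Longrightarrow> B x u = 0"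
  by (simp add: perp_def)

lemma t_0: "t 0 = 0"
  by (metis t_add add.right_neutral add_left_cancel)

lemma t_uminus: "t (- a) = - t a"
  using t_add[of a "- a"] t_0 by (simp add: add_eq_0_iff)

lemma B_0_left [simp]: "B 0 y = 0"
  using B_scale_left[of 0 0 y] by simp

lemma B_eq_0_swap: "B x y = 0 \<longleftrightarrow> B y x = 0"
  using B_swap[of x y] B_swap[of y x] \<sigma>_eq_0[of 0] by auto

lemma B_0_right [simp]: "B x 0 = 0"
  using B_eq_0_swap[of x 0] by simp

lemma B_uminus_right: "B x (- y) = - B x y"
  using B_add_right[of x y "- y"] by (simp add: add_eq_0_iff)

lemma B_diff_left: "B (x - y) z = B x z - B y z"
  using B_add_left[of "x - y" y z] by simp

lemma B_diff_right: "B z (x - y) = B z x - B z y"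
  using B_add_right[of z "x - y" y] by simp

lemma N_0: "N 0 = 0"
  using N_scale[of 0 0] by simp

lemma N_add_perp: "B x y = 0 \<Longrightarrow> N (x + y) = N x + N y"
  by (simp add: N_add t_0)

lemma subspace_perp: "vec.subspace (perp U)"
  by (rule vec.subspaceI) (auto simp: perp_def B_add_left B_scale_left)

lemma mem_perp_swap: "x \<in> perp U \<longleftrightarrow> (\<forall>u\<in>U. B u x = 0)"
  by (auto simp: perp_def B_eq_0_swap[of x])

lemma P_subspace: "U \<in> P \<Longrightarrow> vec.subspace U"
  and P_N: "U \<in> P \<Longrightarrow> x \<in> U \<Longrightarrow> N x = 0"
  and P_B: "U \<in> P \<Longrightarrow> x \<in> U \<Longrightarrow> y \<in> U \<Longrightarrow> B x y = 0"
  unfolding P_eq by auto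

lemma P_subset_perp: "U \<in> P \<Longrightarrow> U \<subseteq> perp U"
  by (auto simp: perp_def P_B)

lemma P_down: "U \<in> P \<Longrightarrow> vec.subspace W \<Longrightarrow> W \<subseteq> U \<Longrightarrow> W \<in> P"
  unfolding P_eq by blast

lemma zero_in_P: "{0} \<in> P"
  unfolding P_eq by (simp add: N_0)

lemma P_sum:
  assumes U: "U \<in> P" and W: "W \<in> P" and WU: "W \<subseteq> perp U"
  shows "{u + w |u w. u \<in> U \<and> w \<in> W} \<in> P"
proof -
  have "N (u + w) = 0" if "u \<in> U" "w \<in> W" for u w
    using that WU P_N[OF U] P_N[OF W] by (auto simp: N_add_perp mem_perp_swap)
  moreover have "B (u + w) (u' + w') = 0" if "u \<in> U" "w \<in> W" "u' \<in> U" "w' \<in> W" for u w u' w'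
  proof -
    have "B u w' = 0" using that WU by (auto simp: mem_perp_swap)
    moreover have "B w u' = 0" using that WU by (auto simp: perp_def)
    ultimately show ?thesis
      using that P_B[OF U, of u u'] P_B[OF W, of w w'] by (simp add: B_add_left B_add_right)
  qed
  moreover have "vec.subspace {u + w |u w. u \<in> U \<and> w \<in> W}"
    using U W by (intro vec.subspace_sums P_subspace)
  ultimately show ?thesis unfolding P_eq by blast
qed

lemma span_singleton_in_P:
  assumes y: "N y = 0"
  shows "vec.span {y} \<in> P"
proof -
  have "\<forall>x\<in>vec.span {y}. N x = 0" "\<forall>x\<in>vec.span {y}. \<forall>z\<in>vec.span {y}. B x z = 0"
    by (auto simp: vec.span_singleton N_scale B_scale_left B_scale_right y B_self)
  then show ?thesis unfolding P_eq by simp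
qed

lemma span_insert_in_P_iff:
  assumes U: "U \<in> P"
  shows "vec.span (insert y U) \<in> P \<longleftrightarrow> N y = 0 \<and> y \<in> perp U"
proof
  assume *: "vec.span (insert y U) \<in> P"
  have "y \<in> vec.span (insert y U)" "U \<subseteq> vec.span (insert y U)"
    by (auto intro: vec.span_base)
  then show "N y = 0 \<and> y \<in> perp U" using P_N[OF *] P_B[OF *] by (auto simp: perp_def)
next
  assume y: "N y = 0 \<and> y \<in> perp U"
  have "vec.span {y} \<subseteq> perp U" using y by (simp add: vec.span_minimal subspace_perp)
  then have "{u + w |u w. u \<in> U \<and> w \<in> vec.span {y}} \<in> P"
    using P_sum[OF U] y span_singleton_in_P by blast
  moreover have "vec.span (insert y U) = {u + w |u w. u \<in> U \<and> w \<in> vec.span {y}}"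
  proof -
    have "vec.span U = U" using P_subspace[OF U] by simp
    moreover have "insert y U = U \<union> {y}" by simp
    ultimately show ?thesis by (simp only: vec.span_Un)
  qed
  ultimately show "vec.span (insert y U) \<in> P" by simp
qed

section \<open>Generators and the sizes of perpendicular spaces\<close>

lemma generatorsD: "\<pi> \<in> generators d P \<Longrightarrow> \<pi> \<in> P" "\<pi> \<in> generators d P \<Longrightarrow> vec.dim \<pi> = d"
  by (simp_all add: generators_def)

lemma generatorsI: "\<pi> \<in> P \<Longrightarrow> vec.dim \<pi> = d \<Longrightarrow> \<pi> \<in> generators d P"
  by (simp add: generators_def)

lemma card_generator: "\<pi> \<in> generators d P \<Longrightarrow> card \<pi> = CARD('a) ^ d"
  by (simp add: generators_def card_subspace P_subspace)

lemma generator_maximal: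
  assumes \<pi>: "\<pi> \<in> generators d P" and y: "N y = 0" "y \<in> perp \<pi>"
  shows "y \<in> \<pi>"
proof (rule ccontr)
  assume "y \<notin> \<pi>"
  then have "vec.dim (vec.span (insert y \<pi>)) = Suc d"
    using dim_span_insert[OF P_subspace[OF generatorsD(1)[OF \<pi>]]] generatorsD(2)[OF \<pi>]
    by simp
  moreover have "vec.span (insert y \<pi>) \<in> P"
    using \<pi> y by (simp add: generatorsD span_insert_in_P_iff)
  ultimately show False using dim_le_rank by fastforce
qed

text \<open>A vector \<open>u\<close> either is perpendicular to all of \<open>W\<close> or defines
  a nonzero functional on it, whose kernel is a share \<open>1 / q\<close> of
  \<open>W\<close>.\<close>

lemma card_orthogonal_pairs:
  assumes W: "vec.subspace W"
  shows "real (\<Sum>u\<in>U. card {x \<in> W. B x u = 0})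
    = real (card W) * (real (card (U \<inter> perp W)) * (1 - 1 / q) + real (card U) / q)"
proof -
  have "real (card {x \<in> W. B x u = 0})
      = real (card W) * ((if u \<in> perp W then 1 else 0) * (1 - 1 / q) + 1 / q)" for u
  proof (cases "u \<in> perp W")
    case True
    then have "{x \<in> W. B x u = 0} = W" by (auto simp: mem_perp_swap)
    then show ?thesis using True by simp
  next
    case False
    then obtain x0 where "x0 \<in> W" "B x0 u \<noteq> 0" by (auto simp: mem_perp_swap)
    then have "card {x \<in> W. B x u = 0} * CARD('a) = card W"
      by (intro card_functional_fibre[OF W]) (auto simp: B_add_left B_scale_left)
    then have "real (card {x \<in> W. B x u = 0}) * q = real (card W)"
      by (metis of_nat_mult q_eq)
    then show ?thesis using False q_pos by (simp add: field_simps)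
  qed
  then have "real (\<Sum>u\<in>U. card {x \<in> W. B x u = 0})
      = real (card W) * ((\<Sum>u\<in>U. if u \<in> perp W then 1 else 0) * (1 - 1 / q) + real (card U) / q)"
    by (simp add: of_nat_sum sum_distrib_left[symmetric] sum.distrib sum_distrib_right[symmetric])
  also have "(\<Sum>u\<in>U. if u \<in> perp W then 1 else 0 :: real) = real (card (U \<inter> perp W))"
    by (simp add: sum.If_cases)
  finally show ?thesis .
qed

text \<open>Perpendicular pairs are counted from both sides; the terms
  \<open>card U * card W / q\<close> agree and cancel. What remains is the dimension formula for
  annihilators, valid even if \<open>B\<close> has a radical.\<close>

lemma card_perp_swap:
  assumes U: "vec.subspace U" and W: "vec.subspace W"
  shows "card (W \<inter> perp U) * card U = card (U \<inter> perp W) * card W"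
proof -
  have "(\<Sum>u\<in>U. card {x \<in> W. B x u = 0}) = (\<Sum>x\<in>W. card {u \<in> U. B x u = 0})"
    by (rule double_count) auto
  also have "\<dots> = (\<Sum>x\<in>W. card {u \<in> U. B u x = 0})"
    by (simp add: B_eq_0_swap)
  finally have eq: "(\<Sum>u\<in>U. card {x \<in> W. B x u = 0}) = (\<Sum>x\<in>W. card {u \<in> U. B u x = 0})" .
  have "real (card W) * (real (card (U \<inter> perp W)) * (1 - 1 / q) + real (card U) / q)
      = real (card U) * (real (card (W \<inter> perp U)) * (1 - 1 / q) + real (card W) / q)"
    using arg_cong[where f = real, OF eq] by (simp only: card_orthogonal_pairs U W)
  then have "(real (card W) * real (card (U \<inter> perp W))) * (1 - 1 / q)
      = (real (card U) * real (card (W \<inter> perp U))) * (1 - 1 / q)"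
    by (simp add: algebra_simps)
  then have "real (card W) * real (card (U \<inter> perp W)) = real (card U) * real (card (W \<inter> perp U))"
    using q_gt_1 by simp
  then have "real (card W * card (U \<inter> perp W)) = real (card U * card (W \<inter> perp U))" by simp
  then show ?thesis by (simp only: of_nat_eq_iff mult.commute)
qed

text \<open>The radical \<open>perp UNIV\<close> contains no nonzero singular vector, so a totally
  singular \<open>U\<close> meets it trivially, and \<open>card_perp_swap\<close> with
  \<open>W = UNIV\<close> applies.\<close>

lemma card_perp:
  assumes U: "U \<in> P"
  shows "card (perp U) * card U = CARD('a) ^ CARD('n)"
proof -
  have "U \<inter> perp UNIV = {0}"
    using nondeg P_N[OF U] vec.subspace_0[OF P_subspace[OF U]] by (auto simp: perp_def)
  then show ?thesis
    using card_perp_swap[OF P_subspace[OF U] vec.subspace_UNIV] by (simp add: CARD_vec)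
qed

text \<open>A vector of \<open>U\<close> perpendicular to \<open>\<pi>\<close> already lies in
  \<open>\<pi>\<close> by maximality. Hence \<open>card_perp_swap\<close> reads dim
  (\<open>\<pi> \<inter> perp U\<close>) + dim \<open>U\<close> = dim of their intersection +
  \<open>d\<close>, which says that the join has dimension \<open>d\<close>.\<close>

lemma join_generator:
  assumes U: "U \<in> P" and \<pi>: "\<pi> \<in> generators d P"
  shows "{u + p |u p. u \<in> U \<and> p \<in> \<pi> \<inter> perp U} \<in> generators d P"
proof -
  let ?W = "\<pi> \<inter> perp U"
  note sU = P_subspace[OF U] and s\<pi> = P_subspace[OF generatorsD(1)[OF \<pi>]]
  have sW: "vec.subspace ?W" by (intro vec.subspace_inter s\<pi> subspace_perp)
  have W: "?W \<in> P" using P_down[OF generatorsD(1)[OF \<pi>] sW] by blast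
  have "U \<inter> perp \<pi> = U \<inter> ?W"
    using generator_maximal[OF \<pi>] P_N[OF U] P_subset_perp[OF U]
      P_subset_perp[OF generatorsD(1)[OF \<pi>]] by blast
  then have "card ?W * card U = card (U \<inter> ?W) * card \<pi>"
    using card_perp_swap[OF sU s\<pi>] by simp
  then have "CARD('a) ^ (vec.dim ?W + vec.dim U) = CARD('a) ^ (vec.dim (U \<inter> ?W) + d)"
    by (simp only: card_subspace sU s\<pi> sW vec.subspace_inter power_add generatorsD(2)[OF \<pi>])
  then have "vec.dim ?W + vec.dim U = vec.dim (U \<inter> ?W) + d"
    using card_field_ge2[where 'a = 'a] by (subst (asm) power_inject_exp) auto
  then have "vec.dim {u + p |u p. u \<in> U \<and> p \<in> ?W} = d"
    using vec.dim_sums_Int[OF sU sW] by simp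
  then show ?thesis using P_sum[OF U W] by (simp add: generatorsI)
qed

lemma generator_above:
  assumes "U \<in> P"
  obtains \<pi> where "\<pi> \<in> generators d P" "U \<subseteq> \<pi>"
proof -
  obtain \<rho> where \<rho>: "\<rho> \<in> generators d P" using rank_attained by (auto simp: generators_def)
  have "0 \<in> \<rho> \<inter> perp U"
    using vec.subspace_0[OF P_subspace[OF generatorsD(1)[OF \<rho>]]]
      vec.subspace_0[OF subspace_perp] by simp
  then have "U \<subseteq> {u + p |u p. u \<in> U \<and> p \<in> \<rho> \<inter> perp U}" by force
  then show thesis using that join_generator[OF assms \<rho>] by blast
qed

text \<open>On the coset, \<open>N (u + y) = N y + t (B u y)\<close>. As \<open>y\<close> is not
  perpendicular to \<open>\<pi>\<close>, the value \<open>B u y\<close> runs through all scalars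
  equally often, and \<open>card_t\<close> counts the \<open>f * q\<close> scalars that give
  zero.\<close>

lemma card_singular_in_coset:
  assumes \<pi>: "\<pi> \<in> generators d P" and y: "y \<notin> perp \<pi>"
  shows "real (card {u \<in> \<pi>. N (u + y) = 0}) = f * real (card \<pi>)"
proof -
  note sp = P_subspace[OF generatorsD(1)[OF \<pi>]]
  obtain x0 where "x0 \<in> \<pi>" "B x0 y \<noteq> 0" using y by (auto simp: mem_perp_swap)
  then have fib: "card {x \<in> \<pi>. B x y = c} * CARD('a) = card \<pi>" for c
    by (intro card_functional_fibre[OF sp]) (auto simp: B_add_left B_scale_left)
  have fib': "real (card {x \<in> \<pi>. B x y = c}) = real (card \<pi>) / q" for c
    using q_pos by (simp add: fib[of c, symmetric] q_eq)
  have "{u \<in> \<pi>. N (u + y) = 0} = (\<Union>c\<in>{c. t c = - N y}. {x \<in> \<pi>. B x y = c})"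
    using P_N[OF generatorsD(1)[OF \<pi>]] by (auto simp: N_add add_eq_0_iff)
  then have "card {u \<in> \<pi>. N (u + y) = 0} = (\<Sum>c\<in>{c. t c = - N y}. card {x \<in> \<pi>. B x y = c})"
    by (simp only:) (rule card_UN_disjoint, auto)
  then have "real (card {u \<in> \<pi>. N (u + y) = 0}) = (f * q) * (real (card \<pi>) / q)"
    by (simp add: fib' card_t[of y])
  then show ?thesis using q_pos by simp
qed

text \<open>The cosets of a generator through \<open>U\<close> partition \<open>perp U\<close>.\<close>

lemma card_singular_perp:
  assumes U: "U \<in> P"
  shows "real (card {y \<in> perp U. N y = 0})
    = q ^ d + q powr (2 * real d + e - 1 - real (vec.dim U)) - q powr (real d + e - 1)"
proof -
  obtain \<pi> where \<pi>: "\<pi> \<in> generators d P" "U \<subseteq> \<pi>" using generator_above[OF U] by blast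
  note pP = generatorsD(1)[OF \<pi>(1)] and sp = P_subspace[OF generatorsD(1)[OF \<pi>(1)]]
  have pU: "\<pi> \<subseteq> perp U" using P_B[OF pP] \<pi>(2) by (auto simp: perp_def)
  have perp_sub: "perp \<pi> \<subseteq> perp U" using \<pi>(2) by (auto simp: perp_def)
  have pp: "\<pi> \<subseteq> perp \<pi>" by (rule P_subset_perp[OF pP])
  have qd: "real (card \<pi>) = q ^ d" using card_generator[OF \<pi>(1)] by (simp add: q_eq)
  \<comment> \<open>A coset inside \<open>perp \<pi>\<close> is entirely singular or entirely
    non-singular, and by maximality it is singular only if it is \<open>\<pi>\<close> itself. Every
    other coset contributes the share \<open>f\<close>.\<close>
  have inner: "real (card {u \<in> \<pi>. N (u + y) = 0})
      = (if y \<in> \<pi> then q ^ d else 0) + (if y \<in> perp \<pi> then 0 else f * q ^ d)" for y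
  proof (cases "y \<in> perp \<pi>")
    case False
    then show ?thesis using card_singular_in_coset[OF \<pi>(1) False] qd pp by auto
  next
    case True
    then have "N (u + y) = N y" if "u \<in> \<pi>" for u
      using that P_N[OF pP that] by (simp add: N_add_perp mem_perp_swap)
    then have "{u \<in> \<pi>. N (u + y) = 0} = (if N y = 0 then \<pi> else {})" by auto
    moreover have "N y = 0 \<longleftrightarrow> y \<in> \<pi>" using generator_maximal[OF \<pi>(1)] True P_N[OF pP] by blast
    ultimately show ?thesis using True qd by simp
  qed
  have shift: "card {y \<in> perp U. N (u + y) = 0} = card {y \<in> perp U. N y = 0}" if "u \<in> \<pi>" for u
    by (rule bij_betw_same_card, rule bij_betw_byWitness[where f = "\<lambda>y. u + y" and f' = "\<lambda>y. y - u"])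
       (use that pU subspace_perp[of U] in \<open>auto simp: vec.subspace_add vec.subspace_diff subset_iff\<close>)
  have "q ^ d * real (card {y \<in> perp U. N y = 0})
      = real (\<Sum>u\<in>\<pi>. card {y \<in> perp U. N (u + y) = 0})"
    by (simp add: shift qd)
  also have "\<dots> = (\<Sum>y\<in>perp U. real (card {u \<in> \<pi>. N (u + y) = 0}))"
    by (subst double_count) auto
  also have "\<dots> = q ^ d * real (card \<pi>) + f * q ^ d * real (card (perp U - perp \<pi>))"
  proof -
    have "perp U \<inter> \<pi> = \<pi>" using pU by blast
    moreover have "perp U \<inter> - perp \<pi> = perp U - perp \<pi>" by blast
    ultimately show ?thesis unfolding inner by (simp add: sum.distrib sum.If_cases mult.commute)
  qed
  also have "\<dots> = q ^ d * (q ^ d + (f * real (card (perp U)) - f * real (card (perp \<pi>))))"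
    using card_mono[OF finite perp_sub]
    by (simp add: qd card_Diff_subset[OF finite perp_sub] of_nat_diff algebra_simps)
  finally have main: "real (card {y \<in> perp U. N y = 0})
      = q ^ d + (f * real (card (perp U)) - f * real (card (perp \<pi>)))"
    using q_pos by simp
  have perp: "f * real (card (perp W)) = q powr (2 * real d + e - 1 - real (vec.dim W))"
    if W: "W \<in> P" for W
  proof -
    have "real (card (perp W)) * q ^ vec.dim W = q ^ CARD('n)"
      using card_perp[OF W] unfolding card_subspace[OF P_subspace[OF W]]
      by (metis of_nat_mult of_nat_power q_eq)
    then have "f * real (card (perp W)) * q ^ vec.dim W = q powr (2 * real d + e - 1)"
      by (simp add: param mult.assoc)
    also have "\<dots> = q powr (2 * real d + e - 1 - real (vec.dim W)) * q ^ vec.dim W"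
      using q_pos by (simp add: powr_realpow[symmetric] powr_add[symmetric])
    finally show ?thesis using q_pos by simp
  qed
  have eq: "2 * real d + e - 1 - real (vec.dim \<pi>) = real d + e - 1"
    by (simp add: generatorsD(2)[OF \<pi>(1)])
  show ?thesis unfolding main perp[OF U] perp[OF pP] eq by simp
qed

section \<open>Numbers of generators through a subspace, and of those opposite to a given
  generator\<close>

lemma powr_split_rank:
  assumes "k \<le> d"
  shows "q powr (2 * real d + e - 1 - real k) = q powr (real d + e - 1 - real k) * q ^ d"
    and "q powr (real d + e - 1) = q powr (real d + e - 1 - real k) * q ^ k"
  using q_pos by (simp_all add: powr_realpow[symmetric] powr_add[symmetric] algebra_simps)

text \<open>The vectors extending \<open>W\<close> inside \<open>P\<close> are the singular vectors
  of \<open>perp W\<close> outside \<open>W\<close>. With \<open>k = vec.dim W\<close> and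
  \<open>s = q powr (d + e - 1 - k)\<close> there are \<open>(s + 1) * (q ^ d - q ^ k)\<close> of
  them, which is the shape required by \<open>count_top_members\<close>.\<close>

lemma card_generators_above:
  assumes U: "U \<in> P"
  shows "real (card {T \<in> generators d P. U \<subseteq> T})
    = (\<Prod>i\<in>{vec.dim U..<d}. q powr (real d + e - 1 - real i) + 1)"
proof -
  have "real (card {T \<in> P. vec.dim T = d \<and> U \<subseteq> T})
    = (\<Prod>i\<in>{vec.dim U..<d}. q powr (real d + e - 1 - real i) + 1)"
  proof (rule count_top_members[where a = "\<lambda>i. q powr (real d + e - 1 - real i) + 1"])
    fix W assume W: "W \<in> P" "vec.dim W < d"
    have "W \<subseteq> {y \<in> perp W. N y = 0}" using P_N P_subset_perp W by blast
    moreover have "{y. y \<notin> W \<and> vec.span (insert y W) \<in> P} = {y \<in> perp W. N y = 0} - W"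
      using W by (auto simp: span_insert_in_P_iff)
    ultimately have "real (card {y. y \<notin> W \<and> vec.span (insert y W) \<in> P})
        = real (card {y \<in> perp W. N y = 0}) - real (card W)"
      by (simp add: card_Diff_subset card_mono of_nat_diff)
    then show "real (card {y. y \<notin> W \<and> vec.span (insert y W) \<in> P})
        = (q powr (real d + e - 1 - real (vec.dim W)) + 1) * (real CARD('a) ^ d - real CARD('a) ^ vec.dim W)"
      using W powr_split_rank[of "vec.dim W"]
      by (simp add: card_singular_perp card_subspace P_subspace q_eq[symmetric] algebra_simps)
  qed (use U in \<open>auto intro: P_subspace dim_le_rank P_down\<close>)
  then show ?thesis by (simp add: generators_def conj_assoc)
qed

lemma card_generators:
  "real (card (generators d P)) = (\<Prod>i<d. q powr (e + real i) + 1)"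
proof -
  have "generators d P = {T \<in> generators d P. {0} \<subseteq> T}"
    using vec.subspace_0[OF P_subspace[OF generatorsD(1)]] by blast
  then have "real (card (generators d P)) = (\<Prod>i\<in>{0..<d}. q powr (real d + e - 1 - real i) + 1)"
    using card_generators_above[OF zero_in_P] by simp
  also have "\<dots> = (\<Prod>i<d. q powr (e + real i) + 1)"
    by (rule prod.reindex_bij_witness[of _ "\<lambda>i. d - 1 - i" "\<lambda>i. d - 1 - i"])
       (auto simp: of_nat_diff algebra_simps)
  finally show ?thesis .
qed

text \<open>The exponents are \<open>e\<close>, \<open>e + 1\<close>, ...,
  \<open>e + (d - k - 1)\<close>.\<close>

lemma prod_powr_rank:
  assumes "k \<le> d"
  shows "(\<Prod>i\<in>{k..<d}. q powr (real d + e - 1 - real i))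
    = q powr (real ((d - k) choose 2) + e * real (d - k))"
  using assms
proof (induction "d - k" arbitrary: k)
  case 0
  then show ?case using q_pos by (simp add: binomial_eq_0)
next
  case (Suc r)
  then have k: "k < d" "r = d - Suc k" by auto
  have dk: "d - k = Suc (d - Suc k)" using k by simp
  have "(\<Prod>i\<in>{k..<d}. q powr (real d + e - 1 - real i))
      = q powr (real d + e - 1 - real k) * q powr (real ((d - Suc k) choose 2) + e * real (d - Suc k))"
    using Suc(1)[of "Suc k"] k by (simp add: prod.atLeast_Suc_lessThan)
  also have "\<dots> = q powr (real ((d - k) choose 2) + e * real (d - k))"
    unfolding powr_add[symmetric] dk
    using k by (intro arg_cong[where f = "\<lambda>s. q powr s"])
       (simp add: numeral_2_eq_2 of_nat_diff algebra_simps)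
  finally show ?case .
qed

text \<open>The count of \<open>card_generators_above\<close> is repeated among the members of
  \<open>P\<close> disjoint from \<open>\<pi>\<close>. A singular vector of \<open>perp W\<close> is
  now forbidden exactly if it lies in the generator joining \<open>W\<close> to
  \<open>\<pi> \<inter> perp W\<close>. Removing these \<open>q ^ d\<close> vectors instead of the
  \<open>q ^ k\<close> vectors of \<open>W\<close> turns the factor \<open>s + 1\<close> into
  \<open>s\<close>.\<close>

lemma card_opposite_above:
  assumes U: "U \<in> P" and \<pi>: "\<pi> \<in> generators d P" and disj: "U \<inter> \<pi> = {0}"
  shows "real (card {T \<in> generators d P. U \<subseteq> T \<and> T \<inter> \<pi> = {0}})
    = q powr (real ((d - vec.dim U) choose 2) + e * real (d - vec.dim U))"
proof -
  let ?F = "{W \<in> P. W \<inter> \<pi> = {0}}"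
  note sp = P_subspace[OF generatorsD(1)[OF \<pi>]]
  have "real (card {T \<in> ?F. vec.dim T = d \<and> U \<subseteq> T})
    = (\<Prod>i\<in>{vec.dim U..<d}. q powr (real d + e - 1 - real i))"
  proof (rule count_top_members[where a = "\<lambda>i. q powr (real d + e - 1 - real i)"])
    fix W assume W: "W \<in> ?F" "vec.dim W < d"
    then have WP: "W \<in> P" and W0: "W \<inter> \<pi> = {0}" by auto
    note sW = P_subspace[OF WP]
    let ?J = "{u + p |u p. u \<in> W \<and> p \<in> \<pi> \<inter> perp W}"
    have J: "?J \<in> generators d P" by (rule join_generator[OF WP \<pi>])
    have WJ: "W \<subseteq> ?J"
      using vec.subspace_0[OF sp] vec.subspace_0[OF subspace_perp[of W]] by force
    have Jperp: "?J \<subseteq> {y \<in> perp W. N y = 0}"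
      using P_B[OF generatorsD(1)[OF J]] P_N[OF generatorsD(1)[OF J]] WJ
      unfolding perp_def by blast
    have key: "y \<notin> W \<and> vec.span (insert y W) \<inter> \<pi> = {0} \<longleftrightarrow> y \<notin> ?J" if y: "y \<in> perp W" for y
    proof
      assume *: "y \<notin> W \<and> vec.span (insert y W) \<inter> \<pi> = {0}"
      show "y \<notin> ?J"
      proof
        assume "y \<in> ?J"
        then obtain u p where up: "u \<in> W" "p \<in> \<pi>" "y = u + p" by blast
        then have "p - 1 *s y = - u" by simp
        then have "p \<in> vec.span (insert y W)"
          unfolding in_span_insert_iff[OF sW] using up(1) sW by (metis vec.subspace_neg)
        then have "p = 0" using up * by blast
        then show False using up * by simp
      qed
    next
      assume *: "y \<notin> ?J"
      have "p = 0" if p: "p \<in> vec.span (insert y W)" "p \<in> \<pi>" for p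
      proof -
        obtain k where k: "p - k *s y \<in> W" using p(1) by (auto simp: in_span_insert_iff[OF sW])
        \<comment> \<open>A nonzero \<open>k\<close> would exhibit \<open>y\<close> as a vector of
          \<open>W\<close> plus a vector of \<open>\<pi>\<close>; the latter is perpendicular to
          \<open>W\<close> because \<open>y\<close> and \<open>W\<close> are, so \<open>y\<close>
          would lie in \<open>?J\<close>.\<close>
        have "k = 0"
        proof (rule ccontr)
          assume k0: "k \<noteq> 0"
          let ?p = "inverse k *s p" and ?u = "y - inverse k *s p"
          have "inverse k *s (p - k *s y) = - ?u"
            using k0 by (simp add: vec.scale_right_diff_distrib)
          then have u: "?u \<in> W" using k sW by (metis minus_minus vec.subspace_neg vec.subspace_scale)
          have "y - ?u \<in> perp W"
            by (rule vec.subspace_diff[OF subspace_perp y]) (use u P_subset_perp[OF WP] in blast)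
          moreover have "?p \<in> \<pi>" by (rule vec.subspace_scale[OF sp p(2)])
          ultimately have "?p \<in> \<pi> \<inter> perp W" by simp
          moreover have "y = ?u + ?p" by simp
          ultimately show False using * u by blast
        qed
        then show ?thesis using k p(2) W0 by auto
      qed
      moreover have "y \<notin> W" using * WJ by blast
      ultimately show "y \<notin> W \<and> vec.span (insert y W) \<inter> \<pi> = {0}"
        using vec.subspace_0[OF sp] vec.span_zero by blast
    qed
    obtain J where J_eq: "J = ?J" by simp
    have mem: "y \<in> {y. y \<notin> W \<and> vec.span (insert y W) \<in> ?F} \<longleftrightarrow> y \<in> {y \<in> perp W. N y = 0} - J" for y
      using key[of y] unfolding J_eq[symmetric]
      unfolding mem_Collect_eq Diff_iff span_insert_in_P_iff[OF WP] by auto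
    have "{y. y \<notin> W \<and> vec.span (insert y W) \<in> ?F} = {y \<in> perp W. N y = 0} - ?J"
      unfolding J_eq[symmetric] by (rule Set.set_eqI) (rule mem)
    then have "real (card {y. y \<notin> W \<and> vec.span (insert y W) \<in> ?F})
        = real (card {y \<in> perp W. N y = 0}) - real (card ?J)"
      using Jperp by (simp only: card_Diff_subset[OF finite] card_mono[OF finite] of_nat_diff)
    then have "real (card {y. y \<notin> W \<and> vec.span (insert y W) \<in> ?F})
        = real (card {y \<in> perp W. N y = 0}) - q ^ d"
      by (simp only: card_generator[OF J] q_eq of_nat_power)
    then show "real (card {y. y \<notin> W \<and> vec.span (insert y W) \<in> ?F})
        = q powr (real d + e - 1 - real (vec.dim W)) * (real CARD('a) ^ d - real CARD('a) ^ vec.dim W)"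
      using W powr_split_rank[of "vec.dim W"]
      by (simp add: card_singular_perp[OF WP] q_eq[symmetric] algebra_simps)
  next
    fix W X assume W: "W \<in> ?F" and X: "vec.subspace X" "X \<subseteq> W"
    then have "X \<in> P" by (auto intro: P_down)
    moreover have "0 \<in> X" "0 \<in> \<pi>" by (rule vec.subspace_0[OF X(1)], rule vec.subspace_0[OF sp])
    ultimately show "X \<in> ?F" using W X(2) by auto
  qed (use U disj in \<open>auto intro: P_subspace dim_le_rank\<close>)
  moreover have "{T \<in> ?F. vec.dim T = d \<and> U \<subseteq> T}
      = {T \<in> generators d P. U \<subseteq> T \<and> T \<inter> \<pi> = {0}}"
    by (auto simp: generators_def)
  ultimately show ?thesis using prod_powr_rank[OF dim_le_rank[OF U]] by simp
qed

end

section \<open>Isometries and spreads\<close>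

context polar_space
begin

definition isometry :: "('a ^ 'n \<Rightarrow> 'a ^ 'n) \<Rightarrow> bool" where
  "isometry \<phi> \<longleftrightarrow> (\<forall>x y. \<phi> (x + y) = \<phi> x + \<phi> y) \<and> (\<forall>c x. \<phi> (c *s x) = c *s \<phi> x) \<and>
    (\<forall>x y. B (\<phi> x) (\<phi> y) = B x y) \<and> (\<forall>x. N (\<phi> x) = N x)"

text \<open>Only inclusion within \<open>P\<close> is preserved, because the groups in (v) need not
  act by semilinear maps; isometries are a special case.\<close>

definition polar_automorphism :: "(('a ^ 'n) set \<Rightarrow> ('a ^ 'n) set) \<Rightarrow> bool" where
  "polar_automorphism g \<longleftrightarrow> bij_betw g P P \<and> (\<forall>U\<in>P. \<forall>W\<in>P. g U \<subseteq> g W \<longleftrightarrow> U \<subseteq> W)"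

lemma isometry_id: "isometry (\<lambda>x. x)"
  by (simp add: isometry_def)

lemma isometry_comp: "isometry \<phi> \<Longrightarrow> isometry \<psi> \<Longrightarrow> isometry (\<lambda>x. \<phi> (\<psi> x))"
  by (simp add: isometry_def)

lemma isometry_0: "isometry \<phi> \<Longrightarrow> \<phi> 0 = 0"
  unfolding isometry_def by (metis vec.scale_zero_left)

text \<open>A vector of the kernel is singular and lies in the radical, so it vanishes.\<close>

lemma isometry_bij:
  assumes \<phi>: "isometry \<phi>"
  shows "bij \<phi>"
proof -
  have "inj \<phi>"
  proof (rule injI)
    fix x y assume eq: "\<phi> x = \<phi> y"
    have "\<phi> x = \<phi> (x - y) + \<phi> y" using \<phi> unfolding isometry_def by (metis diff_add_cancel)
    then have 0: "\<phi> (x - y) = 0" using eq by simp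
    have "N (x - y) = 0" using \<phi> 0 N_0 unfolding isometry_def by metis
    moreover have "B (x - y) z = 0" for z using \<phi> 0 B_0_left unfolding isometry_def by metis
    ultimately have "x - y = 0" by (rule nondeg)
    then show "x = y" by simp
  qed
  then show ?thesis by (simp add: bij_def finite_UNIV_inj_surj)
qed

lemma isometry_image_P:
  assumes \<phi>: "isometry \<phi>" and U: "U \<in> P"
  shows "\<phi> ` U \<in> P"
proof -
  note sU = P_subspace[OF U]
  have "vec.subspace (\<phi> ` U)"
  proof (rule vec.subspaceI)
    show "0 \<in> \<phi> ` U" using isometry_0[OF \<phi>] vec.subspace_0[OF sU] by (metis imageI)
  next
    fix x y assume "x \<in> \<phi> ` U" "y \<in> \<phi> ` U"
    then obtain u v where uv: "u \<in> U" "v \<in> U" "x = \<phi> u" "y = \<phi> v" by blast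
    then have "x + y = \<phi> (u + v)" using \<phi> by (simp add: isometry_def)
    then show "x + y \<in> \<phi> ` U" using vec.subspace_add[OF sU uv(1,2)] by blast
  next
    fix c x assume "x \<in> \<phi> ` U"
    then obtain u where u: "u \<in> U" "x = \<phi> u" by blast
    then have "c *s x = \<phi> (c *s u)" using \<phi> by (simp add: isometry_def)
    then show "c *s x \<in> \<phi> ` U" using vec.subspace_scale[OF sU u(1)] by blast
  qed
  then show ?thesis
    using \<phi> P_N[OF U] P_B[OF U] unfolding P_eq by (auto simp: isometry_def)
qed

lemma isometry_automorphism:
  assumes \<phi>: "isometry \<phi>"
  shows "polar_automorphism ((`) \<phi>)"
proof -
  have inj: "inj \<phi>" using isometry_bij[OF \<phi>] by (rule bij_is_inj)
  then have "inj_on ((`) \<phi>) P" by (meson inj_image_eq_iff inj_onI)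
  moreover have "((`) \<phi>) ` P = P"
    using isometry_image_P[OF \<phi>] calculation by (intro endo_inj_surj) auto
  ultimately show ?thesis using inj by (simp add: polar_automorphism_def bij_betw_def inj_image_subset_iff)
qed

text \<open>Inclusion alone determines dimension: a maximal chain of subspaces below
  \<open>U\<close> is mapped to a strictly increasing chain below \<open>g U\<close>.\<close>

lemma automorphism_dim_ge:
  assumes g: "polar_automorphism g" and U: "U \<in> P"
  shows "vec.dim U \<le> vec.dim (g U)"
  using U
proof (induction "vec.dim U" arbitrary: U)
  case 0
  show ?case unfolding 0(1)[symmetric] by simp
next
  case (Suc k)
  obtain W where "vec.subspace W" "W \<subseteq> vec.span U" "vec.dim W = k"
    by (rule vec.choose_subspace_of_subspace[of k U]) (use Suc(2) in simp)
  moreover have "vec.span U = U" using P_subspace[OF Suc(3)] by simp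
  ultimately have W: "vec.subspace W" "W \<subseteq> U" "vec.dim W = k" by simp_all
  have WP: "W \<in> P" by (rule P_down[OF Suc(3) W(1,2)])
  have gP: "g X \<in> P" if "X \<in> P" for X using g that by (auto simp: polar_automorphism_def bij_betw_def)
  have "g W \<noteq> g U"
    using g Suc(2,3) W WP by (auto simp: polar_automorphism_def bij_betw_def inj_on_def)
  moreover have "g W \<subseteq> g U" using g Suc(3) W WP by (auto simp: polar_automorphism_def)
  ultimately have "vec.dim (g W) < vec.dim (g U)"
    using subspace_eqI[OF P_subspace P_subspace, OF gP gP, OF WP Suc(3)] by linarith
  then show ?case using Suc(1)[of W] W(3) WP Suc(2) by simp
qed

lemma automorphism_dim:
  assumes g: "polar_automorphism g" and U: "U \<in> P"
  shows "vec.dim (g U) = vec.dim U"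
proof -
  let ?h = "the_inv_into P g"
  have bij: "bij_betw g P P" and inj: "inj_on g P" and img: "g ` P = P"
    using g by (auto simp: polar_automorphism_def bij_betw_def)
  have h: "bij_betw ?h P P" by (rule bij_betw_the_inv_into[OF bij])
  have hP: "?h X \<in> P" if "X \<in> P" for X using h that by (auto simp: bij_betw_def)
  have gh: "g (?h X) = X" if "X \<in> P" for X using f_the_inv_into_f[OF inj] img that by simp
  have "polar_automorphism ?h"
    unfolding polar_automorphism_def
  proof (intro conjI ballI h)
    fix X Y assume XY: "X \<in> P" "Y \<in> P"
    have "?h X \<subseteq> ?h Y \<longleftrightarrow> g (?h X) \<subseteq> g (?h Y)"
      using g hP XY by (simp add: polar_automorphism_def)
    then show "?h X \<subseteq> ?h Y \<longleftrightarrow> X \<subseteq> Y" by (simp add: gh XY)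
  qed
  moreover have "g U \<in> P" using img U by blast
  ultimately have "vec.dim (g U) \<le> vec.dim (?h (g U))" by (rule automorphism_dim_ge)
  then show ?thesis
    using automorphism_dim_ge[OF g U] the_inv_into_f_f[OF inj U] by simp
qed

lemma automorphism_generator:
  "polar_automorphism g \<Longrightarrow> U \<in> generators d P \<Longrightarrow> g U \<in> generators d P"
  using automorphism_dim[of g U] by (auto simp: generators_def polar_automorphism_def bij_betw_def)

lemma automorphism_inj: "polar_automorphism g \<Longrightarrow> inj_on g P"
  by (simp add: polar_automorphism_def bij_betw_def)

lemma automorphism_spread:
  assumes g: "polar_automorphism g" and S: "is_spread d P S"
  shows "is_spread d P (g ` S)"
  unfolding is_spread_def
proof (intro conjI ballI impI)
  have SP: "S \<subseteq> generators d P" using S by (simp add: is_spread_def)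
  then show "g ` S \<subseteq> generators d P" using automorphism_generator[OF g] by blast
  fix p assume p: "p \<in> P" "vec.dim p = 1"
  obtain r where r: "r \<in> P" "p = g r"
    using g p(1) unfolding polar_automorphism_def bij_betw_def by (metis imageE)
  then have "vec.dim r = 1" using automorphism_dim[OF g] p by simp
  then obtain U where U: "U \<in> S" "r \<subseteq> U" "\<And>W. W \<in> S \<Longrightarrow> r \<subseteq> W \<Longrightarrow> W = U"
    using S r(1) unfolding is_spread_def by metis
  have le: "p \<subseteq> g W \<longleftrightarrow> r \<subseteq> W" if "W \<in> S" for W
  proof -
    have "W \<in> P" using that SP generatorsD(1) by blast
    then show ?thesis using g r(1) by (simp add: r(2) polar_automorphism_def)
  qed
  show "\<exists>!U. U \<in> g ` S \<and> p \<subseteq> U"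
  proof (rule ex1I[of _ "g U"])
    show "g U \<in> g ` S \<and> p \<subseteq> g U" using U(1,2) le[OF U(1)] by blast
  next
    fix X assume "X \<in> g ` S \<and> p \<subseteq> X"
    then obtain W where "W \<in> S" "X = g W" "p \<subseteq> g W" by blast
    then show "X = g U" using le[of W] U(3)[of W] by simp
  qed
qed

section \<open>Spreads: size, and counting through a fixed member\<close>

lemma spread_disjoint:
  assumes S: "is_spread d P S" and UW: "U \<in> S" "W \<in> S" "U \<noteq> W"
  shows "U \<inter> W = {0}"
proof -
  have P: "U \<in> P" "W \<in> P" using S UW by (auto simp: is_spread_def generators_def)
  have "v = 0" if v: "v \<in> U" "v \<in> W" for v
  proof (rule ccontr)
    assume "v \<noteq> 0"
    then have "vec.dim (vec.span {v}) = 1" by simp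
    moreover have "vec.span {v} \<in> P" using P_N[OF P(1) v(1)] by (rule span_singleton_in_P)
    moreover have "vec.span {v} \<subseteq> U" "vec.span {v} \<subseteq> W"
      using v P by (simp_all add: vec.span_minimal P_subspace)
    ultimately show False using S UW unfolding is_spread_def by metis
  qed
  then show ?thesis using vec.subspace_0 P P_subspace by blast
qed

text \<open>The members of \<open>S\<close> partition the nonzero singular vectors into blocks of
  size \<open>q ^ d - 1\<close>; the number of singular vectors is \<open>card_singular_perp\<close>
  for the zero subspace.\<close>

lemma card_spread:
  assumes S: "is_spread d P S"
  shows "real (card S) = q powr (real d + e - 1) + 1"
proof -
  have P: "U \<in> generators d P" if "U \<in> S" for U using S that by (auto simp: is_spread_def)
  have "{y. N y = 0} - {0} = (\<Union>U\<in>S. U - {0})"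
  proof (intro equalityI subsetI)
    fix y assume y: "y \<in> {y. N y = 0} - {0}"
    then have "vec.span {y} \<in> P" "vec.dim (vec.span {y}) = 1"
      by (simp_all add: span_singleton_in_P)
    then obtain U where "U \<in> S" "vec.span {y} \<subseteq> U" using S unfolding is_spread_def by metis
    moreover have "y \<in> vec.span {y}" by (simp add: vec.span_base)
    ultimately show "y \<in> (\<Union>U\<in>S. U - {0})" using y by blast
  next
    fix y assume "y \<in> (\<Union>U\<in>S. U - {0})"
    then show "y \<in> {y. N y = 0} - {0}" using P P_N generatorsD(1) by blast
  qed
  then have "card ({y. N y = 0} - {0}) = (\<Sum>U\<in>S. card (U - {0}))"
    using spread_disjoint[OF S] by (simp only:) (rule card_UN_disjoint, auto)
  also have "\<dots> = (\<Sum>U\<in>S. CARD('a) ^ d - 1)"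
  proof (rule sum.cong[OF refl])
    fix U assume "U \<in> S"
    then show "card (U - {0}) = CARD('a) ^ d - 1"
      using card_generator[OF P] vec.subspace_0[OF P_subspace[OF generatorsD(1)[OF P]]] by simp
  qed
  finally have "card ({y. N y = 0} - {0}) = card S * (CARD('a) ^ d - 1)" by simp
  moreover have "card ({y. N y = 0} - {0}) = card {y. N y = 0} - 1" using N_0 by simp
  moreover have "card {y. N y = 0} > 0" using N_0 by (auto simp: card_gt_0_iff)
  ultimately have "card {y. N y = 0} = card S * (CARD('a) ^ d - 1) + 1" by linarith
  then have "real (card {y. N y = 0}) = real (card S) * (q ^ d - 1) + 1"
    by (simp add: of_nat_diff q_eq)
  moreover have "real (card {y. N y = 0}) = q ^ d + q powr (2 * real d + e - 1) - q powr (real d + e - 1)"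
    using card_singular_perp[OF zero_in_P] by (simp add: perp_def)
  moreover have "q powr (2 * real d + e - 1) = q powr (real d + e - 1) * q ^ d"
    using powr_split_rank(1)[of 0] by simp
  ultimately have "real (card S) * (q ^ d - 1) = (q powr (real d + e - 1) + 1) * (q ^ d - 1)"
    by (simp add: algebra_simps)
  moreover have "q ^ d > 1" using q_gt_1 rank_pos by (simp add: one_less_power)
  ultimately show ?thesis by simp
qed

text \<open>In this factorisation the first factor is the constant of (i) and the second is one less
  than the size of a spread.\<close>

lemma card_opposite:
  assumes \<pi>: "\<pi> \<in> generators d P"
  shows "real (card {T \<in> generators d P. T \<inter> \<pi> = {0}})
    = q powr (real ((d - 1) choose 2) + e * real (d - 1)) * q powr (real d + e - 1)"
proof -
  have "0 \<in> U" if "U \<in> generators d P" for U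
    using that by (simp add: vec.subspace_0 P_subspace generatorsD)
  then have "{T \<in> generators d P. T \<inter> \<pi> = {0}} = {T \<in> generators d P. {0} \<subseteq> T \<and> T \<inter> \<pi> = {0}}"
    and "{0} \<inter> \<pi> = {0}" using \<pi> by auto
  then have "real (card {T \<in> generators d P. T \<inter> \<pi> = {0}}) = q powr (real (d choose 2) + e * real d)"
    using card_opposite_above[OF zero_in_P \<pi>] by simp
  also have "real (d choose 2) + e * real d
      = (real ((d - 1) choose 2) + e * real (d - 1)) + (real d + e - 1)"
    using rank_pos by (cases d) (simp_all add: numeral_2_eq_2 algebra_simps)
  finally show ?thesis by (simp only: powr_add)
qed

lemma opposite_exists:
  assumes "\<pi> \<in> generators d P"
  obtains U where "U \<in> generators d P" "U \<inter> \<pi> = {0}"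
proof -
  have "real (card {T \<in> generators d P. T \<inter> \<pi> = {0}}) > 0"
    unfolding card_opposite[OF assms] using q_pos by simp
  then have "{T \<in> generators d P. T \<inter> \<pi> = {0}} \<noteq> {}" by (metis card.empty less_irrefl of_nat_0)
  then obtain T where "T \<in> {T \<in> generators d P. T \<inter> \<pi> = {0}}" by (meson ex_in_conv)
  then show thesis using that[of T] by simp
qed

text \<open>Pairs of a spread \<open>S \<in> C\<close> through \<open>\<pi>\<close> and an opposite
  generator \<open>U \<in> S\<close> are double counted, once for all \<open>U\<close> and once for
  \<open>U \<in> L\<close>. Each \<open>U\<close> lies in the same number \<open>a\<close> of these
  spreads, so comparing the two totals eliminates both \<open>a\<close> and the number of spreads.
  An inequality suffices in \<open>const\<close>, as \<open>U\<close> and \<open>W\<close> may be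
  exchanged.\<close>

lemma count_via_spreads:
  assumes C: "\<And>S. S \<in> C \<Longrightarrow> is_spread d P S"
    and \<pi>: "\<pi> \<in> generators d P" and ex: "\<exists>S\<in>C. \<pi> \<in> S"
    and const: "\<And>U W. U \<in> generators d P \<Longrightarrow> W \<in> generators d P \<Longrightarrow> U \<inter> \<pi> = {0} \<Longrightarrow>
      W \<inter> \<pi> = {0} \<Longrightarrow> card {S \<in> C. \<pi> \<in> S \<and> U \<in> S} \<le> card {S \<in> C. \<pi> \<in> S \<and> W \<in> S}"
    and L: "L \<subseteq> generators d P" and x: "\<And>S. S \<in> C \<Longrightarrow> real (card (L \<inter> S)) = x"
  shows "real (card {U \<in> L. U \<inter> \<pi> = {0}})
    = (x - (if \<pi> \<in> L then 1 else 0)) * q powr (real ((d - 1) choose 2) + e * real (d - 1))"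
proof -
  let ?C = "{S \<in> C. \<pi> \<in> S}" and ?O = "{U \<in> generators d P. U \<inter> \<pi> = {0}}"
  let ?m = "q powr (real ((d - 1) choose 2) + e * real (d - 1))"
  let ?Q = "q powr (real d + e - 1)" and ?c = "if \<pi> \<in> L then 1 else 0 :: real"
  obtain U0 where "U0 \<in> generators d P" "U0 \<inter> \<pi> = {0}" by (rule opposite_exists[OF \<pi>])
  then have U0: "U0 \<in> ?O" by simp
  define a where "a = card {S \<in> ?C. U0 \<in> S}"
  have a: "card {S \<in> ?C. U \<in> S} = a" if "U \<in> ?O" for U
    using const[of U U0] const[of U0 U] that U0 by (simp add: a_def conj_assoc)
  have count: "(\<Sum>S\<in>?C. card {U \<in> M. U \<in> S}) = card M * a" if "M \<subseteq> ?O" for M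
  proof -
    have "(\<Sum>S\<in>?C. card {U \<in> M. U \<in> S}) = (\<Sum>U\<in>M. card {S \<in> ?C. U \<in> S})"
      by (rule double_count) auto
    also have "\<dots> = (\<Sum>U\<in>M. a)" using that a by (intro sum.cong refl) blast
    finally show ?thesis by simp
  qed
  \<comment> \<open>The members of a spread through \<open>\<pi>\<close> that are opposite to
    \<open>\<pi>\<close> are all members but \<open>\<pi>\<close> itself; as
    \<open>d \<ge> 1\<close>, \<open>\<pi>\<close> is not disjoint from itself.\<close>
  have part: "{U \<in> M \<inter> ?O. U \<in> S} = M \<inter> S - {\<pi>}" if "S \<in> ?C" for S M
  proof -
    have S: "is_spread d P S" "\<pi> \<in> S" using that C by auto
    have "\<pi> \<inter> \<pi> \<noteq> {0}"
      using generatorsD(2)[OF \<pi>] rank_pos by (metis Int_absorb le_numeral_extra(2) vec.dim_eq_0 subset_refl)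
    then show ?thesis using spread_disjoint[OF S(1) _ S(2)] S(1)
      by (auto simp: is_spread_def)
  qed
  have 1: "real (card {U \<in> ?O. U \<in> S}) = ?Q" if "S \<in> ?C" for S
  proof -
    have "card {U \<in> ?O. U \<in> S} = card (S - {\<pi>})" using part[OF that, of UNIV] by simp
    also have "real \<dots> = real (card S) - 1"
      using that card_gt_0_iff[of S] by (auto simp: card_Diff_singleton of_nat_diff)
    finally show ?thesis using card_spread[of S] C[of S] that by simp
  qed
  have 2: "real (card {U \<in> L \<inter> ?O. U \<in> S}) = x - ?c" if "S \<in> ?C" for S
  proof -
    have "card {U \<in> L \<inter> ?O. U \<in> S} = card (L \<inter> S - {\<pi>})" using part[OF that] by simp
    also have "real \<dots> = real (card (L \<inter> S)) - ?c"
      using that card_gt_0_iff[of "L \<inter> S"] by (auto simp: card_Diff_singleton_if)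
    finally show ?thesis using x that by simp
  qed
  have "real (card ?C) * ?Q = (\<Sum>S\<in>?C. real (card {U \<in> ?O. U \<in> S}))" using 1 by simp
  also have "\<dots> = real (card ?O) * real a" using count[of ?O] by (simp flip: of_nat_sum of_nat_mult)
  finally have eq1: "real (card ?C) * ?Q = ?m * ?Q * real a" using card_opposite[OF \<pi>] by simp
  have "real (card ?C) * (x - ?c) = (\<Sum>S\<in>?C. real (card {U \<in> L \<inter> ?O. U \<in> S}))" using 2 by simp
  also have "\<dots> = real (card (L \<inter> ?O)) * real a"
    using count[of "L \<inter> ?O"] by (simp flip: of_nat_sum of_nat_mult)
  finally have eq2: "real (card ?C) * (x - ?c) = real (card (L \<inter> ?O)) * real a" .
  \<comment> \<open>The existence of a spread through \<open>\<pi>\<close> forces \<open>a\<close>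
    to be nonzero, so it can be cancelled.\<close>
  have C0: "real (card ?C) > 0" using ex by (simp add: card_gt_0_iff) blast
  have eq1': "real (card ?C) = ?m * real a" using eq1 q_pos by simp
  have "real a \<noteq> 0" using C0 unfolding eq1' by (metis less_irrefl mult_zero_right)
  moreover have "real (card (L \<inter> ?O)) * real a = ((x - ?c) * ?m) * real a"
    using eq2 unfolding eq1' by (simp only: ac_simps)
  ultimately have "real (card (L \<inter> ?O)) = (x - ?c) * ?m"
    by (rule mult_right_cancel[THEN iffD1])
  moreover have "L \<inter> ?O = {U \<in> L. U \<inter> \<pi> = {0}}"
  proof (rule Set.set_eqI)
    fix U show "U \<in> L \<inter> ?O \<longleftrightarrow> U \<in> {U \<in> L. U \<inter> \<pi> = {0}}"
      using subsetD[OF L, of U] by (cases "U \<in> L") simp_all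
  qed
  ultimately show ?thesis by simp
qed

section \<open>The stabiliser of a generator is transitive on opposite generators\<close>

text \<open>By maximality of \<open>X\<close>, no nonzero vector of \<open>Y\<close> is
  perpendicular to \<open>X\<close>. Comparing sizes, the space is the direct sum of
  \<open>Y\<close> and \<open>perp X\<close>, and \<open>y\<close> is the \<open>Y\<close>-component
  of \<open>x\<close>.\<close>

lemma ex1_dual:
  assumes X: "X \<in> generators d P" and Y: "Y \<in> generators d P" and XY: "X \<inter> Y = {0}"
  shows "\<exists>!y. y \<in> Y \<and> (\<forall>p\<in>X. B y p = B x p)"
proof -
  note sY = P_subspace[OF generatorsD(1)[OF Y]]
  have zero: "y = 0" if "y \<in> Y" "y \<in> perp X" for y
    using generator_maximal[OF X] P_N[OF generatorsD(1)[OF Y]] that XY by blast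
  let ?h = "\<lambda>(y, z). y + z"
  have "inj_on ?h (Y \<times> perp X)"
  proof (rule inj_onI, clarify)
    fix y z y' z' assume yz: "y \<in> Y" "z \<in> perp X" "y' \<in> Y" "z' \<in> perp X" and eq: "y + z = y' + z'"
    have "y - y' = z' - z" using eq by (simp add: algebra_simps)
    then have "y - y' = 0"
      using yz zero[of "y - y'"] by (metis sY subspace_perp vec.subspace_diff)
    then show "y = y' \<and> z = z'" using eq by simp
  qed
  then have "card (?h ` (Y \<times> perp X)) = CARD('a) ^ CARD('n)"
    using card_perp[OF generatorsD(1)[OF X]] card_generator[OF X] card_generator[OF Y]
    by (simp add: card_image card_cartesian_product mult.commute)
  then have "?h ` (Y \<times> perp X) = UNIV"
    by (intro card_subset_eq) (auto simp: CARD_vec)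
  then have "x \<in> ?h ` (Y \<times> perp X)" by (metis UNIV_I)
  then obtain s where s: "x = ?h s" "s \<in> Y \<times> perp X" by (rule imageE)
  obtain y z where "s = (y, z)" by (cases s)
  with s have yz: "y \<in> Y" "z \<in> perp X" "x = y + z" by auto
  show ?thesis
  proof (rule ex1I[of _ y])
    show "y \<in> Y \<and> (\<forall>p\<in>X. B y p = B x p)"
      using yz by (auto simp: B_add_left perpD)
  next
    fix y' assume y': "y' \<in> Y \<and> (\<forall>p\<in>X. B y' p = B x p)"
    then have "y' - y \<in> perp X" using yz by (auto simp: perp_def B_diff_left B_add_left)
    then show "y' = y" using zero[of "y' - y"] y' yz(1) sY by (simp add: vec.subspace_diff)
  qed
qed

text \<open>For opposite generators this is the projection onto \<open>Y\<close> along
  \<open>perp X\<close>: it represents by a vector of \<open>Y\<close> the functional that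
  \<open>x\<close> induces on \<open>X\<close>.\<close>

definition dual :: "('a ^ 'n) set \<Rightarrow> ('a ^ 'n) set \<Rightarrow> 'a ^ 'n \<Rightarrow> 'a ^ 'n" where
  "dual X Y x = (THE y. y \<in> Y \<and> (\<forall>p\<in>X. B y p = B x p))"

context
  fixes X Y
  assumes X: "X \<in> generators d P" and Y: "Y \<in> generators d P" and XY: "X \<inter> Y = {0}"
begin

lemma dual_mem: "dual X Y x \<in> Y" and dual_B: "p \<in> X \<Longrightarrow> B (dual X Y x) p = B x p"
  using theI'[OF ex1_dual[OF X Y XY, of x]] unfolding dual_def by auto

lemma dual_eqI: "y \<in> Y \<Longrightarrow> (\<And>p. p \<in> X \<Longrightarrow> B y p = B x p) \<Longrightarrow> dual X Y x = y"
  unfolding dual_def by (rule the1_equality[OF ex1_dual[OF X Y XY]]) auto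

lemma dual_add: "dual X Y (x + y) = dual X Y x + dual X Y y"
  by (rule dual_eqI)
     (auto simp: B_add_left dual_B intro: vec.subspace_add dual_mem P_subspace generatorsD Y)

lemma dual_scale: "dual X Y (c *s x) = c *s dual X Y x"
  by (rule dual_eqI)
     (auto simp: B_scale_left dual_B intro: vec.subspace_scale dual_mem P_subspace generatorsD Y)

end

lemma B_decomp:
  assumes "\<pi> \<in> P" "U \<in> P" "p \<in> \<pi>" "p' \<in> \<pi>" "w \<in> U" "w' \<in> U"
    and "z \<in> perp \<pi> \<inter> perp U" "z' \<in> perp \<pi> \<inter> perp U"
  shows "B (p + w + z) (p' + w' + z') = B p w' + B w p' + B z z'"
proof -
  have "B p p' = 0" "B w w' = 0" using assms P_B by blast+
  moreover have "B z p' = 0" "B z w' = 0" using assms by (auto simp: perpD)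
  moreover have "B p z' = 0" "B w z' = 0" using assms by (auto simp: mem_perp_swap)
  ultimately show ?thesis by (simp add: B_add_left B_add_right)
qed

lemma N_decomp:
  assumes "\<pi> \<in> P" "U \<in> P" "p \<in> \<pi>" "w \<in> U" "z \<in> perp \<pi> \<inter> perp U"
  shows "N (p + w + z) = t (B p w) + N z"
proof -
  have "B (p + w) z = 0" using assms by (auto simp: mem_perp_swap B_add_left)
  then show ?thesis using P_N assms by (simp add: N_add_perp) (simp add: N_add)
qed

text \<open>
  For \<open>U\<close> and \<open>W\<close> opposite to \<open>\<pi>\<close> the space decomposes as \<open>\<pi> + U + Z\<close> and as
  \<open>\<pi> + W + Z'\<close>, where \<open>Z\<close> and \<open>Z'\<close> are complements of \<open>\<pi>\<close> in \<open>perp \<pi>\<close>. The map is the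
  identity on \<open>\<pi>\<close>, and moves \<open>U\<close> to \<open>W\<close> along \<open>perp \<pi>\<close> and \<open>Z\<close> to \<open>Z'\<close> along \<open>\<pi>\<close>.
\<close>

definition stab_map :: "('a ^ 'n) set \<Rightarrow> ('a ^ 'n) set \<Rightarrow> ('a ^ 'n) set \<Rightarrow> 'a ^ 'n \<Rightarrow> 'a ^ 'n" where
  "stab_map \<pi> U W x =
    (let w = dual \<pi> U x; p = dual U \<pi> (x - w); z = x - w - p
     in p + dual \<pi> W x + (z - dual W \<pi> z))"

lemma stabiliser_transitive:
  assumes \<pi>: "\<pi> \<in> generators d P" and U: "U \<in> generators d P" and W: "W \<in> generators d P"
    and U\<pi>: "U \<inter> \<pi> = {0}" and W\<pi>: "W \<inter> \<pi> = {0}"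
  obtains \<phi> where "isometry \<phi>" "\<phi> ` \<pi> = \<pi>" "\<phi> ` U = W"
proof -
  note \<pi>U = U\<pi>[unfolded Int_commute[of U]] and \<pi>W = W\<pi>[unfolded Int_commute[of W]]
  note P = generatorsD(1)[OF \<pi>] generatorsD(1)[OF U] generatorsD(1)[OF W]
  \<comment> \<open>The components of \<open>x\<close> in \<open>U\<close>, \<open>\<pi>\<close> and
    \<open>perp \<pi> \<inter> perp U\<close> are \<open>w x\<close>, \<open>p x\<close> and
    \<open>z x\<close>. The replacement \<open>w' x\<close> induces the same functional on
    \<open>\<pi>\<close> as \<open>w x\<close>, and \<open>z' x\<close> is \<open>z x\<close>
    corrected by a vector of \<open>\<pi>\<close> so as to become perpendicular to
    \<open>W\<close>.\<close>
  define w where "w = dual \<pi> U"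
  define p where "p x = dual U \<pi> (x - w x)" for x
  define z where "z x = x - w x - p x" for x
  define w' where "w' = dual \<pi> W"
  define z' where "z' x = z x - dual W \<pi> (z x)" for x
  let ?\<phi> = "stab_map \<pi> U W"
  have \<phi>_eq: "?\<phi> x = p x + w' x + z' x" for x
    by (simp add: stab_map_def Let_def w_def p_def z_def w'_def z'_def)
  have x_eq: "x = p x + w x + z x" for x by (simp add: z_def)
  have w: "w x \<in> U" and w': "w' x \<in> W" and p: "p x \<in> \<pi>" for x
    unfolding w_def w'_def p_def
    by (rule dual_mem[OF \<pi> U \<pi>U], rule dual_mem[OF \<pi> W \<pi>W], rule dual_mem[OF U \<pi> U\<pi>])
  have dz: "dual W \<pi> y \<in> \<pi>" for y by (rule dual_mem[OF W \<pi> W\<pi>])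
  have ww': "B (w' x) r = B (w x) r" if "r \<in> \<pi>" for x r
    unfolding w_def w'_def using that by (simp add: dual_B[OF \<pi> U \<pi>U] dual_B[OF \<pi> W \<pi>W])
  have z: "z x \<in> perp \<pi> \<inter> perp U" for x
  proof
    show "z x \<in> perp \<pi>"
      using p P_B[OF P(1)] by (auto simp: perp_def z_def B_diff_left w_def dual_B[OF \<pi> U \<pi>U])
    show "z x \<in> perp U"
      by (auto simp: perp_def z_def B_diff_left p_def dual_B[OF U \<pi> U\<pi>])
  qed
  have z': "z' x \<in> perp \<pi> \<inter> perp W" for x
  proof
    show "z' x \<in> perp \<pi>" unfolding z'_def
      using z dz P_subset_perp[OF P(1)] subspace_perp[of \<pi>] by (blast intro: vec.subspace_diff)
    show "z' x \<in> perp W"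
      by (auto simp: perp_def z'_def B_diff_left dual_B[OF W \<pi> W\<pi>])
  qed
  have zz': "z x = z' x + dual W \<pi> (z x)" for x by (simp add: z'_def)
  have B_z: "B (z' x) (z' y) = B (z x) (z y)" for x y
  proof -
    have "B (z x) (z y) = B (z' x) (z y) + B (dual W \<pi> (z x)) (z y)"
      by (simp flip: B_add_left zz')
    also have "B (dual W \<pi> (z x)) (z y) = 0"
      by (subst B_eq_0_swap, rule perpD[of _ \<pi>]) (use z dz in auto)
    also have "B (z' x) (z y) = B (z' x) (z' y) + B (z' x) (dual W \<pi> (z y))"
      by (simp flip: B_add_right zz')
    also have "B (z' x) (dual W \<pi> (z y)) = 0"
      by (rule perpD[of _ \<pi>]) (use z' dz in auto)
    finally show ?thesis by simp
  qed
  have N_z: "N (z' x) = N (z x)" for x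
  proof -
    have "B (z' x) (dual W \<pi> (z x)) = 0"
      by (rule perpD[of _ \<pi>]) (use z' dz in auto)
    from N_add_perp[OF this] show ?thesis by (simp add: P_N[OF P(1) dz] flip: zz')
  qed
  have B_pw: "B r (w' x) = B r (w x)" if "r \<in> \<pi>" for x r
    using B_swap[of r "w' x"] B_swap[of r "w x"] ww'[OF that, of x] by simp
  have "isometry ?\<phi>"
    unfolding isometry_def
  proof (intro conjI allI)
    fix x y c
    have w_add: "w (x + y) = w x + w y" and w'_add: "w' (x + y) = w' x + w' y"
      by (simp_all add: w_def w'_def dual_add[OF \<pi> U \<pi>U] dual_add[OF \<pi> W \<pi>W])
    have "x + y - w (x + y) = (x - w x) + (y - w y)" by (simp add: w_add)
    then have p_add: "p (x + y) = p x + p y" by (simp only: p_def dual_add[OF U \<pi> U\<pi>])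
    have z_add: "z (x + y) = z x + z y" by (simp add: z_def w_add p_add)
    have "z' (x + y) = z' x + z' y" by (simp add: z'_def z_add dual_add[OF W \<pi> W\<pi>])
    then show "?\<phi> (x + y) = ?\<phi> x + ?\<phi> y" by (simp add: \<phi>_eq p_add w'_add)
    have w_scale: "w (c *s x) = c *s w x" and w'_scale: "w' (c *s x) = c *s w' x"
      by (simp_all add: w_def w'_def dual_scale[OF \<pi> U \<pi>U] dual_scale[OF \<pi> W \<pi>W])
    have "c *s x - w (c *s x) = c *s (x - w x)" by (simp add: w_scale vec.scale_right_diff_distrib)
    then have p_scale: "p (c *s x) = c *s p x" by (simp only: p_def dual_scale[OF U \<pi> U\<pi>])
    have z_scale: "z (c *s x) = c *s z x"
      by (simp add: z_def w_scale p_scale vec.scale_right_diff_distrib)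
    have "z' (c *s x) = c *s z' x"
      by (simp add: z'_def z_scale dual_scale[OF W \<pi> W\<pi>] vec.scale_right_diff_distrib)
    then show "?\<phi> (c *s x) = c *s ?\<phi> x"
      by (simp add: \<phi>_eq p_scale w'_scale vec.scale_right_distrib)
    have "B (?\<phi> x) (?\<phi> y) = B (p x) (w' y) + B (w' x) (p y) + B (z' x) (z' y)"
      unfolding \<phi>_eq by (rule B_decomp[OF P(1,3)]) (use p w' z' in auto)
    also have "\<dots> = B (p x) (w y) + B (w x) (p y) + B (z x) (z y)"
      by (simp add: B_pw ww' B_z p)
    also have "\<dots> = B (p x + w x + z x) (p y + w y + z y)"
      by (rule B_decomp[OF P(1,2), symmetric]) (use p w z in auto)
    finally show "B (?\<phi> x) (?\<phi> y) = B x y" by (simp flip: x_eq)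
    have "N (?\<phi> x) = t (B (p x) (w' x)) + N (z' x)"
      unfolding \<phi>_eq by (rule N_decomp[OF P(1,3)]) (use p w' z' in auto)
    also have "\<dots> = t (B (p x) (w x)) + N (z x)" by (simp add: B_pw N_z p)
    also have "\<dots> = N (p x + w x + z x)"
      by (rule N_decomp[OF P(1,2), symmetric]) (use p w z in auto)
    finally show "N (?\<phi> x) = N x" by (simp flip: x_eq)
  qed
  moreover have "?\<phi> ` \<pi> = \<pi>"
  proof -
    have "?\<phi> x = x" if x: "x \<in> \<pi>" for x
    proof -
      have Bx: "B x r = 0" if "r \<in> \<pi>" for r using P_B[OF P(1)] x that by blast
      have "w x = 0" "w' x = 0" unfolding w_def w'_def
        by (rule dual_eqI[OF \<pi> U \<pi>U], simp_all add: Bx vec.subspace_0 P_subspace P)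
           (rule dual_eqI[OF \<pi> W \<pi>W], simp_all add: Bx vec.subspace_0 P_subspace P)
      moreover have "p x = x" unfolding p_def \<open>w x = 0\<close>
        by (rule dual_eqI[OF U \<pi> U\<pi>]) (simp_all add: x)
      moreover have "dual W \<pi> 0 = 0"
        by (rule dual_eqI[OF W \<pi> W\<pi>]) (simp_all add: vec.subspace_0 P_subspace P)
      ultimately show ?thesis by (simp add: \<phi>_eq z'_def z_def)
    qed
    then show ?thesis by simp
  qed
  moreover have "?\<phi> ` U = W"
  proof -
    have "?\<phi> x = w' x" if x: "x \<in> U" for x
    proof -
      have "w x = x" unfolding w_def by (rule dual_eqI[OF \<pi> U \<pi>U]) (simp_all add: x)
      moreover have "dual U \<pi> 0 = 0"
        by (rule dual_eqI[OF U \<pi> U\<pi>]) (simp_all add: vec.subspace_0 P_subspace P)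
      moreover have "dual W \<pi> 0 = 0"
        by (rule dual_eqI[OF W \<pi> W\<pi>]) (simp_all add: vec.subspace_0 P_subspace P)
      ultimately show ?thesis by (simp add: \<phi>_eq z'_def z_def p_def)
    qed
    then have "?\<phi> ` U \<subseteq> W" using w' by auto
    moreover have "card (?\<phi> ` U) = card W"
      using isometry_bij[OF \<open>isometry ?\<phi>\<close>] card_generator[OF U] card_generator[OF W]
      by (metis bij_is_inj card_image inj_on_subset subset_UNIV)
    ultimately show ?thesis by (intro card_subset_eq) auto
  qed
  ultimately show thesis by (rule that)
qed

text \<open>A reflection, a symplectic transvection or a unitary quasi-reflection, depending on the type.\<close>

definition swap_map :: "'a ^ 'n \<Rightarrow> 'a ^ 'n \<Rightarrow> 'a ^ 'n \<Rightarrow> 'a ^ 'n" where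
  "swap_map p p' x = x + (B x (p - p') / B p p') *s (p - p')"

lemma isometry_swap_map:
  assumes p: "N p = 0" "N p' = 0" and b0: "B p p' \<noteq> 0"
  shows "isometry (swap_map p p')"
proof -
  define v where "v = p - p'"
  let ?v = v and ?b = "B p p'"
  have map_eq: "swap_map p p' x = x + (B x v / ?b) *s v" for x
    by (simp add: swap_map_def v_def)
  have sb0: "\<sigma> ?b \<noteq> 0" using b0 by (simp add: \<sigma>_eq_0)
  have \<sigma>_div: "\<sigma> (a / ?b) = \<sigma> a / \<sigma> ?b" for a
  proof -
    have "\<sigma> (a / ?b) * \<sigma> ?b = \<sigma> a" using b0 by (simp flip: \<sigma>_mult)
    then show ?thesis using sb0 by (simp add: field_simps)
  qed
  \<comment> \<open>The scalar \<open>1 / B p p'\<close> in \<open>swap_map\<close> is chosen so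
    that these values of \<open>B v v\<close> and \<open>N v\<close> cancel the cross terms.\<close>
  have Bvv: "B ?v ?v = - (?b + \<epsilon> * \<sigma> ?b)"
    using p by (simp add: v_def B_diff_left B_diff_right B_self B_swap[of p' p])
  have Nv: "N ?v = - t ?b"
    using N_add[of p "- p'"] p N_scale[of "- 1" p'] by (simp add: v_def B_uminus_right t_uminus)
  show ?thesis unfolding isometry_def
  proof (intro conjI allI)
    fix x y c
    show "swap_map p p' (x + y) = swap_map p p' x + swap_map p p' y"
      by (simp add: map_eq B_add_left add_divide_distrib vec.scale_left_distrib)
    show "swap_map p p' (c *s x) = c *s swap_map p p' x"
      by (simp add: map_eq B_scale_left vec.scale_right_distrib)
    have Bvy: "B ?v y = \<epsilon> * \<sigma> (B y ?v)" by (rule B_swap)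
    have "B (swap_map p p' x) (swap_map p p' y) = B x y + (B x ?v / ?b) * (\<epsilon> * \<sigma> (B y ?v))
        + (\<sigma> (B y ?v) / \<sigma> ?b) * B x ?v
        + (B x ?v / ?b) * ((\<sigma> (B y ?v) / \<sigma> ?b) * (- (?b + \<epsilon> * \<sigma> ?b)))"
      unfolding map_eq
      by (simp add: B_add_left B_add_right B_scale_left B_scale_right \<sigma>_div Bvv Bvy distrib_left ac_simps)
    also have "\<dots> = B x y" using b0 sb0 by (simp add: field_simps)
    finally show "B (swap_map p p' x) (swap_map p p' y) = B x y" .
    let ?c = "B x ?v / ?b"
    have "B x (?c *s ?v) = ?c * \<sigma> ?c * ?b"
      using b0 by (simp add: B_scale_right)
    then show "N (swap_map p p' x) = N x"
      unfolding map_eq by (simp only: N_add N_scale Nv t_norm) simp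
  qed
qed

text \<open>A vector \<open>p'\<close> of \<open>W\<close> outside \<open>U\<close> is not
  perpendicular to some \<open>p\<close> in \<open>U\<close>. The isometry
  \<open>swap_map p p'\<close> takes \<open>p\<close> to \<open>p'\<close> and fixes
  \<open>U \<inter> W\<close> pointwise, so the image of \<open>U\<close> meets \<open>W\<close> in
  a larger subspace.\<close>

lemma generator_transitive:
  assumes "U \<in> generators d P" "W \<in> generators d P"
  obtains \<phi> where "isometry \<phi>" "\<phi> ` U = W"
  using assms
proof (induction "d - vec.dim (U \<inter> W)" arbitrary: U thesis rule: less_induct)
  case less
  note U = less(3) and W = less(4)
  note PU = generatorsD(1)[OF U] and PW = generatorsD(1)[OF W]
  have sUW: "vec.subspace (U \<inter> W)" using PU PW by (intro vec.subspace_inter P_subspace)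
  show ?case
  proof (cases "W \<subseteq> U")
    case True
    then have "W = U" using subspace_eqI[OF P_subspace[OF PW] P_subspace[OF PU]] U W by (simp add: generatorsD)
    then show ?thesis using less(2)[OF isometry_id] by simp
  next
    case False
    then obtain p' where p': "p' \<in> W" "p' \<notin> U" by blast
    then obtain p where p: "p \<in> U" "B p p' \<noteq> 0"
      using generator_maximal[OF U P_N[OF PW p'(1)]] by (auto simp: mem_perp_swap)
    let ?\<phi> = "swap_map p p'"
    have \<phi>: "isometry ?\<phi>" using p p' P_N[OF PU] P_N[OF PW] by (intro isometry_swap_map) auto
    have \<phi>U: "?\<phi> ` U \<in> generators d P"
      by (rule automorphism_generator[OF isometry_automorphism[OF \<phi>] U])
    have "?\<phi> p = p'"
      using p P_B[OF PU p(1) p(1)] by (simp add: swap_map_def B_diff_right vec.scale_right_diff_distrib)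
    then have "p' \<in> ?\<phi> ` U" using p(1) by (metis imageI)
    moreover have "U \<inter> W \<subseteq> ?\<phi> ` U"
    proof
      fix x assume x: "x \<in> U \<inter> W"
      then have "?\<phi> x = x"
        using p(1) p'(1) P_B[OF PU] P_B[OF PW] by (simp add: swap_map_def B_diff_right)
      then show "x \<in> ?\<phi> ` U" using x by (intro image_eqI[of _ _ x]) auto
    qed
    ultimately have sub: "insert p' (U \<inter> W) \<subseteq> ?\<phi> ` U \<inter> W" using p'(1) by blast
    have "vec.dim (vec.span (insert p' (U \<inter> W))) = Suc (vec.dim (U \<inter> W))"
      using p' by (intro dim_span_insert sUW) simp
    then have "Suc (vec.dim (U \<inter> W)) \<le> vec.dim (?\<phi> ` U \<inter> W)"
      using vec.dim_subset[OF sub] by simp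
    moreover have "vec.dim (?\<phi> ` U \<inter> W) \<le> d"
      using vec.dim_subset[of "?\<phi> ` U \<inter> W" W] W by (simp add: generatorsD)
    ultimately have "d - vec.dim (?\<phi> ` U \<inter> W) < d - vec.dim (U \<inter> W)" by linarith
    from less(1)[OF this _ \<phi>U W] obtain \<psi> where \<psi>: "isometry \<psi>" "\<psi> ` ?\<phi> ` U = W" by blast
    show ?thesis
      by (rule less(2)[OF isometry_comp[OF \<psi>(1) \<phi>]]) (use \<psi>(2) in \<open>simp add: image_image\<close>)
  qed
qed

end

section \<open>Moebius inversion on subspaces\<close>

text \<open>The Moebius function of the lattice of subspaces of a \<open>j\<close>-dimensional space
  over the field of order \<open>q\<close>, from the zero subspace to the whole space.\<close>

definition subspace_moebius :: "real \<Rightarrow> nat \<Rightarrow> real" where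
  "subspace_moebius q j = (-1) ^ j * q ^ (j choose 2)"

text \<open>Such hyperplanes are the top members of the family of subspaces avoiding
  \<open>a\<close>. By exchange, adding \<open>y\<close> to \<open>W\<close> keeps \<open>a\<close>
  out exactly if \<open>y\<close> is outside the span of \<open>W\<close> and \<open>a\<close>. This
  leaves \<open>q * (q ^ t - q ^ k)\<close> vectors, hence a factor \<open>q\<close> at each of
  \<open>t = vec.dim T - 1\<close> steps.\<close>

lemma card_hyperplanes_avoiding:
  fixes T :: "('a::{field,finite} ^ 'n) set"
  assumes T: "vec.subspace T" and a: "a \<in> T" "a \<noteq> 0"
  shows "real (card {W. vec.subspace W \<and> W \<subseteq> T \<and> a \<notin> W \<and> Suc (vec.dim W) = vec.dim T})
    = real CARD('a) ^ (vec.dim T - 1)"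
proof -
  let ?F = "{W. vec.subspace W \<and> W \<subseteq> T \<and> a \<notin> W}" and ?t = "vec.dim T - 1" and ?q = "real CARD('a)"
  have "vec.dim T \<noteq> 0" using a by auto
  then have t: "vec.dim T = Suc ?t" by arith
  have "real (card {W \<in> ?F. vec.dim W = ?t \<and> {0} \<subseteq> W}) = (\<Prod>i\<in>{vec.dim {0::'a ^ 'n}..<?t}. ?q)"
  proof (rule count_top_members)
    fix W assume W: "W \<in> ?F"
    have sub: "vec.span (insert a W) \<subseteq> T" using W a T by (simp add: span_insert_subset)
    have dimW: "vec.dim (vec.span (insert a W)) = Suc (vec.dim W)"
      using W by (intro dim_span_insert) auto
    then show "vec.dim W \<le> ?t" using vec.dim_subset[OF sub] t by linarith
    have mem: "y \<in> {y. y \<notin> W \<and> vec.span (insert y W) \<in> ?F} \<longleftrightarrow> y \<in> T - vec.span (insert a W)" for y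
    proof -
      have W': "vec.span W = W" using W by simp
      have "a \<in> vec.span (insert y W) \<longleftrightarrow> y \<in> vec.span (insert a W)" if "y \<notin> W"
        using vec.in_span_insert[of a y W] vec.in_span_insert[of y a W] W W' that by auto
      moreover have "W \<subseteq> vec.span (insert a W)" by (meson insert_subset vec.span_superset)
      ultimately show ?thesis using W T by (auto simp: span_insert_subset)
    qed
    have "{y. y \<notin> W \<and> vec.span (insert y W) \<in> ?F} = T - vec.span (insert a W)"
      by (rule Set.set_eqI) (rule mem)
    then have "real (card {y. y \<notin> W \<and> vec.span (insert y W) \<in> ?F})
        = real (card T) - real (card (vec.span (insert a W)))"
      using sub by (simp only: card_Diff_subset[OF finite] card_mono[OF finite] of_nat_diff)
    also have "\<dots> = ?q ^ Suc ?t - ?q ^ Suc (vec.dim W)"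
    proof -
      obtain n where n: "vec.dim T = Suc n" using t by blast
      show ?thesis unfolding card_subspace[OF T] card_subspace[OF vec.subspace_span] dimW n by simp
    qed
    finally show "real (card {y. y \<notin> W \<and> vec.span (insert y W) \<in> ?F}) = ?q * (?q ^ ?t - ?q ^ vec.dim W)"
      by (simp add: algebra_simps)
  qed (use T a in \<open>auto simp: vec.subspace_0\<close>)
  moreover have "{W \<in> ?F. vec.dim W = ?t \<and> {0} \<subseteq> W}
      = {W. vec.subspace W \<and> W \<subseteq> T \<and> a \<notin> W \<and> Suc (vec.dim W) = vec.dim T}"
    using t vec.subspace_0 by auto
  ultimately show ?thesis by simp
qed

text \<open>Subspaces avoiding a fixed vector \<open>a\<close> are grouped by their join with \<open>a\<close>.\<close>

lemma sum_subspace_moebius: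
  fixes A :: "('a::{field,finite} ^ 'n) set"
  assumes A: "vec.subspace A"
  shows "(\<Sum>W | vec.subspace W \<and> W \<subseteq> A. subspace_moebius (real CARD('a)) (vec.dim W))
    = (if A = {0} then 1 else 0)"
proof (cases "A = {0}")
  case True
  have "W = {0}" if "vec.subspace W" "W \<subseteq> A" for W
    using that True vec.subspace_0[of W] by auto
  then have "{W. vec.subspace W \<and> W \<subseteq> A} = {{0}}" using True by auto
  then show ?thesis using True by (simp add: subspace_moebius_def binomial_eq_0)
next
  case False
  let ?\<mu> = "subspace_moebius (real CARD('a))"
  obtain a where a: "a \<in> A" "a \<noteq> 0" using False vec.subspace_0[OF A] by blast
  let ?S = "{W. vec.subspace W \<and> W \<subseteq> A}"
  let ?In = "{W \<in> ?S. a \<in> W}" and ?Out = "{W \<in> ?S. a \<notin> W}"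
  \<comment> \<open>The subspaces with join \<open>T\<close> are the hyperplanes of \<open>T\<close>
    avoiding \<open>a\<close>. There are \<open>q ^ t\<close> of them if
    \<open>vec.dim T = t + 1\<close>, and \<open>q ^ t\<close> times the value at \<open>t\<close>
    is minus the value at \<open>t + 1\<close>, so they cancel the term of \<open>T\<close>.\<close>
  have inner: "(\<Sum>W | W \<in> ?Out \<and> vec.span (insert a W) = T. ?\<mu> (vec.dim W)) = - ?\<mu> (vec.dim T)"
    if T: "T \<in> ?In" for T
  proof -
    have sT: "vec.subspace T" and aT: "a \<in> T" and TA: "T \<subseteq> A" using T by auto
    obtain t where t: "vec.dim T = Suc t" using aT a(2) by (cases "vec.dim T") auto
    have "W \<in> {W. W \<in> ?Out \<and> vec.span (insert a W) = T} \<longleftrightarrow>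
        W \<in> {W. vec.subspace W \<and> W \<subseteq> T \<and> a \<notin> W \<and> Suc (vec.dim W) = vec.dim T}" for W
    proof
      assume W: "W \<in> {W. W \<in> ?Out \<and> vec.span (insert a W) = T}"
      have "W \<subseteq> vec.span (insert a W)" by (meson insert_subset vec.span_superset)
      moreover have "vec.dim (vec.span (insert a W)) = Suc (vec.dim W)"
        using W by (intro dim_span_insert) auto
      ultimately show "W \<in> {W. vec.subspace W \<and> W \<subseteq> T \<and> a \<notin> W \<and> Suc (vec.dim W) = vec.dim T}"
        using W by auto
    next
      assume W: "W \<in> {W. vec.subspace W \<and> W \<subseteq> T \<and> a \<notin> W \<and> Suc (vec.dim W) = vec.dim T}"
      then have "vec.dim (vec.span (insert a W)) = vec.dim T"
        using dim_span_insert[of W a] by simp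
      then have "vec.span (insert a W) = T"
        using W aT sT by (intro subspace_eqI) (auto simp: span_insert_subset)
      then show "W \<in> {W. W \<in> ?Out \<and> vec.span (insert a W) = T}" using W TA by auto
    qed
    then have eq: "{W. W \<in> ?Out \<and> vec.span (insert a W) = T}
        = {W. vec.subspace W \<and> W \<subseteq> T \<and> a \<notin> W \<and> Suc (vec.dim W) = vec.dim T}"
      by (intro Set.set_eqI)
    have "(\<Sum>W | W \<in> ?Out \<and> vec.span (insert a W) = T. ?\<mu> (vec.dim W))
        = (\<Sum>W | vec.subspace W \<and> W \<subseteq> T \<and> a \<notin> W \<and> Suc (vec.dim W) = vec.dim T. ?\<mu> t)"
      unfolding eq using t by (intro sum.cong refl) simp
    also have "\<dots> = real CARD('a) ^ t * ?\<mu> t"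
      using card_hyperplanes_avoiding[OF sT aT a(2)] t by simp
    also have "\<dots> = - ?\<mu> (vec.dim T)"
      by (simp add: t subspace_moebius_def numeral_2_eq_2 power_add)
    finally show ?thesis .
  qed
  have "?S = ?In \<union> ?Out"
  proof (rule Set.set_eqI)
    fix W show "W \<in> ?S \<longleftrightarrow> W \<in> ?In \<union> ?Out" by (cases "a \<in> W") simp_all
  qed
  then have "(\<Sum>W\<in>?S. ?\<mu> (vec.dim W)) = (\<Sum>W\<in>?In \<union> ?Out. ?\<mu> (vec.dim W))" by (simp only:)
  also have "\<dots> = (\<Sum>W\<in>?In. ?\<mu> (vec.dim W)) + (\<Sum>W\<in>?Out. ?\<mu> (vec.dim W))"
    by (rule sum.union_disjoint) auto
  also have "(\<Sum>W\<in>?Out. ?\<mu> (vec.dim W))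
      = (\<Sum>T\<in>?In. \<Sum>W | W \<in> ?Out \<and> vec.span (insert a W) = T. ?\<mu> (vec.dim W))"
  proof (rule sum.group[symmetric])
    show "(\<lambda>W. vec.span (insert a W)) ` ?Out \<subseteq> ?In"
    proof (rule image_subsetI)
      fix W assume "W \<in> ?Out"
      then have "vec.span (insert a W) \<subseteq> A" using A a by (simp add: span_insert_subset)
      moreover have "a \<in> vec.span (insert a W)" by (simp add: vec.span_base)
      ultimately show "vec.span (insert a W) \<in> ?In" by simp
    qed
  qed auto
  also have "\<dots> = (\<Sum>T\<in>?In. - ?\<mu> (vec.dim T))" by (rule sum.cong[OF refl inner])
  also have "\<dots> = - (\<Sum>T\<in>?In. ?\<mu> (vec.dim T))" by (rule sum_negf)
  finally show ?thesis using False by simp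
qed

section \<open>Eigenvalues of the disjointness matrix\<close>

lemma subspace_eigenspace: "subspace (eigenspace M \<theta>)"
  unfolding eigenspace_def
  by (rule subspaceI) (auto simp: matrix_vector_right_distrib matrix_vector_mult_scaleR scaleR_add_right)

locale indexed_polar_space =
  polar_space B N \<sigma> t \<epsilon> d q e f P
  for B :: "'a::{field,finite} ^ 'n \<Rightarrow> 'a ^ 'n \<Rightarrow> 'a"
    and N :: "'a ^ 'n \<Rightarrow> 'a" and \<sigma> t :: "'a \<Rightarrow> 'a" and \<epsilon> :: 'a
    and d :: nat and q e f :: real and P :: "('a ^ 'n) set set" +
  fixes G :: "'g::finite \<Rightarrow> ('a ^ 'n) set"
  assumes G_bij: "bij_betw G UNIV (generators d P)"
begin

abbreviation K :: "real ^ 'g ^ 'g" where "K \<equiv> disjointness_matrix G"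

definition lift :: "nat \<Rightarrow> real ^ (('a ^ 'n) set) \<Rightarrow> real ^ 'g" where
  "lift k w = transpose (incidence_matrix P G k) *v w"

text \<open>This is \<open>opposite_count 1\<close>, whence \<open>\<theta> 1 = - m\<close>.\<close>

definition m :: real where
  "m = q powr (real ((d - 1) choose 2) + e * real (d - 1))"

definition opposite_count :: "nat \<Rightarrow> real" where
  "opposite_count k = q powr (real ((d - k) choose 2) + e * real (d - k))"

definition \<theta> :: "nat \<Rightarrow> real" where
  "\<theta> k = subspace_moebius q k * opposite_count k"

lemma G_gen: "G i \<in> generators d P"
  using G_bij by (auto simp: bij_betw_def)

lemma m_pos: "m > 0"
  using q_pos by (simp add: m_def)

lemma G_inj: "G i = G j \<longleftrightarrow> i = j"
  using G_bij by (auto simp: bij_betw_def inj_on_def)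

lemma card_index: "card {i. R (G i)} = card {T \<in> generators d P. R T}"
proof (rule bij_betw_same_card)
  have "generators d P = range G" using G_bij by (simp add: bij_betw_def)
  then show "bij_betw G {i. R (G i)} {T \<in> generators d P. R T}"
    using G_bij by (auto simp: bij_betw_def inj_on_def)
qed

lemma K_nth: "(K *v v) $ i = (\<Sum>j | G j \<inter> G i = {0}. v $ j)"
  unfolding disjointness_matrix_def matrix_vector_mult_def disjoint_subspaces_def
  by (simp add: sum.If_cases if_distrib[of "\<lambda>c. c * _"] Int_commute cong: if_cong)

lemma lift_nth: "lift k w $ i = (\<Sum>U | U \<in> P \<and> vec.dim U = k \<and> U \<subseteq> G i. w $ U)"
  unfolding lift_def incidence_matrix_def matrix_vector_mult_def transpose_def
  by (simp add: sum.If_cases if_distrib[of "\<lambda>c. c * _"] cong: if_cong)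

lemma K_symmetric: "(K *v x) \<bullet> y = x \<bullet> (K *v y)"
proof -
  have "transpose K = K"
    by (simp add: transpose_def disjointness_matrix_def disjoint_subspaces_def Int_commute vec_eq_iff)
  then show ?thesis by (metis dot_lmul_matrix transpose_matrix_vector)
qed

lemma K_all_one: "K *v all_one = (m * q powr (real d + e - 1)) *\<^sub>R all_one"
proof (rule vec_eq_iff[THEN iffD2], rule allI)
  fix i
  have "(K *v all_one) $ i = real (card {j. G j \<inter> G i = {0}})" by (simp add: K_nth all_one_def)
  also have "\<dots> = m * q powr (real d + e - 1)"
    unfolding card_index[of "\<lambda>T. T \<inter> G i = {0}"] card_opposite[OF G_gen] m_def ..
  finally show "(K *v all_one) $ i = ((m * q powr (real d + e - 1)) *\<^sub>R all_one) $ i"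
    by (simp add: all_one_def)
qed

lemma K_lift_nth:
  "(K *v lift k w) $ i
    = opposite_count k * (\<Sum>U | U \<in> P \<and> vec.dim U = k \<and> U \<inter> G i = {0}. w $ U)"
proof -
  let ?Pk = "{U \<in> P. vec.dim U = k}"
  have count: "real (card {j \<in> {j. G j \<inter> G i = {0}}. U \<subseteq> G j})
      = (if U \<inter> G i = {0} then opposite_count k else 0)" if U: "U \<in> ?Pk" for U
  proof (cases "U \<inter> G i = {0}")
    case True
    have "card {j \<in> {j. G j \<inter> G i = {0}}. U \<subseteq> G j}
        = card {T \<in> generators d P. U \<subseteq> T \<and> T \<inter> G i = {0}}"
      unfolding card_index[of "\<lambda>T. U \<subseteq> T \<and> T \<inter> G i = {0}", symmetric]
      by (simp add: conj_commute)
    then show ?thesis using card_opposite_above[OF _ G_gen True] U True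
      by (simp add: opposite_count_def)
  next
    case False
    have "0 \<in> U" "0 \<in> G i" using U G_gen by (simp_all add: vec.subspace_0 P_subspace generatorsD)
    then have "{j \<in> {j. G j \<inter> G i = {0}}. U \<subseteq> G j} = {}" using False by auto
    then show ?thesis using False by simp
  qed
  have "(K *v lift k w) $ i = (\<Sum>j | G j \<inter> G i = {0}. \<Sum>U | U \<in> ?Pk \<and> U \<subseteq> G j. w $ U)"
    by (simp add: K_nth lift_nth conj_assoc)
  also have "\<dots> = (\<Sum>U\<in>?Pk. \<Sum>j | j \<in> {j. G j \<inter> G i = {0}} \<and> U \<subseteq> G j. w $ U)"
    by (rule sum.swap_restrict) auto
  also have "\<dots> = (\<Sum>U\<in>?Pk. if U \<inter> G i = {0} then opposite_count k * w $ U else 0)"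
    using count by (intro sum.cong refl) simp
  also have "\<dots> = (\<Sum>U | U \<in> ?Pk \<and> U \<inter> G i = {0}. opposite_count k * w $ U)"
    by (rule sum.inter_filter[symmetric]) simp
  finally show ?thesis by (simp add: sum_distrib_left conj_assoc)
qed

text \<open>The condition \<open>U \<inter> G i = {0}\<close> is replaced by the Moebius sum over
  all subspaces \<open>W\<close> of \<open>U \<inter> G i\<close>. After exchanging the sums, the
  \<open>W\<close> of dimension \<open>j\<close> in \<open>G i\<close> make up a vector in the image
  of \<open>lift j\<close>.\<close>

lemma disjoint_sum_lift:
  "(\<Sum>U | U \<in> P \<and> vec.dim U = k \<and> U \<inter> G i = {0}. w $ U)
    = (\<Sum>j\<le>k. subspace_moebius q j *
        lift j (\<chi> W. \<Sum>U | U \<in> P \<and> vec.dim U = k \<and> W \<subseteq> U. w $ U) $ i)"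
proof -
  let ?Pk = "{U \<in> P. vec.dim U = k}" and ?\<mu> = "subspace_moebius q"
  let ?h = "\<lambda>W. \<Sum>U | U \<in> ?Pk \<and> W \<subseteq> U. w $ U"
  let ?S = "{W. vec.subspace W \<and> W \<subseteq> G i}"
  note sG = P_subspace[OF generatorsD(1)[OF G_gen]]
  have "(\<Sum>j\<le>k. ?\<mu> j * lift j (\<chi> W. ?h W) $ i)
      = (\<Sum>j\<le>k. \<Sum>W | W \<in> ?S \<and> vec.dim W = j. ?\<mu> (vec.dim W) * ?h W)"
  proof (rule sum.cong[OF refl])
    fix j
    have "{U. U \<in> P \<and> vec.dim U = j \<and> U \<subseteq> G i} = {W. W \<in> ?S \<and> vec.dim W = j}"
      using P_subspace P_down[OF generatorsD(1)[OF G_gen]] by blast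
    then have "?\<mu> j * lift j (\<chi> W. ?h W) $ i = ?\<mu> j * (\<Sum>W | W \<in> ?S \<and> vec.dim W = j. ?h W)"
      by (simp only: lift_nth vec_lambda_beta)
    also have "\<dots> = (\<Sum>W | W \<in> ?S \<and> vec.dim W = j. ?\<mu> j * ?h W)" by (rule sum_distrib_left)
    also have "\<dots> = (\<Sum>W | W \<in> ?S \<and> vec.dim W = j. ?\<mu> (vec.dim W) * ?h W)"
      by (rule sum.cong[OF refl]) simp
    finally show "?\<mu> j * lift j (\<chi> W. ?h W) $ i
        = (\<Sum>W | W \<in> ?S \<and> vec.dim W = j. ?\<mu> (vec.dim W) * ?h W)" .
  qed
  also have "\<dots> = (\<Sum>j\<le>k. \<Sum>W | W \<in> {W \<in> ?S. vec.dim W \<le> k} \<and> vec.dim W = j. ?\<mu> (vec.dim W) * ?h W)"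
    by (intro sum.cong refl) auto
  also have "\<dots> = (\<Sum>W | W \<in> ?S \<and> vec.dim W \<le> k. ?\<mu> (vec.dim W) * ?h W)"
    by (subst sum.group) (auto intro: sum.cong)
  \<comment> \<open>Terms with \<open>vec.dim W > k\<close> may be added, as no
    \<open>k\<close>-dimensional \<open>U\<close> contains such a \<open>W\<close>.\<close>
  also have "\<dots> = (\<Sum>W\<in>?S. ?\<mu> (vec.dim W) * ?h W)"
  proof (rule sum.mono_neutral_left)
    show "\<forall>W\<in>?S - {W. W \<in> ?S \<and> vec.dim W \<le> k}. ?\<mu> (vec.dim W) * ?h W = 0"
    proof
      fix W assume W: "W \<in> ?S - {W. W \<in> ?S \<and> vec.dim W \<le> k}"
      have "vec.dim W \<le> k" if "U \<in> ?Pk" "W \<subseteq> U" for U using that vec.dim_subset[of W U] by simp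
      then have "{U. U \<in> ?Pk \<and> W \<subseteq> U} = {}" using W by blast
      then show "?\<mu> (vec.dim W) * ?h W = 0" by (simp only: sum.empty mult_zero_right)
    qed
  qed auto
  also have "\<dots> = (\<Sum>W\<in>?S. \<Sum>U | U \<in> ?Pk \<and> W \<subseteq> U. ?\<mu> (vec.dim W) * w $ U)"
    by (simp add: sum_distrib_left)
  also have "\<dots> = (\<Sum>U\<in>?Pk. \<Sum>W | W \<in> ?S \<and> W \<subseteq> U. ?\<mu> (vec.dim W) * w $ U)"
    by (rule sum.swap_restrict) auto
  also have "\<dots> = (\<Sum>U\<in>?Pk. if U \<inter> G i = {0} then w $ U else 0)"
  proof (rule sum.cong[OF refl])
    fix U assume "U \<in> ?Pk"
    then have sUG: "vec.subspace (U \<inter> G i)" using sG by (intro vec.subspace_inter) (auto intro: P_subspace)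
    have "{W. W \<in> ?S \<and> W \<subseteq> U} = {W. vec.subspace W \<and> W \<subseteq> U \<inter> G i}" by blast
    then show "(\<Sum>W | W \<in> ?S \<and> W \<subseteq> U. ?\<mu> (vec.dim W) * w $ U) = (if U \<inter> G i = {0} then w $ U else 0)"
      using sum_subspace_moebius[OF sUG]
      by (simp only: sum_distrib_right[symmetric] q_eq[symmetric]) simp
  qed
  also have "\<dots> = (\<Sum>U | U \<in> ?Pk \<and> U \<inter> G i = {0}. w $ U)"
    by (rule sum.inter_filter[symmetric]) simp
  finally show ?thesis by (simp add: conj_assoc)
qed

text \<open>Thus \<open>K\<close> is triangular with respect to the flag of images of
  \<open>lift 0\<close>, ..., \<open>lift k\<close>, with diagonal entry
  \<open>\<theta> k\<close>.\<close>

lemma K_lift: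
  obtains h where "K *v lift k w = \<theta> k *\<^sub>R lift k w + (\<Sum>j<k. lift j (h j))"
proof -
  define u where "u = (\<chi> W. \<Sum>U | U \<in> P \<and> vec.dim U = k \<and> W \<subseteq> U. w $ U)"
  define h where "h j = (opposite_count k * subspace_moebius q j) *\<^sub>R u" for j
  \<comment> \<open>A \<open>k\<close>-dimensional \<open>W\<close> lies in only one
    \<open>k\<close>-dimensional \<open>U\<close>, namely itself. Hence the summand
    \<open>j = k\<close> is a multiple of the original \<open>lift k w\<close>.\<close>
  have "u $ W = w $ W" if "W \<in> P" "vec.dim W = k" for W
  proof -
    have "U = W" if "U \<in> P" "vec.dim U = k" "W \<subseteq> U" for U
      using subspace_eqI[OF P_subspace P_subspace, of W U] that \<open>W \<in> P\<close> \<open>vec.dim W = k\<close> by simp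
    then have "{U. U \<in> P \<and> vec.dim U = k \<and> W \<subseteq> U} = {W}" using that by blast
    then show ?thesis by (simp add: u_def)
  qed
  then have top: "lift k u $ i = lift k w $ i" for i by (simp add: lift_nth)
  have "K *v lift k w = \<theta> k *\<^sub>R lift k w + (\<Sum>j<k. lift j (h j))"
  proof (rule vec_eq_iff[THEN iffD2], rule allI)
    fix i
    have "(K *v lift k w) $ i = opposite_count k * (\<Sum>j\<le>k. subspace_moebius q j * lift j u $ i)"
      by (simp only: K_lift_nth disjoint_sum_lift u_def)
    also have "\<dots> = opposite_count k * (\<Sum>j<k. subspace_moebius q j * lift j u $ i) + \<theta> k * lift k w $ i"
      by (simp add: lessThan_Suc_atMost[symmetric] \<theta>_def top algebra_simps)
    also have "\<dots> = (\<theta> k *\<^sub>R lift k w + (\<Sum>j<k. lift j (h j))) $ i"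
      by (simp add: h_def lift_def matrix_vector_mult_scaleR sum_distrib_left mult.assoc
          del: transpose_matrix_vector)
    finally show "(K *v lift k w) $ i = (\<theta> k *\<^sub>R lift k w + (\<Sum>j<k. lift j (h j))) $ i" .
  qed
  then show thesis by (rule that)
qed

text \<open>The decomposition prescribes the images for \<open>k \<ge> 1\<close> only; this is the
  bottom step of the flag.\<close>

lemma range_lift_0: "range (lift 0) = span {all_one}"
proof -
  have eq: "{U. U \<in> P \<and> vec.dim U = 0 \<and> U \<subseteq> G i} = {{0}}" for i
  proof -
    have "U = {0}" if "U \<in> P" "vec.dim U = 0" for U
      using that vec.subspace_0[OF P_subspace[OF that(1)]] by (auto simp: vec.dim_eq_0)
    moreover have "0 \<in> G i" using G_gen by (simp add: vec.subspace_0 P_subspace generatorsD)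
    ultimately show ?thesis using zero_in_P by auto
  qed
  have lift0: "lift 0 w = w $ {0} *\<^sub>R all_one" for w
    unfolding vec_eq_iff lift_nth eq by (simp add: all_one_def)
  show ?thesis
  proof (intro equalityI subsetI)
    fix v assume "v \<in> range (lift 0)"
    then show "v \<in> span {all_one}" by (auto simp: lift0 span_mul span_base)
  next
    fix v assume "v \<in> span {all_one :: real ^ 'g}"
    then obtain c where "v = c *\<^sub>R all_one" by (auto simp: span_singleton)
    then have "v = lift 0 (\<chi> U. c)" by (simp add: lift0)
    then show "v \<in> range (lift 0)" by blast
  qed
qed

section \<open>The eigenspace decomposition diagonalises the disjointness matrix\<close>

context
  fixes V :: "nat \<Rightarrow> (real ^ 'g) set"
  assumes V: "eigenspace_decomposition d P G V"
begin

lemma V_orthogonal: "i \<le> d \<Longrightarrow> j \<le> d \<Longrightarrow> i \<noteq> j \<Longrightarrow> u \<in> V i \<Longrightarrow> v \<in> V j \<Longrightarrow> u \<bullet> v = 0"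
  using V unfolding eigenspace_decomposition_def orthogonal_def by blast

lemma V_span: "span (\<Union>k\<le>d. V k) = UNIV" and V_0: "V 0 = span {all_one}"
  using V unfolding eigenspace_decomposition_def by auto

lemma range_lift:
  assumes "k \<le> d"
  shows "range (lift k) = span (\<Union>i<Suc k. V i)"
proof (cases k)
  case 0
  then show ?thesis using range_lift_0 V_0 by (simp add: lessThan_Suc span_span)
next
  case (Suc r)
  then show ?thesis
    using V assms unfolding eigenspace_decomposition_def lessThan_Suc_atMost lift_def[abs_def] by auto
qed

text \<open>By triangularity, \<open>K *v v\<close> is \<open>\<theta> k *\<^sub>R v\<close> plus
  some \<open>r\<close> in the span of the lower \<open>V i\<close>. That span is invariant under
  \<open>K\<close> and orthogonal to \<open>v\<close>, so symmetry of \<open>K\<close> gives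
  \<open>0 = v \<bullet> (K *v r) = (K *v v) \<bullet> r = r \<bullet> r\<close>.\<close>

lemma V_eigenvector:
  assumes k: "k \<le> d" and v: "v \<in> V k"
  shows "K *v v = \<theta> k *\<^sub>R v"
proof -
  let ?W = "\<lambda>k. span (\<Union>i<k. V i)"
  have mono: "?W i \<subseteq> ?W j" if "i \<le> j" for i j by (intro span_mono UN_mono) (use that in auto)
  have lift_in: "lift j w \<in> ?W (Suc j)" if "j \<le> d" for j w using range_lift[OF that] by blast
  have "v \<in> ?W (Suc k)" using v by (intro span_base) auto
  then obtain w where w: "v = lift k w" using range_lift[OF k] by auto
  obtain h where h: "K *v lift k w = \<theta> k *\<^sub>R lift k w + (\<Sum>j<k. lift j (h j))" by (rule K_lift)
  define r where "r = (\<Sum>j<k. lift j (h j))"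
  have r: "r \<in> ?W k" unfolding r_def
  proof (rule span_sum)
    fix j assume "j \<in> {..<k}"
    then show "lift j (h j) \<in> ?W k" using lift_in[of j "h j"] mono[of "Suc j" k] k by auto
  qed
  have v_orth: "v \<bullet> u = 0" if "u \<in> ?W k" for u
  proof -
    have "orthogonal v u"
    proof (rule orthogonal_to_span[OF that])
      fix y assume "y \<in> (\<Union>i<k. V i)"
      then obtain i where "i < k" "y \<in> V i" by auto
      then show "orthogonal v y" using V_orthogonal[OF k, of i v y] v k by (simp add: orthogonal_def)
    qed
    then show ?thesis by (simp add: orthogonal_def)
  qed
  have "K *v r \<in> ?W k"
  proof (cases k)
    case 0
    then show ?thesis by (simp add: r_def span_0)
  next
    case (Suc l)
    then obtain w' where w': "r = lift l w'" using r range_lift[of l] k by auto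
    obtain h' where "K *v lift l w' = \<theta> l *\<^sub>R lift l w' + (\<Sum>j<l. lift j (h' j))" by (rule K_lift)
    moreover have "(\<Sum>j<l. lift j (h' j)) \<in> ?W k"
    proof (rule span_sum)
      fix j assume "j \<in> {..<l}"
      then show "lift j (h' j) \<in> ?W k" using lift_in[of j "h' j"] mono[of "Suc j" k] k Suc by auto
    qed
    ultimately show ?thesis using r w' by (simp add: span_add span_scale)
  qed
  then have "0 = v \<bullet> (K *v r)" by (simp add: v_orth)
  also have "\<dots> = (\<theta> k *\<^sub>R v + r) \<bullet> r" by (simp add: K_symmetric[symmetric] h w r_def)
  also have "\<dots> = r \<bullet> r" using v_orth[OF r] by (simp add: inner_add_left)
  finally have "r = 0" by simp
  then show ?thesis using h w r_def by simp
qed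

text \<open>Split an eigenvector into a part \<open>a\<close> from the \<open>V k\<close> with the
  right eigenvalue and a rest \<open>b\<close>. The rest is again an eigenvector for
  \<open>\<theta>'\<close>, so it is orthogonal to every \<open>V k\<close> with another eigenvalue,
  and therefore to itself.\<close>

lemma eigenspace_K:
  "eigenspace K \<theta>' = span (\<Union>k\<in>{k. k \<le> d \<and> \<theta> k = \<theta>'}. V k)"
proof
  let ?A = "\<Union>k\<in>{k. k \<le> d \<and> \<theta> k = \<theta>'}. V k" and ?B = "\<Union>k\<in>{k. k \<le> d \<and> \<theta> k \<noteq> \<theta>'}. V k"
  show AE: "span ?A \<subseteq> eigenspace K \<theta>'"
    by (rule span_minimal[OF _ subspace_eigenspace]) (auto simp: eigenspace_def V_eigenvector)
  show "eigenspace K \<theta>' \<subseteq> span ?A"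
  proof
    fix v assume v: "v \<in> eigenspace K \<theta>'"
    have "?A \<union> ?B = (\<Union>k\<le>d. V k)" by auto
    then have "v \<in> span (?A \<union> ?B)" using V_span by simp
    then obtain a b where ab: "a \<in> span ?A" "b \<in> span ?B" "v = a + b" by (auto simp: span_Un)
    have "v - a \<in> eigenspace K \<theta>'"
      by (rule subspace_diff[OF subspace_eigenspace v]) (use ab AE in blast)
    then have Kb: "K *v b = \<theta>' *\<^sub>R b" using ab by (simp add: eigenspace_def)
    have "orthogonal b u" if u: "u \<in> ?B" for u
    proof -
      obtain k where k: "k \<le> d" "\<theta> k \<noteq> \<theta>'" "u \<in> V k" using u by blast
      have "\<theta>' * (b \<bullet> u) = \<theta> k * (b \<bullet> u)"
        using K_symmetric[of b u] by (simp add: Kb V_eigenvector[OF k(1,3)])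
      then show ?thesis using k by (simp add: orthogonal_def)
    qed
    then have "orthogonal b b" using orthogonal_to_span[OF ab(2)] by blast
    then show "v \<in> span ?A" using ab by (simp add: orthogonal_self)
  qed
qed

end

section \<open>Spreads are orthogonal to the eigenspace\<close>

lemma isometry_permutation:
  assumes \<phi>: "isometry \<phi>"
  obtains \<rho> where "bij \<rho>" "\<And>i. G (\<rho> i) = \<phi> ` G i"
    "\<And>i j. G (\<rho> i) \<inter> G (\<rho> j) = {0} \<longleftrightarrow> G i \<inter> G j = {0}"
proof -
  have inj: "inj \<phi>" using isometry_bij[OF \<phi>] by (rule bij_is_inj)
  define \<rho> where "\<rho> i = the_inv_into UNIV G (\<phi> ` G i)" for i
  have \<rho>: "G (\<rho> i) = \<phi> ` G i" for i
    using f_the_inv_into_f_bij_betw[OF G_bij] automorphism_generator[OF isometry_automorphism[OF \<phi>] G_gen]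
    by (simp add: \<rho>_def)
  have "inj \<rho>"
    by (rule injI) (metis G_inj \<rho> inj inj_image_eq_iff)
  then have bij: "bij \<rho>" by (simp add: bij_def finite_UNIV_inj_surj)
  have disj: "G (\<rho> i) \<inter> G (\<rho> j) = {0} \<longleftrightarrow> G i \<inter> G j = {0}" for i j
  proof -
    have "G (\<rho> i) \<inter> G (\<rho> j) = {0} \<longleftrightarrow> \<phi> ` (G i \<inter> G j) = \<phi> ` {0}"
      by (simp add: \<rho> image_Int[OF inj] isometry_0[OF \<phi>])
    also have "\<dots> \<longleftrightarrow> G i \<inter> G j = {0}" by (rule inj_image_eq_iff[OF inj])
    finally show ?thesis .
  qed
  show thesis by (rule that[OF bij \<rho> disj])
qed

text \<open>
  Projections of unit vectors are unique, hence invariant under the stabiliser of the generator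
  in question. This replaces Delsarte's clique bound, of which spreads are the case of equality.
\<close>

lemma projection_constant:
  assumes g: "g \<in> eigenspace K \<theta>'" and orth: "\<And>u. u \<in> eigenspace K \<theta>' \<Longrightarrow> (axis i 1 - g) \<bullet> u = 0"
    and j: "G j \<inter> G i = {0}" and l: "G l \<inter> G i = {0}"
  shows "g $ j = g $ l"
proof -
  obtain \<phi> where \<phi>: "isometry \<phi>" "\<phi> ` G i = G i" "\<phi> ` G j = G l"
    by (rule stabiliser_transitive[OF G_gen G_gen G_gen j l])
  obtain \<rho> where \<rho>: "bij \<rho>" "\<And>i. G (\<rho> i) = \<phi> ` G i"
    "\<And>i j. G (\<rho> i) \<inter> G (\<rho> j) = {0} \<longleftrightarrow> G i \<inter> G j = {0}"
    by (rule isometry_permutation[OF \<phi>(1)], rule that)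
  have \<rho>ij: "\<rho> i = i" "\<rho> j = l" using \<rho>(2) \<phi> G_inj by metis+
  define T where "T v = (\<chi> j. v $ \<rho> j)" for v :: "real ^ 'g"
  have T_inner: "T x \<bullet> T y = x \<bullet> y" for x y
    unfolding inner_vec_def T_def using sum.reindex_bij_betw[OF \<rho>(1), of "\<lambda>j. x $ j \<bullet> y $ j"] by simp
  have T_diff: "T (x - y) = T x - T y" for x y by (simp add: T_def vec_eq_iff)
  have "K *v T v = T (K *v v)" for v
  proof (rule vec_eq_iff[THEN iffD2], rule allI)
    fix k
    have "(K *v T v) $ k = (\<Sum>j | G j \<inter> G k = {0}. v $ \<rho> j)" by (simp add: K_nth T_def)
    also have "\<dots> = (\<Sum>j | G j \<inter> G (\<rho> k) = {0}. v $ j)"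
    proof (rule sum.reindex_bij_betw)
      have "\<rho> ` {j. G j \<inter> G k = {0}} = {j. G j \<inter> G (\<rho> k) = {0}}"
      proof (intro equalityI subsetI)
        fix y assume y: "y \<in> {j. G j \<inter> G (\<rho> k) = {0}}"
        obtain y' where "y = \<rho> y'" using \<rho>(1) by (metis bij_pointE)
        then show "y \<in> \<rho> ` {j. G j \<inter> G k = {0}}" using y \<rho>(3) by simp
      next
        fix y assume "y \<in> \<rho> ` {j. G j \<inter> G k = {0}}"
        then obtain y' where "y = \<rho> y'" "G y' \<inter> G k = {0}" by (elim imageE CollectE) (rule that)
        then show "y \<in> {j. G j \<inter> G (\<rho> k) = {0}}" by (simp only: mem_Collect_eq \<rho>(3))
      qed
      moreover have "inj_on \<rho> {j. G j \<inter> G k = {0}}"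
        by (rule inj_on_subset[OF bij_is_inj[OF \<rho>(1)] subset_UNIV])
      ultimately show "bij_betw \<rho> {j. G j \<inter> G k = {0}} {j. G j \<inter> G (\<rho> k) = {0}}"
        by (simp only: bij_betw_def simp_thms)
    qed
    finally show "(K *v T v) $ k = T (K *v v) $ k" by (simp add: K_nth T_def)
  qed
  then have Tg: "T g \<in> eigenspace K \<theta>'" using g by (simp add: eigenspace_def) (simp add: T_def vec_eq_iff)
  have Ti: "T (axis i 1) = axis i 1"
    using \<rho>ij(1) bij_is_inj[OF \<rho>(1)] by (auto simp: T_def axis_def vec_eq_iff) (metis injD)
  let ?h = "axis i 1 - g"
  \<comment> \<open>Since \<open>T\<close> is orthogonal, commutes with \<open>K\<close> and fixes
    \<open>axis i 1\<close>, the vector \<open>T g\<close> is a point of the eigenspace at the same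
    distance from \<open>axis i 1\<close> as \<open>g\<close>. Pythagoras forces
    \<open>T g = g\<close>.\<close>
  have "T ?h = ?h + (g - T g)" by (simp add: T_diff Ti)
  then have "?h \<bullet> ?h = (?h + (g - T g)) \<bullet> (?h + (g - T g))" by (metis T_inner)
  moreover have "?h \<bullet> (g - T g) = 0"
    using orth subspace_diff[OF subspace_eigenspace g Tg] by blast
  moreover have "y \<bullet> y = 0" if "x \<bullet> x = (x + y) \<bullet> (x + y)" "x \<bullet> y = 0" for x y :: "real ^ 'g"
    using that by (simp add: inner_add_left inner_add_right inner_commute)
  ultimately have "(g - T g) \<bullet> (g - T g) = 0" by blast
  then have "g = T g" by simp
  then have "g $ j = T g $ j" by simp
  then show ?thesis by (simp add: T_def \<rho>ij)
qed

text \<open>The sum \<open>?h\<close> of the projections \<open>g i\<close> of the unit vectors of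
  \<open>S\<close> is the projection of \<open>char_vec G S\<close>. It vanishes once each
  \<open>g i\<close> is orthogonal to \<open>char_vec G S\<close>, because then
  \<open>?h \<bullet> ?h = 0\<close>.\<close>

lemma spread_orthogonal:
  assumes S: "is_spread d P S" and v: "v \<in> eigenspace K (- m)"
  shows "v \<bullet> char_vec G S = 0"
proof -
  let ?E = "eigenspace K (- m)" and ?Q = "q powr (real d + e - 1)" and ?I = "{i. G i \<in> S}"
  have span_E: "span ?E = ?E" using subspace_eigenspace by (simp add: span_eq_iff)
  have "\<exists>g. g \<in> ?E \<and> (\<forall>u\<in>?E. (axis i 1 - g) \<bullet> u = 0)" for i
  proof -
    obtain y z where "y \<in> span ?E" "\<And>w. w \<in> span ?E \<Longrightarrow> orthogonal z w" "axis i 1 = y + z"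
      using orthogonal_subspace_decomp_exists[of ?E "axis i 1"] by metis
    then show ?thesis by (intro exI[of _ y]) (simp add: span_E orthogonal_def)
  qed
  then obtain g where g: "\<And>i. g i \<in> ?E" "\<And>i u. u \<in> ?E \<Longrightarrow> (axis i 1 - g i) \<bullet> u = 0" by metis
  have inner_S: "u \<bullet> char_vec G S = (\<Sum>i\<in>?I. u $ i)" for u
    by (simp add: inner_vec_def char_vec_def if_distrib[of "\<lambda>c. _ * c"] sum.If_cases cong: if_cong)
  have inner_g: "u \<bullet> char_vec G S = u \<bullet> (\<Sum>i\<in>?I. g i)" if "u \<in> ?E" for u
  proof -
    have "u $ i = u \<bullet> g i" for i
      using g(2)[OF that, of i] by (simp add: inner_diff_left inner_axis' inner_commute[of u])
    then show ?thesis by (simp add: inner_S inner_sum_right)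
  qed
  have zero: "g i \<bullet> char_vec G S = 0" if i: "i \<in> ?I" for i
  proof -
    obtain U where U: "U \<in> generators d P" "U \<inter> G i = {0}" by (rule opposite_exists[OF G_gen])
    then have "U \<in> range G" using G_bij by (simp add: bij_betw_def)
    then obtain j where "U = G j" by (rule rangeE)
    with U have j: "G j \<inter> G i = {0}" by simp
    have const: "g i $ l = g i $ j" if "G l \<inter> G i = {0}" for l
      by (rule projection_constant[OF g(1,2)]) (use that j in auto)
    \<comment> \<open>Coordinate \<open>i\<close> of the eigenvalue equation sums the common value
      \<open>g i $ j\<close> over the \<open>m * ?Q\<close> opposite generators. Dividing by
      \<open>m\<close> leaves \<open>?Q\<close> copies, which is the number of members of
      \<open>S\<close> other than \<open>G i\<close>.\<close>
    have "- m * g i $ i = (K *v g i) $ i" using g(1)[of i] by (simp add: eigenspace_def)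
    also have "\<dots> = (\<Sum>l | G l \<inter> G i = {0}. g i $ j)" unfolding K_nth using const by simp
    also have "\<dots> = m * ?Q * g i $ j"
      using card_opposite[OF G_gen[of i]] card_index[of "\<lambda>T. T \<inter> G i = {0}"] by (simp add: m_def)
    finally have "m * (g i $ i + ?Q * g i $ j) = 0" by (simp add: algebra_simps)
    then have gi: "g i $ i + ?Q * g i $ j = 0" using m_pos by simp
    have "card ?I = card {T \<in> generators d P. T \<in> S}" by (rule card_index)
    also have "{T \<in> generators d P. T \<in> S} = S" using S by (auto simp: is_spread_def)
    finally have card_I: "card (?I - {i}) = card S - 1" using i by simp
    have "card S > 0" using i by (auto simp: card_gt_0_iff)
    then have "real (card (?I - {i})) = ?Q" using card_spread[OF S] card_I by simp
    moreover have "(\<Sum>l\<in>?I - {i}. g i $ l) = (\<Sum>l\<in>?I - {i}. g i $ j)"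
    proof (rule sum.cong[OF refl])
      fix l assume "l \<in> ?I - {i}"
      then have "G l \<inter> G i = {0}" using i G_inj by (intro spread_disjoint[OF S]) auto
      then show "g i $ l = g i $ j" by (rule const)
    qed
    moreover have "g i \<bullet> char_vec G S = g i $ i + (\<Sum>l\<in>?I - {i}. g i $ l)"
      unfolding inner_S using i by (intro sum.remove) auto
    ultimately show ?thesis using gi by simp
  qed
  let ?h = "\<Sum>i\<in>?I. g i"
  have "?h \<in> ?E" by (rule subspace_sum[OF subspace_eigenspace]) (rule g(1))
  then have "?h \<bullet> ?h = ?h \<bullet> char_vec G S" by (simp add: inner_g)
  also have "\<dots> = 0" unfolding inner_sum_left by (rule sum.neutral) (use zero in blast)
  finally have "?h = 0" by simp
  then show ?thesis using inner_g[OF v] by simp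
qed

end

section \<open>The classical forms\<close>

text \<open>For quadrics \<open>f = 1 / q\<close>, so the axiom \<open>param\<close> says that the
  ambient dimension is \<open>2 * d + e\<close>.\<close>

lemma powr_param:
  assumes "q > (0::real)" "real n = s + 1"
  shows "1 / q * q ^ n = q powr s"
  using assms by (simp add: powr_realpow[symmetric] powr_add)

text \<open>Here \<open>t\<close> is the identity, and \<open>t c = - N x\<close> is solved by one
  of the \<open>q\<close> scalars, so \<open>f = 1 / q\<close>.\<close>

lemma polar_space_quadric:
  fixes Q :: "'a::{field,finite} ^ 'n \<Rightarrow> 'a"
  assumes Q: "nondegenerate_quadratic_form Q" and n: "real CARD('n) = 2 * real d + e"
    and d: "d \<ge> 1" "\<exists>U\<in>quadric Q. vec.dim U = d" "\<And>U. U \<in> quadric Q \<Longrightarrow> vec.dim U \<le> d"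
  shows "polar_space (polar_form Q) Q (\<lambda>c. c) (\<lambda>c. c) 1 d (real CARD('a)) e (1 / real CARD('a)) (quadric Q)"
proof -
  have scale: "Q (c *s x) = c\<^sup>2 * Q x" for c x
    using Q by (simp add: nondegenerate_quadratic_form_def)
  have sesq: "sesquilinear (\<lambda>c. c) (polar_form Q)"
    using Q by (simp add: nondegenerate_quadratic_form_def)
  have "x + x = (1 + 1) *s x" for x :: "'a ^ 'n" by (simp only: vec.scale_left_distrib vec.scale_one)
  then have self: "Q x = 0 \<Longrightarrow> polar_form Q x x = 0" for x by (simp add: polar_form_def scale)
  have P: "quadric Q = {U. vec.subspace U \<and> (\<forall>x\<in>U. Q x = 0) \<and> (\<forall>x\<in>U. \<forall>y\<in>U. polar_form Q x y = 0)}"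
    unfolding quadric_def polar_form_def by (auto simp: vec.subspace_add)
  show ?thesis
  proof (unfold_locales)
    show "1 / real CARD('a) * real CARD('a) ^ CARD('n) = real CARD('a) powr (2 * real d + e - 1)"
      by (rule powr_param) (use n in auto)
    show "x = 0" if "Q x = 0" "\<And>y. polar_form Q x y = 0" for x
      using Q that by (simp add: nondegenerate_quadratic_form_def)
  qed (use sesq self d P in \<open>auto simp: sesquilinear_def scale power2_eq_square polar_form_def add.commute\<close>)
qed

text \<open>With \<open>N\<close> and \<open>t\<close> both zero, every scalar solves
  \<open>t c = - N x\<close>, so \<open>f = 1\<close>.\<close>

lemma polar_space_symplectic:
  fixes B :: "'a::{field,finite} ^ 'n \<Rightarrow> 'a ^ 'n \<Rightarrow> 'a"
  assumes B: "symplectic_form B" and n: "CARD('n) = 2 * d"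
    and d: "d \<ge> 1" "\<exists>U\<in>isotropic_subspaces B. vec.dim U = d"
      "\<And>U. U \<in> isotropic_subspaces B \<Longrightarrow> vec.dim U \<le> d"
  shows "polar_space B (\<lambda>_. 0) (\<lambda>c. c) (\<lambda>_. 0) (- 1) d (real CARD('a)) 1 1 (isotropic_subspaces B)"
proof -
  have sesq: "sesquilinear (\<lambda>c. c) B" and alt: "B x x = 0" for x
    using B by (auto simp: symplectic_form_def)
  have swap: "B y x = - B x y" for x y
  proof -
    have "B (x + y) (x + y) = B x x + B x y + (B y x + B y y)"
      using sesq unfolding sesquilinear_def by metis
    then show ?thesis by (simp add: alt add_eq_0_iff)
  qed
  have pow: "real CARD('a) ^ (2 * d) = real CARD('a) powr (2 * real d + 1 - 1)"
    by (simp flip: powr_realpow)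
  show ?thesis
  proof (unfold_locales)
    show "x = 0" if "\<And>y. B x y = 0" for x
      using B that by (auto simp: symplectic_form_def nondegenerate_def)
    show "B y x = - 1 * B x y" for x y using swap[of y x] by simp
    show "isotropic_subspaces B = {U. vec.subspace U \<and> (\<forall>x\<in>U. 0 = (0::'a)) \<and> (\<forall>x\<in>U. \<forall>y\<in>U. B x y = 0)}"
      by (simp add: isotropic_subspaces_def)
    show "1 * real CARD('a) ^ CARD('n) = real CARD('a) powr (2 * real d + 1 - 1)"
      using pow by (simp only: n mult_1)
  qed (use sesq d alt in \<open>auto simp: sesquilinear_def\<close>)
qed

text \<open>
  The map \<open>c \<mapsto> c + c ^ r\<close> has fibres of size at most \<open>r\<close> and its image lies in the at most
  \<open>r\<close> roots of \<open>a ^ r = a\<close>. As the field has \<open>r\<^sup>2\<close> elements, both bounds are attained.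
\<close>

lemma card_trace_fibre:
  fixes a :: "'a::{field,finite}"
  assumes r: "r\<^sup>2 = CARD('a)" and add: "\<And>x y :: 'a. (x + y) ^ r = x ^ r + y ^ r"
    and inv: "\<And>x :: 'a. (x ^ r) ^ r = x" and a: "a ^ r = a"
  shows "card {c. c + c ^ r = a} = r"
proof -
  have r2: "r \<ge> 2"
  proof (rule ccontr)
    assume "\<not> r \<ge> 2"
    then have "r = 0 \<or> r = 1" by linarith
    then have "r\<^sup>2 \<le> 1" by auto
    then show False using r card_field_ge2[where 'a = 'a] by simp
  qed
  \<comment> \<open>The polynomial has degree \<open>r\<close> because \<open>r \<ge> 2\<close>. The
    choice \<open>s = 1\<close> bounds the fibres of the trace, \<open>s = - 1\<close> with
    \<open>b = 0\<close> the set of fixed elements.\<close>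
  have roots: "card {c :: 'a. s * c + c ^ r = b} \<le> r" for s b
  proof -
    let ?p = "monom 1 r + [:- b, s:]"
    have deg: "degree ?p = r"
      using r2 by (subst degree_add_eq_left) (auto simp: degree_monom_eq)
    then have "?p \<noteq> 0" using r2 by auto
    then have "card {c. poly ?p c = 0} \<le> r" using card_poly_roots_bound[of ?p] deg by simp
    moreover have "{c. poly ?p c = 0} = {c. s * c + c ^ r = b}"
      by (auto simp: poly_monom algebra_simps add_eq_0_iff)
    ultimately show ?thesis by simp
  qed
  let ?F = "{b :: 'a. b ^ r = b}" and ?n = "\<lambda>b :: 'a. card {c. c + c ^ r = b}"
  have F: "card ?F \<le> r" using roots[of "- 1" 0] by (simp add: add_eq_0_iff)
  have n: "?n b \<le> r" for b using roots[of 1 b] by simp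
  have "c + c ^ r \<in> ?F" for c by (simp add: add inv add.commute)
  then have "UNIV = (\<Union>b\<in>?F. {c. c + c ^ r = b})" by auto
  then have "CARD('a) = card (\<Union>b\<in>?F. {c. c + c ^ r = b})" by simp
  also have "\<dots> = (\<Sum>b\<in>?F. ?n b)" by (rule card_UN_disjoint) auto
  also have "\<dots> = ?n a + (\<Sum>b\<in>?F - {a}. ?n b)" using a by (intro sum.remove) auto
  also have "(\<Sum>b\<in>?F - {a}. ?n b) \<le> (\<Sum>b\<in>?F - {a}. r)" by (rule sum_mono) (rule n)
  also have "\<dots> \<le> (r - 1) * r" using F a by (simp add: diff_le_mono)
  finally have "r * r \<le> ?n a + (r - 1) * r" using r by (simp add: power2_eq_square)
  then have "r \<le> ?n a" using r2 by (cases r) simp_all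
  then show ?thesis using n[of a] by simp
qed

text \<open>The value \<open>- B x x\<close> is fixed by \<open>c \<mapsto> c ^ r\<close>, so it is
  the trace of \<open>r\<close> of the \<open>r * r\<close> scalars, which gives
  \<open>f = 1 / r\<close>.\<close>

lemma polar_space_hermitian:
  fixes B :: "'a::{field,finite} ^ 'n \<Rightarrow> 'a ^ 'n \<Rightarrow> 'a"
  assumes B: "hermitian_form B" and n: "real CARD('n) = 2 * real d + e - 1 / 2"
    and d: "d \<ge> 1" "\<exists>U\<in>isotropic_subspaces B. vec.dim U = d"
      "\<And>U. U \<in> isotropic_subspaces B \<Longrightarrow> vec.dim U \<le> d"
  obtains r where "polar_space B (\<lambda>x. B x x) (\<lambda>c. c ^ r) (\<lambda>c. c + c ^ r) 1 d (real CARD('a)) e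
    (1 / real r) (isotropic_subspaces B)"
proof -
  obtain r where r: "r\<^sup>2 = CARD('a)" and sesq: "sesquilinear (\<lambda>c. c ^ r) B"
    and herm: "\<And>x y. B y x = B x y ^ r"
    using B by (auto simp: hermitian_form_def)
  have nondeg: "x = 0" if "\<And>y. B x y = 0" for x
    using B that by (auto simp: hermitian_form_def nondegenerate_def)
  have r0: "r > 0" using r by (cases "r = 0") auto
  obtain x0 y0 where b0: "B x0 y0 \<noteq> 0" using nondeg[of "axis undefined 1"] by (metis axis_eq_0_iff one_neq_zero)
  have scale_l: "B (c *s x) y = c * B x y" and scale_r: "B x (c *s y) = c ^ r * B x y"
    and add_l: "B (x + y) z = B x z + B y z" and add_r: "B x (y + z) = B x y + B x z" for c x y z
    using sesq by (auto simp: sesquilinear_def)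
  \<comment> \<open>That \<open>c \<mapsto> c ^ r\<close> is additive and an involution is read off
    from the form at a pair with \<open>B x0 y0 \<noteq> 0\<close>.\<close>
  have add: "(a + b) ^ r = a ^ r + b ^ r" for a b :: 'a
  proof -
    have "(a + b) ^ r * B x0 y0 = B x0 (a *s y0 + b *s y0)"
      by (simp only: scale_r[symmetric] vec.scale_left_distrib)
    also have "\<dots> = (a ^ r + b ^ r) * B x0 y0" by (simp add: add_r scale_r distrib_right)
    finally show ?thesis using b0 by simp
  qed
  have inv: "(c ^ r) ^ r = c" for c :: 'a
  proof -
    define x where "x = (c / B x0 y0) *s x0"
    have "B x y0 = c" using b0 by (simp add: x_def scale_l)
    moreover have "(B x y0 ^ r) ^ r = B x y0" by (simp only: herm[of x y0, symmetric] herm[of y0 x, symmetric])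
    ultimately show ?thesis by simp
  qed
  have minus: "(- a) ^ r = - (a ^ r)" for a :: 'a
  proof -
    have "a ^ r + (- a) ^ r = 0" using add[of a "- a"] r0 by (simp add: power_0_left)
    then show ?thesis by (simp add: add_eq_0_iff)
  qed
  have fibre: "real (card {c. c + c ^ r = - B x x}) = 1 / real r * real CARD('a)" for x
  proof -
    have "card {c. c + c ^ r = - B x x} = r"
      by (rule card_trace_fibre[OF r add inv]) (simp add: minus herm[of x x, symmetric])
    then show ?thesis using r r0 by (simp add: power2_eq_square flip: r)
  qed
  have param: "1 / real r * real CARD('a) ^ CARD('n) = real CARD('a) powr (2 * real d + e - 1)"
  proof -
    have "real r = real CARD('a) powr (1 / 2)"
      using r by (simp add: powr_half_sqrt flip: r)
    moreover have "real CARD('a) ^ CARD('n) = real CARD('a) powr (2 * real d + e - 1 / 2)"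
      by (simp add: powr_realpow[symmetric] n)
    ultimately show ?thesis by (simp add: powr_diff[symmetric])
  qed
  have "polar_space B (\<lambda>x. B x x) (\<lambda>c. c ^ r) (\<lambda>c. c + c ^ r) 1 d (real CARD('a)) e
    (1 / real r) (isotropic_subspaces B)"
  proof (unfold_locales)
    fix x y :: "'a ^ 'n" and a b c :: 'a
    show "B (c *s x) (c *s x) = c * c ^ r * B x x" by (simp add: scale_l scale_r)
    show "B (x + y) (x + y) = B x x + B y y + (B x y + B x y ^ r)"
      by (simp add: add_l add_r herm[of x y] inv)
    show "B y x = 1 * B x y ^ r" by (simp add: herm[of x y] inv)
    show "a + b + (a + b) ^ r = a + a ^ r + (b + b ^ r)" by (simp add: add)
    show "c * c ^ r * b + (c * c ^ r * b) ^ r = c * c ^ r * (b + b ^ r)"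
      by (simp add: power_mult_distrib inv algebra_simps)
  qed (use d nondeg fibre param r0 in
        \<open>auto simp: add_l add_r scale_l scale_r power_mult_distrib isotropic_subspaces_def\<close>)
  then show thesis by (rule that)
qed

lemma classical_polar_space_polar_space:
  fixes P :: "('a::{field,finite} ^ 'n) set set"
  assumes "classical_polar_space T d P"
  obtains B N \<sigma> t \<epsilon> f where "polar_space B N \<sigma> t \<epsilon> d (real CARD('a)) (polar_param T) f P"
proof -
  have d: "d \<ge> 1" "\<exists>U\<in>P. vec.dim U = d" "\<And>U. U \<in> P \<Longrightarrow> vec.dim U \<le> d"
    and n: "CARD('n) = ambient_dim T d" and form: "arises_from_form T P"
    using assms by (auto simp: classical_polar_space_def)
  show thesis
  proof (cases T)
    case Hyperbolic
    then obtain Q where "nondegenerate_quadratic_form Q" "P = quadric Q" using form by auto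
    then show thesis using polar_space_quadric[of Q d 0] d n Hyperbolic that by auto
  next
    case Parabolic
    then obtain Q where "nondegenerate_quadratic_form Q" "P = quadric Q" using form by auto
    then show thesis using polar_space_quadric[of Q d 1] d n Parabolic that by auto
  next
    case Elliptic
    then obtain Q where "nondegenerate_quadratic_form Q" "P = quadric Q" using form by auto
    then show thesis using polar_space_quadric[of Q d 2] d n Elliptic that by auto
  next
    case Symplectic
    then obtain B where "symplectic_form B" "P = isotropic_subspaces B" using form by auto
    then show thesis using polar_space_symplectic[of B d] d n Symplectic that by auto
  next
    case Hermitian_odd
    then obtain B where B: "hermitian_form B" "P = isotropic_subspaces B" using form by auto
    show thesis
      by (rule polar_space_hermitian[OF B(1), of d "1 / 2"])
         (use B d n Hermitian_odd that in auto)
  next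
    case Hermitian_even
    then obtain B where B: "hermitian_form B" "P = isotropic_subspaces B" using form by auto
    show thesis
      by (rule polar_space_hermitian[OF B(1), of d "3 / 2"])
         (use B d n Hermitian_even that in auto)
  qed
qed

section \<open>The equivalences\<close>

lemma real_choose_2: "real (n choose 2) = real n * (real n - 1) / 2"
  by (induction n) (simp_all add: numeral_2_eq_2 field_simps)

context indexed_polar_space
begin

text \<open>The exponent of \<open>\<theta> k\<close> is a quadratic polynomial in \<open>k\<close> symmetric about \<open>(d + e) / 2\<close>.\<close>

lemma \<theta>_eq_iff:
  assumes "k \<le> d"
  shows "\<theta> k = - m \<longleftrightarrow> odd k \<and> (real k = 1 \<or> real k = real d + e - 1)"
proof -
  let ?f = "\<lambda>k. real (k choose 2) + (real ((d - k) choose 2) + e * real (d - k))"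
  have \<theta>: "\<theta> k = (-1) ^ k * q powr ?f k"
    using q_pos by (simp add: \<theta>_def subspace_moebius_def opposite_count_def powr_add powr_realpow)
  have "?f k - ?f 1 = (real k - 1) * (real k - (real d + e - 1))"
    using assms rank_pos by (simp add: real_choose_2 of_nat_diff field_simps)
  then have f: "?f k = ?f 1 \<longleftrightarrow> real k = 1 \<or> real k = real d + e - 1" by auto
  have m: "m = q powr ?f 1" by (simp add: m_def numeral_2_eq_2)
  show ?thesis
  proof (cases "even k")
    case True
    then have "\<theta> k > 0" using \<theta> q_pos by simp
    then show ?thesis using True m_pos by simp
  next
    case False
    then have "\<theta> k = - m \<longleftrightarrow> q powr ?f k = q powr ?f 1" by (simp add: \<theta> m)
    also have "\<dots> \<longleftrightarrow> ?f k = ?f 1" using q_gt_1 by (intro powr_inj) auto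
    finally show ?thesis using False f by simp
  qed
qed

section \<open>Disjointness counts, the eigenspace of \<open>- m\<close>, and the
  decomposition\<close>

lemma K_char_vec:
  assumes "L \<subseteq> generators d P"
  shows "(K *v char_vec G L) $ i = real (card {U \<in> L. disjoint_subspaces U (G i)})"
proof -
  have "(K *v char_vec G L) $ i = real (card ({j. G j \<inter> G i = {0}} \<inter> {j. G j \<in> L}))"
    by (simp add: K_nth char_vec_def sum.If_cases)
  also have "{j. G j \<inter> G i = {0}} \<inter> {j. G j \<in> L} = {j. G j \<in> L \<and> G j \<inter> G i = {0}}" by auto
  also have "card \<dots> = card {T \<in> generators d P. T \<in> L \<and> T \<inter> G i = {0}}" by (rule card_index)
  also have "{T \<in> generators d P. T \<in> L \<and> T \<inter> G i = {0}} = {U \<in> L. disjoint_subspaces U (G i)}"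
    unfolding disjoint_subspaces_def
  proof (rule Set.set_eqI)
    fix U show "U \<in> {T \<in> generators d P. T \<in> L \<and> T \<inter> G i = {0}} \<longleftrightarrow> U \<in> {U \<in> L. U \<inter> G i = {0}}"
      using subsetD[OF assms, of U] by (cases "U \<in> L") simp_all
  qed
  finally show ?thesis .
qed

text \<open>Condition (i) is the coordinate form of
  \<open>K *v \<chi> = m *\<^sub>R (x *\<^sub>R all_one - \<chi>)\<close>. As \<open>all_one\<close>
  has eigenvalue \<open>m * Q\<close>, the shift by \<open>x / (Q + 1)\<close> times
  \<open>all_one\<close> makes this homogeneous, because
  \<open>Q / (Q + 1) = 1 - 1 / (Q + 1)\<close>.\<close>

lemma disjoint_count_iff_eigenspace:
  assumes "L \<subseteq> generators d P"
  shows "(\<forall>i. real (card {U \<in> L. disjoint_subspaces U (G i)}) = (x - char_vec G L $ i) * m)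
    \<longleftrightarrow> char_vec G L - (x / (q powr (real d + e - 1) + 1)) *\<^sub>R all_one \<in> eigenspace K (- m)"
proof -
  let ?Q = "q powr (real d + e - 1)" and ?\<chi> = "char_vec G L"
  let ?c = "x / (?Q + 1)"
  have Q: "?Q + 1 \<noteq> 0" using powr_ge_zero[of q "real d + e - 1"] by linarith
  have K_nth: "(K *v (?\<chi> - ?c *\<^sub>R all_one)) $ i = (K *v ?\<chi>) $ i - ?c * (m * ?Q)" for i
    by (simp add: matrix_vector_mult_diff_distrib matrix_vector_mult_scaleR K_all_one)
       (simp add: all_one_def)
  have split: "?c * (m * ?Q) = x * m - ?c * m" using Q by (simp add: field_simps)
  have rhs: "((- m) *\<^sub>R (?\<chi> - ?c *\<^sub>R all_one)) $ i = ?c * m - ?\<chi> $ i * m" for i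
    by (simp add: all_one_def right_diff_distrib mult.commute)
  have "(K *v (?\<chi> - ?c *\<^sub>R all_one)) $ i = ((- m) *\<^sub>R (?\<chi> - ?c *\<^sub>R all_one)) $ i
      \<longleftrightarrow> (K *v ?\<chi>) $ i = (x - ?\<chi> $ i) * m" for i
    unfolding K_nth rhs split left_diff_distrib by linarith
  then show ?thesis
    unfolding eigenspace_def mem_Collect_eq vec_eq_iff K_char_vec[OF assms, symmetric] by simp
qed

lemma inner_char_vec:
  assumes "S \<subseteq> generators d P"
  shows "char_vec G L \<bullet> char_vec G S = real (card (L \<inter> S))" and "all_one \<bullet> char_vec G S = real (card S)"
proof -
  have "char_vec G L \<bullet> char_vec G S = real (card {i. G i \<in> L \<inter> S})"
    unfolding inner_vec_def char_vec_def
    by (simp add: sum.If_cases if_distrib[of "\<lambda>c. _ * c"] Int_def conj_commute cong: if_cong)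
  also have "card {i. G i \<in> L \<inter> S} = card {T \<in> generators d P. T \<in> L \<inter> S}" by (rule card_index)
  also have "{T \<in> generators d P. T \<in> L \<inter> S} = L \<inter> S" using assms by blast
  finally show "char_vec G L \<bullet> char_vec G S = real (card (L \<inter> S))" .
  have "all_one \<bullet> char_vec G S = real (card {i. G i \<in> S})"
    unfolding inner_vec_def char_vec_def all_one_def by (simp add: sum.If_cases)
  also have "card {i. G i \<in> S} = card {T \<in> generators d P. T \<in> S}" by (rule card_index)
  also have "{T \<in> generators d P. T \<in> S} = S" using assms by blast
  finally show "all_one \<bullet> char_vec G S = real (card S)" .
qed

text \<open>For the converse the coefficient of \<open>all_one\<close> must be identified. The part
  in the eigenspace of \<open>- m\<close> is orthogonal to \<open>all_one\<close>, so pairing with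
  \<open>all_one\<close> gives coefficient times number of generators equal to
  \<open>card L\<close>; the last factor of that number is \<open>Q + 1\<close>.\<close>

lemma eigenspace_iff_decomposition:
  assumes V: "eigenspace_decomposition d P G V" and L: "L \<subseteq> generators d P"
    and x: "x = real (card L) / (\<Prod>i<d - 1. (q powr (e + real i) + 1))"
  shows "char_vec G L - (x / (q powr (real d + e - 1) + 1)) *\<^sub>R all_one \<in> eigenspace K (- m)
    \<longleftrightarrow> char_vec G L \<in> span (V 0 \<union> (\<Union>k\<in>{k. k \<le> d \<and> \<theta> k = - m}. V k))"
proof -
  let ?Q = "q powr (real d + e - 1)" and ?\<chi> = "char_vec G L"
  let ?c = "x / (?Q + 1)" and ?A = "\<Union>k\<in>{k. k \<le> d \<and> \<theta> k = - m}. V k"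
  have Q: "?Q + 1 > 0" using powr_ge_zero[of q "real d + e - 1"] by linarith
  have E: "eigenspace K (- m) = span ?A" by (rule eigenspace_K[OF V])
  have V0: "span (V 0) = span {all_one}" using V_0[OF V] by (simp add: span_span)
  show ?thesis
  proof
    assume "?\<chi> - ?c *\<^sub>R all_one \<in> eigenspace K (- m)"
    then have "?\<chi> - ?c *\<^sub>R all_one \<in> span (V 0 \<union> ?A)" unfolding E using span_mono[of ?A "V 0 \<union> ?A"] by blast
    moreover have "?c *\<^sub>R all_one \<in> span (V 0)" unfolding V0 by (intro span_mul span_base) simp
    then have "?c *\<^sub>R all_one \<in> span (V 0 \<union> ?A)" using span_mono[of "V 0" "V 0 \<union> ?A"] by blast
    ultimately have "(?\<chi> - ?c *\<^sub>R all_one) + ?c *\<^sub>R all_one \<in> span (V 0 \<union> ?A)" by (rule span_add)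
    then show "?\<chi> \<in> span (V 0 \<union> ?A)" by simp
  next
    assume "?\<chi> \<in> span (V 0 \<union> ?A)"
    then obtain u b where ub: "u \<in> span (V 0)" "b \<in> span ?A" "?\<chi> = u + b" unfolding span_Un by blast
    obtain \<alpha> where \<alpha>: "u = \<alpha> *\<^sub>R all_one" using ub(1) unfolding V0 by (auto simp: span_singleton)
    have b: "b \<in> eigenspace K (- m)" using ub(2) E by simp
    then have "- m * (b \<bullet> all_one) = (m * ?Q) * (b \<bullet> all_one)"
      using K_symmetric[of b all_one] by (simp add: K_all_one eigenspace_def)
    then have "(m * (?Q + 1)) * (b \<bullet> all_one) = 0" by (simp add: algebra_simps)
    then have b1: "b \<bullet> all_one = 0" using m_pos Q by simp
    have "char_vec G (generators d P) = all_one" using G_gen by (simp add: char_vec_def all_one_def)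
    then have "?\<chi> \<bullet> all_one = real (card (L \<inter> generators d P))"
      "all_one \<bullet> (all_one :: real ^ 'g) = real (card (generators d P))"
      using inner_char_vec[OF subset_refl] by metis+
    moreover have "L \<inter> generators d P = L" using L by blast
    ultimately have "\<alpha> * real (card (generators d P)) = real (card L)"
      using b1 by (simp add: ub(3) \<alpha> inner_add_left)
    moreover have "real (card (generators d P)) = (\<Prod>i<d - 1. q powr (e + real i) + 1) * (?Q + 1)"
    proof -
      obtain n where n: "d = Suc n" using rank_pos by (cases d) auto
      have eq: "real d + e - 1 = e + real n" by (simp add: n)
      show ?thesis unfolding card_generators eq by (simp add: n)
    qed
    moreover have "(\<Prod>i<d - 1. q powr (e + real i) + 1) > 0"
      by (intro prod_pos) (simp add: add_nonneg_pos)
    moreover have "\<alpha> = l / p / s" if "\<alpha> * r = l" "r = p * s" "p > 0" "s > 0" for l p r s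
      using that by auto
    ultimately have "\<alpha> = ?c" using Q unfolding x by blast
    then have "?\<chi> - ?c *\<^sub>R all_one = b" using ub(3) \<alpha> by simp
    then show "?\<chi> - ?c *\<^sub>R all_one \<in> eigenspace K (- m)" using b by simp
  qed
qed

section \<open>The conditions on spreads\<close>

lemma spread_intersection:
  assumes E: "char_vec G L - (x / (q powr (real d + e - 1) + 1)) *\<^sub>R all_one \<in> eigenspace K (- m)"
    and S: "is_spread d P S"
  shows "real (card (L \<inter> S)) = x"
proof -
  let ?Q = "q powr (real d + e - 1)"
  have Q: "?Q + 1 > 0" using powr_ge_zero[of q "real d + e - 1"] by linarith
  have SG: "S \<subseteq> generators d P" using S by (simp add: is_spread_def)
  have "real (card (L \<inter> S)) - (x / (?Q + 1)) * real (card S) = 0"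
    using spread_orthogonal[OF S E] by (simp add: inner_diff_left inner_char_vec[OF SG])
  then show ?thesis using Q by (simp add: card_spread[OF S])
qed

lemma card_spreads_through_le:
  assumes g: "polar_automorphism g" and C: "\<And>S. S \<in> C \<Longrightarrow> is_spread d P S"
    and closed: "\<And>S. S \<in> C \<Longrightarrow> g ` S \<in> C"
  shows "card {S \<in> C. \<pi> \<in> S \<and> U \<in> S} \<le> card {S \<in> C. g \<pi> \<in> S \<and> g U \<in> S}"
proof (rule card_inj_on_le[where f = "(`) g"])
  have "S \<subseteq> P" if "S \<in> C" for S using C[OF that] by (auto simp: is_spread_def generators_def)
  then show "inj_on ((`) g) {S \<in> C. \<pi> \<in> S \<and> U \<in> S}"
    using inj_on_image_eq_iff[OF automorphism_inj[OF g]] by (auto simp: inj_on_def)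
  show "(`) g ` {S \<in> C. \<pi> \<in> S \<and> U \<in> S} \<subseteq> {S \<in> C. g \<pi> \<in> S \<and> g U \<in> S}"
    using closed by auto
qed simp

text \<open>The class of all spreads is invariant under isometries:
  \<open>generator_transitive\<close> moves the given spread onto one through \<open>G i\<close>,
  and \<open>stabiliser_transitive\<close> makes the number of spreads through \<open>G i\<close>
  and an opposite generator constant.\<close>

lemma disjoint_count_if_all_spreads:
  assumes ex: "is_spread d P S0" and L: "L \<subseteq> generators d P"
    and x: "\<And>S. is_spread d P S \<Longrightarrow> real (card (L \<inter> S)) = x"
  shows "real (card {U \<in> L. disjoint_subspaces U (G i)}) = (x - char_vec G L $ i) * m"
proof -
  have "real (card {U \<in> L. U \<inter> G i = {0}}) = (x - (if G i \<in> L then 1 else 0)) * m"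
    unfolding m_def
  proof (rule count_via_spreads[where C = "{S. is_spread d P S}"])
    have "real (card S0) > 0" using card_spread[OF ex] powr_ge_zero[of q "real d + e - 1"] by linarith
    then obtain U0 where U0: "U0 \<in> S0" by (metis card.empty ex_in_conv less_irrefl of_nat_0)
    then have "U0 \<in> generators d P" using ex by (auto simp: is_spread_def)
    then obtain \<phi> where \<phi>: "isometry \<phi>" "\<phi> ` U0 = G i" by (rule generator_transitive[OF _ G_gen])
    have "is_spread d P ((`) \<phi> ` S0)" by (rule automorphism_spread[OF isometry_automorphism[OF \<phi>(1)] ex])
    moreover have "G i \<in> (`) \<phi> ` S0" using U0 \<phi>(2) by blast
    ultimately show "\<exists>S\<in>{S. is_spread d P S}. G i \<in> S" by blast
  next
    fix U W assume UW: "U \<in> generators d P" "W \<in> generators d P" "U \<inter> G i = {0}" "W \<inter> G i = {0}"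
    obtain \<phi> where \<phi>: "isometry \<phi>" "\<phi> ` G i = G i" "\<phi> ` U = W"
      by (rule stabiliser_transitive[OF G_gen UW])
    note aut = isometry_automorphism[OF \<phi>(1)]
    have "card {S \<in> {S. is_spread d P S}. G i \<in> S \<and> U \<in> S}
        \<le> card {S \<in> {S. is_spread d P S}. \<phi> ` G i \<in> S \<and> \<phi> ` U \<in> S}"
      by (rule card_spreads_through_le[OF aut]) (auto intro: automorphism_spread[OF aut])
    then show "card {S \<in> {S. is_spread d P S}. G i \<in> S \<and> U \<in> S}
        \<le> card {S \<in> {S. is_spread d P S}. G i \<in> S \<and> W \<in> S}" using \<phi> by simp
  qed (use L x G_gen in auto)
  then show ?thesis by (simp add: disjoint_subspaces_def char_vec_def)
qed

context
  fixes A :: "(('a ^ 'n) set \<Rightarrow> ('a ^ 'n) set) set" and C :: "('a ^ 'n) set set set"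
  assumes A: "automorphism_group P A" and C: "union_of_spread_orbits d P A C"
begin

lemma group_automorphism: "g \<in> A \<Longrightarrow> polar_automorphism g"
  using A subgroup.subset[of A "BijGroup P"]
  by (auto simp: automorphism_group_def polar_automorphism_def BijGroup_def Bij_def)

lemma orbit_spread: "S \<in> C \<Longrightarrow> is_spread d P S"
  using C by (auto simp: union_of_spread_orbits_def spread_orbit_def
      intro: automorphism_spread[OF group_automorphism])

lemma orbit_closed:
  assumes g: "g \<in> A" and S: "S \<in> C"
  shows "g ` S \<in> C"
proof -
  obtain R where R: "\<And>S. S \<in> R \<Longrightarrow> is_spread d P S" "C = (\<Union>S\<in>R. spread_orbit A S)"
    using C by (auto simp: union_of_spread_orbits_def)
  obtain S' h where S': "S' \<in> R" "h \<in> A" "S = h ` S'" using S R(2) by (auto simp: spread_orbit_def)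
  have sub: "subgroup A (BijGroup P)" using A by (simp add: automorphism_group_def)
  have "g \<in> Bij P" "h \<in> Bij P" using subgroup.subset[OF sub] g S'(2) by (auto simp: BijGroup_def)
  then have "compose P g h \<in> A"
    using subgroup.m_closed[OF sub g S'(2)] by (simp add: BijGroup_def)
  \<comment> \<open>The product in \<open>BijGroup P\<close> is composition restricted to
    \<open>P\<close>, which agrees with plain composition on \<open>S'\<close>.\<close>
  moreover have "S' \<subseteq> P" using R(1)[OF S'(1)] by (auto simp: is_spread_def generators_def)
  then have "g ` S = compose P g h ` S'" unfolding S'(3) by (auto simp: compose_def image_iff)
  ultimately show ?thesis using R(2) S'(1) by (auto simp: spread_orbit_def)
qed

lemma orbit_nonempty: "C \<noteq> {}"
proof -
  have "\<one>\<^bsub>BijGroup P\<^esub> \<in> A" using A by (simp add: automorphism_group_def subgroup.one_closed)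
  then show ?thesis using C by (auto simp: union_of_spread_orbits_def spread_orbit_def)
qed

lemma disjoint_count_if_orbit_spreads:
  assumes trans: "transitive_on_disjoint_pairs d P A" and L: "L \<subseteq> generators d P"
    and x: "\<And>S. S \<in> C \<Longrightarrow> real (card (L \<inter> S)) = x"
  shows "real (card {U \<in> L. disjoint_subspaces U (G i)}) = (x - char_vec G L $ i) * m"
proof -
  have "real (card {U \<in> L. U \<inter> G i = {0}}) = (x - (if G i \<in> L then 1 else 0)) * m"
    unfolding m_def
  proof (rule count_via_spreads[where C = C])
    obtain S where S: "S \<in> C" using orbit_nonempty by blast
    note sp = orbit_spread[OF S]
    \<comment> \<open>Transitivity is given on disjoint pairs only, so a second member of
      \<open>S\<close> and an opposite of \<open>G i\<close> are needed to move a member of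
      \<open>S\<close> to \<open>G i\<close>.\<close>
    have "real (card S) > 1" using card_spread[OF sp] q_pos by simp
    then have "\<not> is_singleton S" "S \<noteq> {}" by (auto simp: is_singleton_altdef)
    then obtain U1 U2 where U: "U1 \<in> S" "U2 \<in> S" "U1 \<noteq> U2" by (metis is_singletonI')
    have gen: "U1 \<in> generators d P" "U2 \<in> generators d P" using U sp by (auto simp: is_spread_def)
    obtain W where W: "W \<in> generators d P" "W \<inter> G i = {0}" by (rule opposite_exists[OF G_gen])
    obtain g where g: "g \<in> A" "g U1 = G i"
      using trans gen W G_gen[of i] spread_disjoint[OF sp U]
      unfolding transitive_on_disjoint_pairs_def disjoint_subspaces_def by (metis Int_commute)
    have "G i \<in> g ` S" using U(1) g(2) by (metis imageI)
    then show "\<exists>S\<in>C. G i \<in> S" using orbit_closed[OF g(1) S] by blast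
  next
    fix U W assume UW: "U \<in> generators d P" "W \<in> generators d P" "U \<inter> G i = {0}" "W \<inter> G i = {0}"
    obtain g where g: "g \<in> A" "g (G i) = G i" "g U = W"
      using trans UW G_gen[of i]
      unfolding transitive_on_disjoint_pairs_def disjoint_subspaces_def by (metis Int_commute)
    show "card {S \<in> C. G i \<in> S \<and> U \<in> S} \<le> card {S \<in> C. G i \<in> S \<and> W \<in> S}"
      using card_spreads_through_le[OF group_automorphism[OF g(1)] orbit_spread orbit_closed[OF g(1)], of "G i" U] g
      by simp
  qed (use L x G_gen orbit_spread in auto)
  then show ?thesis by (simp add: disjoint_subspaces_def char_vec_def)
qed

end

end

theorem theorem3p7:
  fixes P :: "('a::{field,finite} ^ 'n) set set"
    and T :: polar_type
    and d :: nat
    and q e x :: real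
    and G :: "'g::finite \<Rightarrow> ('a ^ 'n) set"
    and V :: "nat \<Rightarrow> (real ^ 'g) set"
    and L :: "('a ^ 'n) set set"
    and \<chi>L :: "real ^ 'g"
    and K :: "real ^ 'g ^ 'g"
  assumes polar: "classical_polar_space T d P"
    and q: "q = real CARD('a)"
    and e: "e = polar_param T"
    and G: "bij_betw G UNIV (generators d P)"
    and V: "eigenspace_decomposition d P G V"
    and L: "L \<subseteq> generators d P"
    and \<chi>L: "\<chi>L = char_vec G L"
    and K: "K = disjointness_matrix G"
    and x: "x = real (card L) / (\<Prod>i<d - 1. (q powr (e + real i) + 1))"
  shows
    "let m = q powr (real ((d - 1) choose 2) + e * real (d - 1));
         i = (\<forall>g. real (card {U \<in> L. disjoint_subspaces U (G g)}) = (x - \<chi>L $ g) * m);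
         ii = (\<chi>L - (x / (q powr (real d + e - 1) + 1)) *\<^sub>R all_one \<in> eigenspace K (- m));
         iii = (\<chi>L \<in> (if even d \<and> e = 0 then span (V 0 \<union> V 1 \<union> V (d - 1))
                      else if odd d \<and> e = 1 then span (V 0 \<union> V 1 \<union> V d)
                      else span (V 0 \<union> V 1)));
         iv = (\<forall>S. is_spread d P S \<longrightarrow> real (card (L \<inter> S)) = x);
         v = (\<lambda>C. \<forall>S\<in>C. real (card (L \<inter> S)) = x)
     in (i \<longleftrightarrow> ii) \<and> (ii \<longleftrightarrow> iii) \<and>
        ((\<exists>S. is_spread d P S) \<longrightarrow>
           (i \<longleftrightarrow> iv) \<and>
           (\<forall>A C. automorphism_group P A \<and> transitive_on_disjoint_pairs d P A \<and>
                  union_of_spread_orbits d P A C \<longrightarrow> (i \<longleftrightarrow> v C)))"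
proof -
  obtain B N \<sigma> t \<epsilon> f where ps: "polar_space B N \<sigma> t \<epsilon> d q e f P"
    using classical_polar_space_polar_space[OF polar] unfolding q e by blast
  interpret ips: indexed_polar_space B N \<sigma> t \<epsilon> d q e f P G
    by (intro indexed_polar_space.intro ps indexed_polar_space_axioms.intro G)
  define i where "i \<longleftrightarrow> (\<forall>g. real (card {U \<in> L. disjoint_subspaces U (G g)}) = (x - \<chi>L $ g) * ips.m)"
  define ii where "ii \<longleftrightarrow> \<chi>L - (x / (q powr (real d + e - 1) + 1)) *\<^sub>R all_one \<in> eigenspace K (- ips.m)"
  have i_ii: "i \<longleftrightarrow> ii"
    unfolding i_def ii_def \<chi>L K by (rule ips.disjoint_count_iff_eigenspace[OF L])
  let ?I = "{k. k \<le> d \<and> ips.\<theta> k = - ips.m}"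
  have e_cases: "e = 0 \<or> e = 1 / 2 \<or> e = 1 \<or> e = 3 / 2 \<or> e = 2" unfolding e by (cases T) auto
  \<comment> \<open>Besides \<open>k = 1\<close>, an odd \<open>k = d + e - 1\<close> with
    \<open>k \<le> d\<close> is possible. This needs \<open>d\<close> even if \<open>e = 0\<close>
    and \<open>d\<close> odd if \<open>e = 1\<close>; it is not an integer for
    \<open>e = 1 / 2\<close> or \<open>e = 3 / 2\<close>, and exceeds \<open>d\<close> for
    \<open>e = 2\<close>.\<close>
  have I: "?I = {1} \<union> (if even d \<and> e = 0 then {d - 1} else if odd d \<and> e = 1 then {d} else {})"
  proof (rule Set.set_eqI)
    fix k
    have d: "d \<ge> 1" by (rule ips.rank_pos)
    have "k \<in> ?I \<longleftrightarrow> k \<le> d \<and> odd k \<and> (k = 1 \<or> real k = real d + e - 1)"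
      using ips.\<theta>_eq_iff[of k] by auto
    also have "\<dots> \<longleftrightarrow> k = 1 \<or> k \<le> d \<and> odd k \<and> (e = 0 \<and> k = d - 1 \<or> e = 1 \<and> k = d)"
    proof -
      have "real k = real d + e - 1 \<longleftrightarrow> e = 0 \<and> k = d - 1 \<or> e = 1 \<and> k = d" if "k \<le> d"
        using e_cases
      proof (elim disjE)
        assume e: "e = 1 / 2"
        have "2 * k + 1 \<noteq> 2 * d" by presburger
        then have "real (2 * k + 1) \<noteq> real (2 * d)" by (simp only: of_nat_eq_iff not_False_eq_True)
        then have "real k \<noteq> real d + e - 1" unfolding e by auto
        then show ?thesis using e by simp
      next
        assume e: "e = 3 / 2"
        have "2 * k \<noteq> 2 * d + 1" by presburger
        then have "real (2 * k) \<noteq> real (2 * d + 1)" by (simp only: of_nat_eq_iff not_False_eq_True)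
        then have "real k \<noteq> real d + e - 1" unfolding e by auto
        then show ?thesis using e by simp
      qed (use d that in auto)
      then show ?thesis using d by auto
    qed
    also have "\<dots> \<longleftrightarrow> k \<in> {1} \<union> (if even d \<and> e = 0 then {d - 1} else if odd d \<and> e = 1 then {d} else {})"
      using d by auto
    finally show "k \<in> ?I \<longleftrightarrow> k \<in> {1} \<union> (if even d \<and> e = 0 then {d - 1} else if odd d \<and> e = 1 then {d} else {})" .
  qed
  have "ii \<longleftrightarrow> \<chi>L \<in> span (V 0 \<union> (\<Union>k\<in>?I. V k))"
    unfolding ii_def \<chi>L K by (rule ips.eigenspace_iff_decomposition[OF V L x])
  then have ii_iii: "ii \<longleftrightarrow> \<chi>L \<in> (if even d \<and> e = 0 then span (V 0 \<union> V 1 \<union> V (d - 1))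
      else if odd d \<and> e = 1 then span (V 0 \<union> V 1 \<union> V d) else span (V 0 \<union> V 1))"
    unfolding I by (simp add: Un_assoc)
  have spread: "real (card (L \<inter> S)) = x" if "i" "is_spread d P S" for S
    by (rule ips.spread_intersection) (use that i_ii in \<open>simp_all add: ii_def \<chi>L K\<close>)
  have iv: "i" if "is_spread d P S0" "\<forall>S. is_spread d P S \<longrightarrow> real (card (L \<inter> S)) = x" for S0
    unfolding i_def \<chi>L using ips.disjoint_count_if_all_spreads[OF that(1) L] that(2) by blast
  have v: "i \<longleftrightarrow> (\<forall>S\<in>C. real (card (L \<inter> S)) = x)"
    if "automorphism_group P A" "transitive_on_disjoint_pairs d P A" "union_of_spread_orbits d P A C" for A C
  proof
    assume "i"
    then show "\<forall>S\<in>C. real (card (L \<inter> S)) = x"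
      using spread ips.orbit_spread[OF that(1,3)] by blast
  next
    assume "\<forall>S\<in>C. real (card (L \<inter> S)) = x"
    then show "i"
      unfolding i_def \<chi>L using ips.disjoint_count_if_orbit_spreads[OF that(1,3,2) L] by blast
  qed
  show ?thesis
    unfolding Let_def ips.m_def[symmetric] i_def[symmetric] ii_def[symmetric]
    using i_ii ii_iii spread iv v by blast
qed

end
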